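(* Let $M$ be a connected complete Riemannian manifold of dimension $n$ and let $p$ be an integer with $1\le p\le n$. Assume that the stochastic differential equation $dx_t=X(x_t)\circ dB_t+A(x_t)\,dt$ on $M$ is complete at one point. Suppose that for each positive number $t$ and each compact set $K\subset M$ there is a number $\delta>0$ such that $$\sup_{x\in K}E\left(\sup_{s\le t}|T_xF_s|^{p+\delta}\chi_{\{s<\xi(x)\}}\right)<\infty .$$ Then $\xi^K=\infty$ almost surely for each $K\in L_p$. In particular the equation is strongly $p$-complete.
   Context: Setting: $B_t$ is an $m$-dimensional Brownian motion on a filtered probability space; $X:\mathbb{R}^m\times M\to TM$ is $C^2$ with $X(x):\mathbb{R}^m\to T_xM$ linear for each $x$; $A$ is a $C^2$ vector field; the equation is a Stratonovich equation. $F_t(x)$, $0\le t<\xi(x)$, denotes the maximal solution starting at $x$ with explosion time $\xi(x)$, always taken to be the partial flow: almost surely, for all $t$, $M_t(\omega)=\{x: t<\xi(x,\omega)\}$ is open, $F_t(\cdot,\omega):M_t(\omega)\to M$ is a $C^1$ diffeomorphism onto an open subset of $M$, continuous in $t$ for $C^1$ convergence on compacta, and for compact $K$ with $\xi^K=\inf_{x\in K}\xi(x)$ one has $\lim_{t\nearrow\xi^K}\sup_{x\in K}d(x_0,F_t(x))=\infty$ almost surely on $\{\xi^K<\infty\}$. $T_xF_t$ is the derivative of $F_t$ at $x$ and $|T_xF_t|$ its operator norm; $\chi$ denotes an indicator function. The equation is complete at one point if there is $x_0\in M$ with $\xi(x_0)=\infty$ a.s. $L_p$ is the set of all images of Lipschitz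 maps from $[0,1]^p$ to $M$. Let $S_p$ be the set of images of all smooth singular $p$-simplices in $M$ (smooth meaning extending smoothly over an open neighbourhood). The equation is strongly $p$-complete if the solution can be chosen jointly continuous in time and space a.s. for all time when restricted to any $K\in S_p$; equivalently $\xi^K=\infty$ a.s. for all $K\in S_p$. *)

theory Defs
  imports "HOL-Probability.Probability"
begin

section \<open>Smooth manifolds\<close>

text \<open>
  \<open>Ck_on k S f\<close> is meant for open \<open>S\<close>: \<open>f\<close> is \<open>k\<close> times continuously differentiable on \<open>S\<close>,
  i.e. all iterated directional derivatives of order at most \<open>k\<close> are continuous.
\<close>

primrec Ck_on :: "nat \<Rightarrow> 'x::real_normed_vector set \<Rightarrow> ('x \<Rightarrow> 'y::real_normed_vector) \<Rightarrow> bool" where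
  "Ck_on 0 S f \<longleftrightarrow> continuous_on S f"
| "Ck_on (Suc k) S f \<longleftrightarrow>
     (\<forall>x\<in>S. f differentiable (at x)) \<and> (\<forall>v. Ck_on k S (\<lambda>x. frechet_derivative f (at x) v))"

text \<open>
  The manifold is the whole type \<open>'a\<close>; the model space is the Euclidean space \<open>'e\<close>, so the
  dimension is \<open>DIM('e)\<close>.  A chart is a pair of its domain and its coordinate map, of which only
  the values on the domain matter.
\<close>

type_synonym ('a, 'e) chart = "'a set \<times> ('a \<Rightarrow> 'e)"

abbreviation dom_chart :: "('a, 'e) chart \<Rightarrow> 'a set" where
  "dom_chart c \<equiv> fst c"

abbreviation coord :: "('a, 'e) chart \<Rightarrow> 'a \<Rightarrow> 'e" where
  "coord c \<equiv> snd c"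

definition coord_inv :: "('a, 'e) chart \<Rightarrow> 'e \<Rightarrow> 'a" where
  "coord_inv c = inv_into (dom_chart c) (coord c)"

definition smooth_atlas ::
  "('a::{t2_space, second_countable_topology}, 'e::euclidean_space) chart set \<Rightarrow> bool" where
  "smooth_atlas \<A> \<longleftrightarrow>
     (\<Union>c\<in>\<A>. dom_chart c) = UNIV \<and>
     (\<forall>c\<in>\<A>. open (dom_chart c) \<and> open (coord c ` dom_chart c) \<and>
        homeomorphism (dom_chart c) (coord c ` dom_chart c) (coord c) (coord_inv c)) \<and>
     (\<forall>c\<in>\<A>. \<forall>d\<in>\<A>. \<forall>k.
        Ck_on k (coord c ` (dom_chart c \<inter> dom_chart d)) (coord d \<circ> coord_inv c))"

text \<open>
  At every point \<open>x\<close> one chart of the atlas is singled out.  A tangent vector at \<open>x\<close> is encoded by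
  its components in that chart, so that every tangent space \<open>T\<^sub>xM\<close> is the space \<open>'e\<close> and a vector
  field is a function \<open>'a \<Rightarrow> 'e\<close>.  The chart at \<open>x\<close> does not depend continuously on \<open>x\<close>:
  regularity of a field always has to be read in the components with respect to a fixed chart,
  which \<open>to_chart\<close> and \<open>from_chart\<close> provide.
\<close>

definition chart_at :: "('a, 'e) chart set \<Rightarrow> 'a \<Rightarrow> ('a, 'e) chart" where
  "chart_at \<A> x = (SOME c. c \<in> \<A> \<and> x \<in> dom_chart c)"

definition to_chart ::
  "('a, 'e::euclidean_space) chart set \<Rightarrow> ('a, 'e) chart \<Rightarrow> 'a \<Rightarrow> 'e \<Rightarrow> 'e" where
  "to_chart \<A> c x =
     frechet_derivative (coord c \<circ> coord_inv (chart_at \<A> x)) (at (coord (chart_at \<A> x) x))"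

definition from_chart ::
  "('a, 'e::euclidean_space) chart set \<Rightarrow> ('a, 'e) chart \<Rightarrow> 'a \<Rightarrow> 'e \<Rightarrow> 'e" where
  "from_chart \<A> c x =
     frechet_derivative (coord (chart_at \<A> x) \<circ> coord_inv c) (at (coord c x))"

definition tangent_map ::
  "('a, 'e::euclidean_space) chart set \<Rightarrow> ('a \<Rightarrow> 'a) \<Rightarrow> 'a \<Rightarrow> 'e \<Rightarrow> 'e" where
  "tangent_map \<A> f x =
     frechet_derivative (coord (chart_at \<A> (f x)) \<circ> f \<circ> coord_inv (chart_at \<A> x))
       (at (coord (chart_at \<A> x) x))"

definition differential ::
  "('a, 'e::euclidean_space) chart set \<Rightarrow> ('a \<Rightarrow> real) \<Rightarrow> 'a \<Rightarrow> 'e \<Rightarrow> real" where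
  "differential \<A> f x =
     frechet_derivative (f \<circ> coord_inv (chart_at \<A> x)) (at (coord (chart_at \<A> x) x))"

definition smooth_function ::
  "('a, 'e::euclidean_space) chart set \<Rightarrow> ('a \<Rightarrow> real) \<Rightarrow> bool" where
  "smooth_function \<A> f \<longleftrightarrow> (\<forall>c\<in>\<A>. \<forall>k. Ck_on k (coord c ` dom_chart c) (f \<circ> coord_inv c))"

definition Ck_map_on ::
  "nat \<Rightarrow> ('a::topological_space, 'e::euclidean_space) chart set \<Rightarrow> 'a set \<Rightarrow> ('a \<Rightarrow> 'a) \<Rightarrow> bool" where
  "Ck_map_on k \<A> W f \<longleftrightarrow> continuous_on W f \<and>
     (\<forall>c\<in>\<A>. \<forall>d\<in>\<A>. Ck_on k (coord c ` (W \<inter> dom_chart c \<inter> f -` dom_chart d))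
        (coord d \<circ> f \<circ> coord_inv c))"

definition Ck_diffeo_onto_open ::
  "nat \<Rightarrow> ('a::topological_space, 'e::euclidean_space) chart set \<Rightarrow> 'a set \<Rightarrow> ('a \<Rightarrow> 'a) \<Rightarrow> bool" where
  "Ck_diffeo_onto_open k \<A> W f \<longleftrightarrow>
     inj_on f W \<and> open (f ` W) \<and> Ck_map_on k \<A> W f \<and> Ck_map_on k \<A> (f ` W) (inv_into W f)"

definition Ck_vector_field ::
  "nat \<Rightarrow> ('a, 'e::euclidean_space) chart set \<Rightarrow> ('a \<Rightarrow> 'e) \<Rightarrow> bool" where
  "Ck_vector_field k \<A> V \<longleftrightarrow>
     (\<forall>c\<in>\<A>. Ck_on k (coord c ` dom_chart c)
        (\<lambda>y. to_chart \<A> c (coord_inv c y) (V (coord_inv c y))))"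

text \<open>
  \<open>X :: 'a \<Rightarrow> 'b \<Rightarrow> 'e\<close> stands for a map from (Euclidean space \<open>'b\<close>) \<open>\<times> M\<close> to \<open>TM\<close> over the
  projection to \<open>M\<close>, with \<open>X x\<close> linear into \<open>T\<^sub>xM\<close>.
\<close>

definition Ck_linear_fields ::
  "nat \<Rightarrow> ('a, 'e::euclidean_space) chart set \<Rightarrow> ('a \<Rightarrow> 'b::euclidean_space \<Rightarrow> 'e) \<Rightarrow> bool" where
  "Ck_linear_fields k \<A> X \<longleftrightarrow> (\<forall>x. linear (X x)) \<and>
     (\<forall>c\<in>\<A>. Ck_on k (UNIV \<times> coord c ` dom_chart c)
        (\<lambda>(e, y). to_chart \<A> c (coord_inv c y) (X (coord_inv c y) e)))"


section \<open>Riemannian metrics\<close>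

definition riemannian_metric ::
  "('a, 'e::euclidean_space) chart set \<Rightarrow> ('a \<Rightarrow> 'e \<Rightarrow> 'e \<Rightarrow> real) \<Rightarrow> bool" where
  "riemannian_metric \<A> g \<longleftrightarrow>
     (\<forall>x. bilinear (g x) \<and> (\<forall>u v. g x u v = g x v u) \<and> (\<forall>v. v \<noteq> 0 \<longrightarrow> 0 < g x v v)) \<and>
     (\<forall>c\<in>\<A>. \<forall>u v k. Ck_on k (coord c ` dom_chart c)
        (\<lambda>y. g (coord_inv c y) (from_chart \<A> c (coord_inv c y) u)
                               (from_chart \<A> c (coord_inv c y) v)))"

definition rnorm :: "('a \<Rightarrow> 'e \<Rightarrow> 'e \<Rightarrow> real) \<Rightarrow> 'a \<Rightarrow> 'e \<Rightarrow> real" where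
  "rnorm g x v = sqrt (g x v v)"

definition C1_curve_on ::
  "('a::topological_space, 'e::euclidean_space) chart set \<Rightarrow> real \<Rightarrow> real \<Rightarrow> (real \<Rightarrow> 'a) \<Rightarrow> bool" where
  "C1_curve_on \<A> a b \<gamma> \<longleftrightarrow> continuous_on {a..b} \<gamma> \<and>
     (\<forall>c\<in>\<A>. \<forall>a' b'. a \<le> a' \<and> a' < b' \<and> b' \<le> b \<and> \<gamma> ` {a'..b'} \<subseteq> dom_chart c \<longrightarrow>
        (\<exists>D. continuous_on {a'..b'} D \<and>
          (\<forall>t\<in>{a'..b'}. ((coord c \<circ> \<gamma>) has_vector_derivative D t) (at t within {a'..b'}))))"

text \<open>The finite set \<open>S\<close> contains the break points.\<close>

definition piecewise_C1_curve ::
  "('a::topological_space, 'e::euclidean_space) chart set \<Rightarrow> (real \<Rightarrow> 'a) \<Rightarrow> bool" where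
  "piecewise_C1_curve \<A> \<gamma> \<longleftrightarrow> continuous_on {0..1} \<gamma> \<and>
     (\<exists>S. finite S \<and> (\<forall>a b. 0 \<le> a \<and> a < b \<and> b \<le> 1 \<and> {a<..<b} \<inter> S = {} \<longrightarrow> C1_curve_on \<A> a b \<gamma>))"

definition curve_length ::
  "('a, 'e::euclidean_space) chart set \<Rightarrow> ('a \<Rightarrow> 'e \<Rightarrow> 'e \<Rightarrow> real) \<Rightarrow> (real \<Rightarrow> 'a) \<Rightarrow> real" where
  "curve_length \<A> g \<gamma> = integral {0..1}
     (\<lambda>t. rnorm g (\<gamma> t) (vector_derivative (coord (chart_at \<A> (\<gamma> t)) \<circ> \<gamma>) (at t)))"

definition riemannian_dist ::
  "('a::topological_space, 'e::euclidean_space) chart set \<Rightarrow> ('a \<Rightarrow> 'e \<Rightarrow> 'e \<Rightarrow> real) \<Rightarrow>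
   'a \<Rightarrow> 'a \<Rightarrow> real" where
  "riemannian_dist \<A> g x y =
     Inf {curve_length \<A> g \<gamma> | \<gamma>. piecewise_C1_curve \<A> \<gamma> \<and> \<gamma> 0 = x \<and> \<gamma> 1 = y}"

text \<open>The operator norm of a linear map from \<open>T\<^sub>xM\<close> to \<open>T\<^sub>yM\<close>.\<close>

definition op_norm ::
  "('a \<Rightarrow> 'e::euclidean_space \<Rightarrow> 'e \<Rightarrow> real) \<Rightarrow> 'a \<Rightarrow> 'a \<Rightarrow> ('e \<Rightarrow> 'e) \<Rightarrow> real" where
  "op_norm g x y L = Sup {rnorm g y (L v) | v. rnorm g x v \<le> 1}"

definition tangent_norm ::
  "('a, 'e::euclidean_space) chart set \<Rightarrow> ('a \<Rightarrow> 'e \<Rightarrow> 'e \<Rightarrow> real) \<Rightarrow> ('a \<Rightarrow> 'a) \<Rightarrow> 'a \<Rightarrow> real" where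
  "tangent_norm \<A> g f x = op_norm g x (f x) (tangent_map \<A> f x)"


section \<open>Brownian motion and the Stratonovich integral\<close>

text \<open>
  Time is indexed by \<open>real\<close>; only times \<open>t \<ge> 0\<close> are used (a filtration indexed by \<open>t \<ge> 0\<close> can be
  continued by its value at \<open>0\<close>).  The usual conditions are not required.
\<close>

definition filtered_prob_space :: "'w measure \<Rightarrow> (real \<Rightarrow> 'w measure) \<Rightarrow> bool" where
  "filtered_prob_space P \<F> \<longleftrightarrow>
     prob_space P \<and> filtration (space P) \<F> \<and> (\<forall>t. subalgebra P (\<F> t))"

definition brownian_motion ::
  "'w measure \<Rightarrow> (real \<Rightarrow> 'w measure) \<Rightarrow> (real \<Rightarrow> 'w \<Rightarrow> 'b::euclidean_space) \<Rightarrow> bool" where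
  "brownian_motion P \<F> B \<longleftrightarrow>
     (\<forall>t\<ge>0. B t \<in> borel_measurable (\<F> t)) \<and>
     (AE \<omega> in P. B 0 \<omega> = 0) \<and>
     (AE \<omega> in P. continuous_on {0..} (\<lambda>t. B t \<omega>)) \<and>
     (\<forall>s t. 0 \<le> s \<and> s < t \<longrightarrow>
        prob_space.indep_set P (sets (\<F> s))
          (sets (vimage_algebra (space P) (\<lambda>\<omega>. B t \<omega> - B s \<omega>) borel)) \<and>
        prob_space.indep_vars P (\<lambda>_. borel) (\<lambda>b \<omega>. (B t \<omega> - B s \<omega>) \<bullet> b) Basis \<and>
        (\<forall>b\<in>Basis. distributed P lborel (\<lambda>\<omega>. (B t \<omega> - B s \<omega>) \<bullet> b)
           (\<lambda>x. ennreal (normal_density 0 (sqrt (t - s)) x))))"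

definition martingale ::
  "'w measure \<Rightarrow> (real \<Rightarrow> 'w measure) \<Rightarrow> (real \<Rightarrow> 'w \<Rightarrow> real) \<Rightarrow> bool" where
  "martingale P \<F> N \<longleftrightarrow>
     (\<forall>t\<ge>0. N t \<in> borel_measurable (\<F> t) \<and> integrable P (N t)) \<and>
     (\<forall>s t. 0 \<le> s \<and> s \<le> t \<longrightarrow> (AE \<omega> in P. real_cond_exp P (\<F> s) (N t) \<omega> = N s \<omega>))"

definition continuous_adapted ::
  "'w measure \<Rightarrow> (real \<Rightarrow> 'w measure) \<Rightarrow> (real \<Rightarrow> 'w \<Rightarrow> real) \<Rightarrow> bool" where
  "continuous_adapted P \<F> N \<longleftrightarrow>
     (\<forall>t\<ge>0. N t \<in> borel_measurable (\<F> t)) \<and> (AE \<omega> in P. continuous_on {0..} (\<lambda>t. N t \<omega>))"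

definition continuous_local_martingale ::
  "'w measure \<Rightarrow> (real \<Rightarrow> 'w measure) \<Rightarrow> (real \<Rightarrow> 'w \<Rightarrow> real) \<Rightarrow> bool" where
  "continuous_local_martingale P \<F> N \<longleftrightarrow> continuous_adapted P \<F> N \<and>
     (\<exists>\<rho>::nat \<Rightarrow> 'w \<Rightarrow> real.
        (\<forall>k. stopping_time \<F> (\<rho> k) \<and> (\<forall>\<omega>\<in>space P. 0 \<le> \<rho> k \<omega>)) \<and>
        (AE \<omega> in P. incseq (\<lambda>k. \<rho> k \<omega>) \<and> filterlim (\<lambda>k. \<rho> k \<omega>) at_top sequentially) \<and>
        (\<forall>k. martingale P \<F> (\<lambda>t \<omega>. N (min t (\<rho> k \<omega>)) \<omega> - N 0 \<omega>)))"

definition finite_variation_path :: "(real \<Rightarrow> real) \<Rightarrow> bool" where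
  "finite_variation_path v \<longleftrightarrow> (\<forall>T\<ge>0. \<exists>C. \<forall>m. \<forall>\<pi>::nat \<Rightarrow> real.
     mono \<pi> \<and> range \<pi> \<subseteq> {0..T} \<longrightarrow> (\<Sum>i<m. \<bar>v (\<pi> (Suc i)) - v (\<pi> i)\<bar>) \<le> C)"

definition continuous_semimartingale ::
  "'w measure \<Rightarrow> (real \<Rightarrow> 'w measure) \<Rightarrow> (real \<Rightarrow> 'w \<Rightarrow> real) \<Rightarrow> bool" where
  "continuous_semimartingale P \<F> Y \<longleftrightarrow>
     (\<exists>N V. continuous_local_martingale P \<F> N \<and> continuous_adapted P \<F> V \<and>
        (AE \<omega> in P. finite_variation_path (\<lambda>t. V t \<omega>)) \<and>
        (AE \<omega> in P. \<forall>t\<ge>0. Y t \<omega> = N t \<omega> + V t \<omega>))"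

text \<open>
  Random variables that are only almost surely equal to measurable ones are measurable with
  respect to the completion of \<open>P\<close>, which is therefore used here.
\<close>

definition tendsto_in_prob :: "'w measure \<Rightarrow> (nat \<Rightarrow> 'w \<Rightarrow> real) \<Rightarrow> ('w \<Rightarrow> real) \<Rightarrow> bool" where
  "tendsto_in_prob P S Z \<longleftrightarrow>
     (\<forall>n. S n \<in> borel_measurable (completion P)) \<and> Z \<in> borel_measurable (completion P) \<and>
     (\<forall>\<epsilon>>0. (\<lambda>n. measure (completion P) {\<omega> \<in> space P. \<epsilon> < \<bar>S n \<omega> - Z \<omega>\<bar>}) \<longlonglongrightarrow> 0)"

text \<open>The \<open>n\<close>-th partition is \<open>0 = \<pi> n 0 \<le> \<dots> \<le> \<pi> n (m n) = t\<close>; the meshes tend to \<open>0\<close>.\<close>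

definition partitions_to_zero :: "real \<Rightarrow> (nat \<Rightarrow> nat) \<Rightarrow> (nat \<Rightarrow> nat \<Rightarrow> real) \<Rightarrow> bool" where
  "partitions_to_zero t m \<pi> \<longleftrightarrow>
     (\<forall>n. \<pi> n 0 = 0 \<and> \<pi> n (m n) = t \<and> (\<forall>i<m n. \<pi> n i \<le> \<pi> n (Suc i))) \<and>
     (\<forall>\<epsilon>>0. \<forall>\<^sub>F n in sequentially. \<forall>i<m n. \<pi> n (Suc i) - \<pi> n i < \<epsilon>)"

text \<open>\<open>Z t = \<integral>\<^sub>0\<^sup>t Y\<^sub>s \<circ> dW\<^sub>s\<close>, as the limit in probability of the symmetric (trapezoidal) sums.\<close>

definition is_stratonovich_integral ::
  "'w measure \<Rightarrow> (real \<Rightarrow> 'w measure) \<Rightarrow> (real \<Rightarrow> 'w \<Rightarrow> real) \<Rightarrow> (real \<Rightarrow> 'w \<Rightarrow> real) \<Rightarrow>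
   (real \<Rightarrow> 'w \<Rightarrow> real) \<Rightarrow> bool" where
  "is_stratonovich_integral P \<F> Y W Z \<longleftrightarrow>
     continuous_semimartingale P \<F> Y \<and> continuous_semimartingale P \<F> W \<and>
     (AE \<omega> in P. continuous_on {0..} (\<lambda>t. Z t \<omega>)) \<and>
     (\<forall>t\<ge>0. \<forall>m \<pi>. partitions_to_zero t m \<pi> \<longrightarrow>
        tendsto_in_prob P
          (\<lambda>n \<omega>. \<Sum>i<m n. (Y (\<pi> n i) \<omega> + Y (\<pi> n (Suc i)) \<omega>) / 2 *
                          (W (\<pi> n (Suc i)) \<omega> - W (\<pi> n i) \<omega>))
          (Z t))"


section \<open>Stochastic differential equations and their partial flows\<close>

text \<open>
  \<open>y\<close> is a solution, up to \<open>\<zeta>\<close>, of \<open>dy = X(y) \<circ> dB + V(y) dt\<close> started at \<open>x\<close>.  The values of \<open>y\<close>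
  from time \<open>\<zeta>\<close> on are irrelevant.  The equation is tested on all smooth functions \<open>f\<close>,
    \<open>f(y\<^sub>t) = f(x) + \<Sum>\<^sub>b \<integral>\<^sub>0\<^sup>t df(X(y\<^sub>s) b) \<circ> d(B\<^sub>s \<bullet> b) + \<integral>\<^sub>0\<^sup>t df(V(y\<^sub>s)) ds\<close>,
  up to each member \<open>\<tau> k\<close> of a sequence of stopping times that increases strictly below \<open>\<zeta>\<close> to \<open>\<zeta>\<close>.
\<close>

definition sde_solution ::
  "('a::topological_space, 'e::euclidean_space) chart set \<Rightarrow> 'w measure \<Rightarrow> (real \<Rightarrow> 'w measure) \<Rightarrow>
   (real \<Rightarrow> 'w \<Rightarrow> 'b::euclidean_space) \<Rightarrow> ('a \<Rightarrow> 'b \<Rightarrow> 'e) \<Rightarrow> ('a \<Rightarrow> 'e) \<Rightarrow>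
   'a \<Rightarrow> ('w \<Rightarrow> ereal) \<Rightarrow> (real \<Rightarrow> 'w \<Rightarrow> 'a) \<Rightarrow> bool" where
  "sde_solution \<A> P \<F> B X V x \<zeta> y \<longleftrightarrow>
     (AE \<omega> in P. 0 < \<zeta> \<omega> \<and> y 0 \<omega> = x) \<and>
     (\<forall>t\<ge>0. \<forall>U. open U \<longrightarrow> {\<omega> \<in> space P. ereal t < \<zeta> \<omega> \<and> y t \<omega> \<in> U} \<in> sets (\<F> t)) \<and>
     (AE \<omega> in P. continuous_on {t. 0 \<le> t \<and> ereal t < \<zeta> \<omega>} (\<lambda>t. y t \<omega>)) \<and>
     (\<exists>\<tau>::nat \<Rightarrow> 'w \<Rightarrow> real.
        (\<forall>k. stopping_time \<F> (\<tau> k) \<and> (\<forall>\<omega>\<in>space P. 0 \<le> \<tau> k \<omega>)) \<and>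
        (AE \<omega> in P. incseq (\<lambda>k. \<tau> k \<omega>) \<and> (\<forall>k. ereal (\<tau> k \<omega>) < \<zeta> \<omega>) \<and>
           (\<lambda>k. ereal (\<tau> k \<omega>)) \<longlonglongrightarrow> \<zeta> \<omega>) \<and>
        (\<forall>k f. smooth_function \<A> f \<longrightarrow>
          (\<exists>Z::'b \<Rightarrow> real \<Rightarrow> 'w \<Rightarrow> real.
             (\<forall>b\<in>Basis. is_stratonovich_integral P \<F>
                (\<lambda>t \<omega>. differential \<A> f (y (min t (\<tau> k \<omega>)) \<omega>) (X (y (min t (\<tau> k \<omega>)) \<omega>) b))
                (\<lambda>t \<omega>. B (min t (\<tau> k \<omega>)) \<omega> \<bullet> b)
                (Z b)) \<and>
             (AE \<omega> in P. \<forall>t\<ge>0. f (y (min t (\<tau> k \<omega>)) \<omega>) =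
                f x + (\<Sum>b\<in>Basis. Z b t \<omega>) +
                integral {0..min t (\<tau> k \<omega>)} (\<lambda>s. differential \<A> f (y s \<omega>) (V (y s \<omega>)))))))"

definition maximal_sde_solution ::
  "('a::topological_space, 'e::euclidean_space) chart set \<Rightarrow> 'w measure \<Rightarrow> (real \<Rightarrow> 'w measure) \<Rightarrow>
   (real \<Rightarrow> 'w \<Rightarrow> 'b::euclidean_space) \<Rightarrow> ('a \<Rightarrow> 'b \<Rightarrow> 'e) \<Rightarrow> ('a \<Rightarrow> 'e) \<Rightarrow>
   'a \<Rightarrow> ('w \<Rightarrow> ereal) \<Rightarrow> (real \<Rightarrow> 'w \<Rightarrow> 'a) \<Rightarrow> bool" where
  "maximal_sde_solution \<A> P \<F> B X V x \<zeta> y \<longleftrightarrow>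
     sde_solution \<A> P \<F> B X V x \<zeta> y \<and>
     (\<forall>\<zeta>' y'. sde_solution \<A> P \<F> B X V x \<zeta>' y' \<and>
        (AE \<omega> in P. \<zeta> \<omega> \<le> \<zeta>' \<omega> \<and> (\<forall>t\<ge>0. ereal t < \<zeta> \<omega> \<longrightarrow> y' t \<omega> = y t \<omega>)) \<longrightarrow>
        (AE \<omega> in P. \<zeta>' \<omega> = \<zeta> \<omega>))"

definition live_set :: "('a \<Rightarrow> 'w \<Rightarrow> ereal) \<Rightarrow> real \<Rightarrow> 'w \<Rightarrow> 'a set" where
  "live_set \<xi> t \<omega> = {x. ereal t < \<xi> x \<omega>}"

definition explosion_time_on :: "('a \<Rightarrow> 'w \<Rightarrow> ereal) \<Rightarrow> 'a set \<Rightarrow> 'w \<Rightarrow> ereal" where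
  "explosion_time_on \<xi> K \<omega> = (INF x\<in>K. \<xi> x \<omega>)"

text \<open>
  Continuity in time of \<open>t \<mapsto> \<phi> t\<close>, where \<open>\<phi> t\<close> is defined on \<open>D t\<close>, for \<open>C\<^sup>1\<close> convergence on
  compacta.  The compact sets \<open>L\<close> considered lie in one chart domain and are mapped by \<open>\<phi> t\<close> into
  one chart domain; every compact subset of \<open>D t\<close> is a finite union of such sets.
\<close>

definition C1_compact_continuous ::
  "('a::topological_space, 'e::euclidean_space) chart set \<Rightarrow> (real \<Rightarrow> 'a set) \<Rightarrow>
   (real \<Rightarrow> 'a \<Rightarrow> 'a) \<Rightarrow> bool" where
  "C1_compact_continuous \<A> D \<phi> \<longleftrightarrow>
     (\<forall>t\<ge>0. \<forall>c\<in>\<A>. \<forall>d\<in>\<A>. \<forall>L.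
        compact L \<and> L \<subseteq> dom_chart c \<inter> D t \<and> \<phi> t ` L \<subseteq> dom_chart d \<longrightarrow>
        (\<forall>\<^sub>F s in at t within {0..}. L \<subseteq> D s \<and> \<phi> s ` L \<subseteq> dom_chart d) \<and>
        uniform_limit L (\<lambda>s z. coord d (\<phi> s z)) (\<lambda>z. coord d (\<phi> t z)) (at t within {0..}) \<and>
        (\<forall>v. uniform_limit L
           (\<lambda>s z. frechet_derivative (coord d \<circ> \<phi> s \<circ> coord_inv c) (at (coord c z)) v)
           (\<lambda>z. frechet_derivative (coord d \<circ> \<phi> t \<circ> coord_inv c) (at (coord c z)) v)
           (at t within {0..})))"

definition partial_flow ::
  "('a::topological_space, 'e::euclidean_space) chart set \<Rightarrow> ('a \<Rightarrow> 'e \<Rightarrow> 'e \<Rightarrow> real) \<Rightarrow> 'w measure \<Rightarrow>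
   ('a \<Rightarrow> 'w \<Rightarrow> ereal) \<Rightarrow> (real \<Rightarrow> 'a \<Rightarrow> 'w \<Rightarrow> 'a) \<Rightarrow> bool" where
  "partial_flow \<A> g P \<xi> F \<longleftrightarrow>
     (AE \<omega> in P.
        (\<forall>x. 0 < \<xi> x \<omega> \<and> F 0 x \<omega> = x) \<and>
        (\<forall>t\<ge>0. open (live_set \<xi> t \<omega>) \<and>
           Ck_diffeo_onto_open 1 \<A> (live_set \<xi> t \<omega>) (\<lambda>x. F t x \<omega>)) \<and>
        C1_compact_continuous \<A> (\<lambda>t. live_set \<xi> t \<omega>) (\<lambda>t x. F t x \<omega>)) \<and>
     (\<forall>K. compact K \<longrightarrow> (AE \<omega> in P. explosion_time_on \<xi> K \<omega> < \<infinity> \<longrightarrow>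
        (\<forall>x\<^sub>0. ((\<lambda>t. SUP x\<in>K. ereal (riemannian_dist \<A> g x\<^sub>0 (F t x \<omega>))) \<longlongrightarrow> \<infinity>)
           (at_left (real_of_ereal (explosion_time_on \<xi> K \<omega>))))))"

definition sde_flow ::
  "('a::topological_space, 'e::euclidean_space) chart set \<Rightarrow> ('a \<Rightarrow> 'e \<Rightarrow> 'e \<Rightarrow> real) \<Rightarrow>
   'w measure \<Rightarrow> (real \<Rightarrow> 'w measure) \<Rightarrow>
   (real \<Rightarrow> 'w \<Rightarrow> 'b::euclidean_space) \<Rightarrow> ('a \<Rightarrow> 'b \<Rightarrow> 'e) \<Rightarrow> ('a \<Rightarrow> 'e) \<Rightarrow>
   ('a \<Rightarrow> 'w \<Rightarrow> ereal) \<Rightarrow> (real \<Rightarrow> 'a \<Rightarrow> 'w \<Rightarrow> 'a) \<Rightarrow> bool" where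
  "sde_flow \<A> g P \<F> B X V \<xi> F \<longleftrightarrow>
     (\<forall>x. maximal_sde_solution \<A> P \<F> B X V x (\<xi> x) (\<lambda>t. F t x)) \<and> partial_flow \<A> g P \<xi> F"

definition complete_at_one_point :: "'w measure \<Rightarrow> ('a \<Rightarrow> 'w \<Rightarrow> ereal) \<Rightarrow> bool" where
  "complete_at_one_point P \<xi> \<longleftrightarrow> (\<exists>x\<^sub>0. AE \<omega> in P. \<xi> x\<^sub>0 \<omega> = \<infinity>)"


section \<open>Lipschitz cubes, smooth simplices and strong completeness\<close>

text \<open>In this section \<open>p = CARD('p)\<close>.\<close>

definition lipschitz_cube_images ::
  "('a::topological_space, 'e::euclidean_space) chart set \<Rightarrow> ('a \<Rightarrow> 'e \<Rightarrow> 'e \<Rightarrow> real) \<Rightarrow>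
   'p::finite itself \<Rightarrow> 'a set set" where
  "lipschitz_cube_images \<A> g _ =
     {\<sigma> ` {u. \<forall>i. 0 \<le> u $ i \<and> u $ i \<le> 1} | \<sigma> :: real ^ 'p \<Rightarrow> 'a.
        \<exists>C. \<forall>u v. (\<forall>i. 0 \<le> u $ i \<and> u $ i \<le> 1) \<and> (\<forall>i. 0 \<le> v $ i \<and> v $ i \<le> 1) \<longrightarrow>
          riemannian_dist \<A> g (\<sigma> u) (\<sigma> v) \<le> C * dist u v}"

definition corner_simplex :: "(real ^ 'p::finite) set" where
  "corner_simplex = {u. (\<forall>i. 0 \<le> u $ i) \<and> (\<Sum>i\<in>UNIV. u $ i) \<le> 1}"

definition smooth_simplex_images ::
  "('a::topological_space, 'e::euclidean_space) chart set \<Rightarrow> 'p::finite itself \<Rightarrow> 'a set set" where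
  "smooth_simplex_images \<A> _ =
     {\<sigma> ` corner_simplex | \<sigma> :: real ^ 'p \<Rightarrow> 'a.
        \<exists>W. open W \<and> corner_simplex \<subseteq> W \<and> continuous_on W \<sigma> \<and>
          (\<forall>c\<in>\<A>. \<forall>k. Ck_on k (W \<inter> \<sigma> -` dom_chart c) (coord c \<circ> \<sigma>))}"

text \<open>
  ``The solution can be chosen jointly continuous'': the flow restricted to \<open>K\<close> has, for each
  initial point in \<open>K\<close> up to indistinguishability, a version \<open>F'\<close> that is continuous on
  \<open>[0,\<infinity>) \<times> K\<close>.
\<close>

definition strongly_p_complete ::
  "('a::topological_space, 'e::euclidean_space) chart set \<Rightarrow> 'w measure \<Rightarrow>
   ('a \<Rightarrow> 'w \<Rightarrow> ereal) \<Rightarrow> (real \<Rightarrow> 'a \<Rightarrow> 'w \<Rightarrow> 'a) \<Rightarrow> 'p::finite itself \<Rightarrow> bool" where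
  "strongly_p_complete \<A> P \<xi> F p \<longleftrightarrow>
     (\<forall>K\<in>smooth_simplex_images \<A> p. \<exists>F' :: real \<Rightarrow> 'a \<Rightarrow> 'w \<Rightarrow> 'a.
        (\<forall>x\<in>K. AE \<omega> in P. \<xi> x \<omega> = \<infinity> \<and> (\<forall>t\<ge>0. F' t x \<omega> = F t x \<omega>)) \<and>
        (AE \<omega> in P. continuous_on ({0..} \<times> K) (\<lambda>(t, x). F' t x \<omega>)))"

end

theory Submission
  imports Defs
begin

text \<open>
  Let \<open>\<sigma>\<close> be a Lipschitz map on the unit cube of dimension \<open>p\<close> one of whose values never explodes.
  As long as \<open>F\<^sub>s\<close> lives on the whole image, the distance \<open>h\<^sub>s(u)\<close> from a base point to
  \<open>F\<^sub>s(\<sigma>(u))\<close> has local Lipschitz constant at most a multiple of the norm of the derivative of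
  \<open>F\<^sub>s\<close> at \<open>\<sigma>(u)\<close>.  Morrey's inequality for an exponent \<open>q > p\<close> therefore bounds the
  oscillation of \<open>h\<^sub>s\<close> by the integral over the cube of the \<open>q\<close>-th power of that norm, uniformly
  in \<open>s \<le> T\<close>; by the moment hypothesis and Tonelli's theorem this integral is almost surely finite.
  Since \<open>h\<^sub>s\<close> stays bounded at the non-exploding point, it stays bounded on the whole cube, and the
  blow-up property of the partial flow excludes an explosion before \<open>T\<close>.  Applied to segments in charts,
  this spreads non-explosion from one point to the connected manifold \<open>M\<close>; then it applies to every
  Lipschitz cube.

  No measurability of the derivative of the flow is available, and integrals of non-measurable functions
  are lower integrals.  The derivative is therefore first replaced by the smaller local Lipschitz
  constants of \<open>h\<^sub>s\<close>, which are computed from countably many random variables.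
\<close>

section \<open>Oscillation of locally Lipschitz functions\<close>

text \<open>The heights are real valued, so Morrey's inequality concerns functions on a Euclidean
  cube and never the flow map itself, and a bounded height is exactly what the blow-up property
  contradicts. The oscillation bound must not contain a Lipschitz constant of the height: before the
  explosion such a constant exists, but it depends on the outcome and on the time and may degenerate
  as the explosion approaches. It serves only to make the slopes finite. Factors 2 lost when a chart
  is compared with the metric are harmless, since only finiteness of moments matters.

  A lower integral is monotone, but Tonelli's theorem fails for it in general. For each fixed
  \<open>u\<close> the derivative norm is therefore only used as an upper bound for something
  measurable, and the integration over the cube comes afterwards.

  The time of a possible explosion is random, whereas the exponent \<open>q\<close> may change with
  the horizon. Integer horizons keep the number of exceptional null sets countable.\<close>

lemma locally_lipschitz_uniform:
  fixes Q :: "'x::metric_space set" and \<delta> :: "'x \<Rightarrow> 'x \<Rightarrow> real"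
  assumes Q: "compact Q"
    and loc: "\<And>u. u \<in> Q \<Longrightarrow> \<exists>M. \<exists>e>0. \<forall>v\<in>Q \<inter> ball u e. \<forall>w\<in>Q \<inter> ball u e. \<delta> v w \<le> M * dist v w"
  obtains M e where "e > 0" "0 \<le> M"
    "\<And>u v w. u \<in> Q \<Longrightarrow> v \<in> Q \<inter> ball u e \<Longrightarrow> w \<in> Q \<inter> ball u e \<Longrightarrow> \<delta> v w \<le> M * dist v w"
proof -
  obtain M e where e: "\<And>u. u \<in> Q \<Longrightarrow> e u > 0"
    and M: "\<And>u v w. u \<in> Q \<Longrightarrow> v \<in> Q \<inter> ball u (e u) \<Longrightarrow> w \<in> Q \<inter> ball u (e u) \<Longrightarrow> \<delta> v w \<le> M u * dist v w"
    using loc by metis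
  \<comment> \<open>Halving the local radii gives a Lebesgue number: a ball of radius
    \<open>E\<close> around any point of \<open>Q\<close> then lies in one of finitely many full
    balls.\<close>
  have "Q \<subseteq> (\<Union>u\<in>Q. ball u (e u / 2))"
    using e by force
  then obtain T where T: "T \<subseteq> Q" "finite T" "Q \<subseteq> (\<Union>u\<in>T. ball u (e u / 2))"
    using compactE_image[OF Q, of Q "\<lambda>u. ball u (e u / 2)"] by auto
  \<comment> \<open>The inserted 1 and 0 cover an empty \<open>T\<close>; the 0 also makes the
    common constant nonnegative, as the local ones need not be.\<close>
  define E where "E = Min (insert 1 ((\<lambda>u. e u / 2) ` T))"
  define N where "N = Max (insert 0 (M ` T))"
  have E0: "E > 0"
    unfolding E_def using T e by (subst Min_gr_iff) auto
  have E: "E \<le> e u / 2" if "u \<in> T" for u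
    unfolding E_def using T that by (intro Min_le) auto
  have N: "M u \<le> N" if "u \<in> T" for u
    unfolding N_def using T that by (intro Max_ge) auto
  have N0: "0 \<le> N"
    unfolding N_def using T by (intro Max_ge) auto
  have "\<delta> v w \<le> N * dist v w"
    if u: "u \<in> Q" and v: "v \<in> Q \<inter> ball u E" and w: "w \<in> Q \<inter> ball u E" for u v w
  proof -
    obtain t where t: "t \<in> T" "dist t u < e t / 2"
      using T u by auto
    have "dist t z < e t" if "z \<in> ball u E" for z
      using dist_triangle[of t z u] t E[OF t(1)] that by (auto simp: dist_commute)
    then have "\<delta> v w \<le> M t * dist v w"
      using v w t T by (intro M) auto
    also have "\<dots> \<le> N * dist v w"
      using N[OF t(1)] by (intro mult_right_mono) auto
    finally show ?thesis .
  qed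
  then show ?thesis
    using that E0 N0 by blast
qed

text \<open>The triangle inequality adds up the local bounds along the segment from \<open>v\<close>
  to \<open>w\<close>, which convexity keeps in \<open>Q\<close>. The function
  \<open>\<delta>\<close> is arbitrary because it will be a Riemannian distance pulled back to a
  simplex.\<close>

lemma locally_lipschitz_imp_lipschitz:
  fixes Q :: "'x::real_normed_vector set" and \<delta> :: "'x \<Rightarrow> 'x \<Rightarrow> real"
  assumes Q: "compact Q" "convex Q"
    and tri: "\<And>u v w. u \<in> Q \<Longrightarrow> v \<in> Q \<Longrightarrow> w \<in> Q \<Longrightarrow> \<delta> u w \<le> \<delta> u v + \<delta> v w"
    and loc: "\<And>u. u \<in> Q \<Longrightarrow> \<exists>M. \<exists>e>0. \<forall>v\<in>Q \<inter> ball u e. \<forall>w\<in>Q \<inter> ball u e. \<delta> v w \<le> M * dist v w"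
  obtains M where "\<And>v w. v \<in> Q \<Longrightarrow> w \<in> Q \<Longrightarrow> \<delta> v w \<le> M * dist v w"
proof -
  obtain M e where Me: "e > 0" "0 \<le> M"
    "\<And>u v w. u \<in> Q \<Longrightarrow> v \<in> Q \<inter> ball u e \<Longrightarrow> w \<in> Q \<inter> ball u e \<Longrightarrow> \<delta> v w \<le> M * dist v w"
    using locally_lipschitz_uniform[OF Q(1) loc] by metis
  have "\<delta> v w \<le> M * dist v w" if vw: "v \<in> Q" "w \<in> Q" for v w
  proof -
    define \<gamma> where "\<gamma> r = v + r *\<^sub>R (w - v)" for r :: real
    have inQ: "\<gamma> r \<in> Q" if "0 \<le> r" "r \<le> 1" for r
    proof -
      have "\<gamma> r = (1 - r) *\<^sub>R v + r *\<^sub>R w"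
        by (simp add: \<gamma>_def algebra_simps)
      then show ?thesis
        using convexD[OF Q(2) vw, of "1-r" r] that by simp
    qed
    have dist\<gamma>: "dist (\<gamma> a) (\<gamma> b) = \<bar>a - b\<bar> * dist v w" for a b
      by (simp add: \<gamma>_def dist_norm norm_minus_commute flip: scaleR_diff_left)
    \<comment> \<open>\<open>P\<close> passes to unions of adjacent intervals, so the bisection
      principle \<open>Bolzano\<close> replaces an explicit subdivision. The two premises confine
      the claim to parts of [0,1].\<close>
    define P where "P a b \<longleftrightarrow> (0 \<le> a \<longrightarrow> b \<le> 1 \<longrightarrow> \<delta> (\<gamma> a) (\<gamma> b) \<le> M * dist v w * (b - a))" for a b
    have "P 0 1"
    proof (rule Bolzano)
      show "P a c" if "P a b" "P b c" "a \<le> b" "b \<le> c" for a b c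
        unfolding P_def
      proof (intro impI)
        assume "0 \<le> a" "c \<le> 1"
        then have "\<delta> (\<gamma> a) (\<gamma> c) \<le> \<delta> (\<gamma> a) (\<gamma> b) + \<delta> (\<gamma> b) (\<gamma> c)"
          using that by (intro tri inQ) auto
        also have "\<dots> \<le> M * dist v w * (b - a) + M * dist v w * (c - b)"
          using that \<open>0 \<le> a\<close> \<open>c \<le> 1\<close> by (intro add_mono) (auto simp: P_def)
        finally show "\<delta> (\<gamma> a) (\<gamma> c) \<le> M * dist v w * (c - a)"
          by (simp add: algebra_simps)
      qed
      show "\<exists>d>0. \<forall>a b. a \<le> x \<and> x \<le> b \<and> b - a < d \<longrightarrow> P a b" for x
        unfolding P_def
      proof (intro exI[of _ "e / (dist v w + 1)"] conjI allI impI)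
        show "0 < e / (dist v w + 1)"
          using Me by (simp add: add_nonneg_pos)
        fix a b assume ab: "a \<le> x \<and> x \<le> b \<and> b - a < e / (dist v w + 1)" "0 \<le> a" "b \<le> 1"
        then have "(b - a) * (dist v w + 1) < e"
          by (simp add: add_nonneg_pos pos_less_divide_eq)
        then have "dist (\<gamma> a) (\<gamma> b) < e"
          using ab by (simp add: dist\<gamma> algebra_simps)
        then have "\<delta> (\<gamma> a) (\<gamma> b) \<le> M * dist (\<gamma> a) (\<gamma> b)"
          using Me ab by (intro Me(3)[of "\<gamma> a"]) (auto intro!: inQ)
        then show "\<delta> (\<gamma> a) (\<gamma> b) \<le> M * dist v w * (b - a)"
          using ab by (simp add: dist\<gamma> algebra_simps)
      qed
    qed simp
    then show ?thesis by (simp add: \<gamma>_def P_def)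
  qed
  then show ?thesis using that by blast
qed

text \<open>Only slopes between points of a countable set \<open>D\<close> are taken into account, so that these suprema
  remain measurable when \<open>h\<close> is random.\<close>

definition steep :: "'x::metric_space set \<Rightarrow> ('x \<Rightarrow> real) \<Rightarrow> nat \<Rightarrow> 'x \<Rightarrow> ennreal" where
  "steep D h n u = (SUP (v, w)\<in>D \<times> D.
     indicator {z. dist v z < 1 / real (Suc n) \<and> dist w z < 1 / real (Suc n)} u *
     ennreal (\<bar>h v - h w\<bar> / dist v w))"

text \<open>The asymptotic Lipschitz constant of \<open>h\<close> at \<open>u\<close>, seen on
  \<open>D\<close> only. By \<open>steep_mono\<close> the infimum is a limit for shrinking radii.
  The point \<open>u\<close> need not belong to \<open>D\<close>.\<close>

definition slope :: "'x::metric_space set \<Rightarrow> ('x \<Rightarrow> real) \<Rightarrow> 'x \<Rightarrow> ennreal" where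
  "slope D h u = (INF n. steep D h n u)"

lemma steep_mono:
  assumes "m \<le> n"
  shows "steep D h n u \<le> steep D h m u"
proof -
  have "1 / real (Suc n) \<le> 1 / real (Suc m)"
    using assms by (simp add: frac_le)
  then show ?thesis
    unfolding steep_def
    by (intro SUP_mono) (auto split: split_indicator intro!: bexI)
qed

lemma steep_measurable [measurable]:
  fixes D :: "'x::{metric_space, second_countable_topology} set"
  assumes [simp]: "countable D"
  shows "steep D h n \<in> borel_measurable borel"
  unfolding steep_def case_prod_beta by (intro borel_measurable_SUP) auto

lemma slope_measurable [measurable]:
  fixes D :: "'x::{metric_space, second_countable_topology} set"
  assumes [simp]: "countable D"
  shows "slope D h \<in> borel_measurable borel"
  unfolding slope_def by (intro borel_measurable_INF) auto

lemma steep_leI: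
  assumes "\<And>v w. v \<in> D \<Longrightarrow> w \<in> D \<Longrightarrow> dist v u < 1 / real (Suc n) \<Longrightarrow> dist w u < 1 / real (Suc n) \<Longrightarrow>
    \<bar>h v - h w\<bar> \<le> M * dist v w" and "0 \<le> M"
  shows "steep D h n u \<le> ennreal M"
  unfolding steep_def
proof (rule SUP_least, clarify)
  fix v w assume vw: "v \<in> D" "w \<in> D"
  \<comment> \<open>Pairs with \<open>v = w\<close> contribute 0, as division by zero yields 0;
    hence the need for \<open>0 \<le> M\<close>.\<close>
  have "\<bar>h v - h w\<bar> / dist v w \<le> M" if "dist v u < 1 / real (Suc n)" "dist w u < 1 / real (Suc n)"
    using assms(1)[OF vw that] assms(2) by (cases "v = w") (auto simp: divide_simps)
  then show "indicator {z. dist v z < 1 / real (Suc n) \<and> dist w z < 1 / real (Suc n)} u *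
       ennreal (\<bar>h v - h w\<bar> / dist v w) \<le> ennreal M"
    by (auto split: split_indicator simp: ennreal_leI)
qed

text \<open>Density and continuity carry the estimate from \<open>D\<close> to \<open>Q\<close>. The
  nearness conditions are strict, so sequences in \<open>D\<close> tending to \<open>v\<close> and
  \<open>w\<close> satisfy them eventually.\<close>

lemma steep_bound:
  fixes Q :: "'x::metric_space set"
  assumes D: "D \<subseteq> Q" "Q \<subseteq> closure D" and h: "continuous_on Q h"
    and vw: "v \<in> Q" "w \<in> Q" and near: "dist v u < 1 / real (Suc n)" "dist w u < 1 / real (Suc n)"
  shows "ennreal \<bar>h v - h w\<bar> \<le> ennreal (dist v w) * steep D h n u"
proof (cases "v = w \<or> steep D h n u = \<infinity>")
  case True
  then show ?thesis by (auto simp: ennreal_mult_top)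
next
  case False
  then obtain S where S: "steep D h n u = ennreal S" "0 \<le> S"
    by (cases "steep D h n u") auto
  obtain x y where x: "\<And>k. x k \<in> D" "x \<longlonglongrightarrow> v" and y: "\<And>k. y k \<in> D" "y \<longlonglongrightarrow> w"
    using vw D(2) by (metis closure_sequential subsetD)
  have hx: "(\<lambda>k. h (x k)) \<longlonglongrightarrow> h v" and hy: "(\<lambda>k. h (y k)) \<longlonglongrightarrow> h w"
    using h x y vw D(1) unfolding continuous_on_sequentially o_def by blast+
  have "eventually (\<lambda>k. dist (x k) u < 1 / real (Suc n)) sequentially"
    "eventually (\<lambda>k. dist (y k) u < 1 / real (Suc n)) sequentially"
    using near by (auto intro!: order_tendstoD tendsto_intros x y)
  then have ev: "eventually (\<lambda>k. \<bar>h (x k) - h (y k)\<bar> \<le> dist (x k) (y k) * S) sequentially"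
  proof eventually_elim
    case (elim k)
    have "ennreal (\<bar>h (x k) - h (y k)\<bar> / dist (x k) (y k)) \<le> steep D h n u"
      unfolding steep_def using x y elim
      by (intro SUP_upper2[where i="(x k, y k)"]) (auto split: split_indicator)
    then have "\<bar>h (x k) - h (y k)\<bar> / dist (x k) (y k) \<le> S"
      using S by (simp add: )
    then show ?case
      by (cases "x k = y k") (auto simp: divide_simps mult.commute split: if_splits)
  qed
  then have "\<bar>h v - h w\<bar> \<le> dist v w * S"
    by (intro tendsto_le[OF _ _ _ ev] tendsto_intros hx hy x y) auto
  then show ?thesis
    using S by (simp add: ennreal_leI flip: ennreal_mult)
qed

text \<open>A discrete form of the fundamental theorem of calculus. The ends of a short piece lie
  within \<open>1 / real (Suc n)\<close> of each of its points, so \<open>steep\<close> at any of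
  these points controls the increment; averaging over the piece produces an integral, and integrals
  add up. No differentiability of \<open>h\<close> is involved.\<close>

lemma steep_segment:
  fixes Q D :: "'x::euclidean_space set"
  assumes cD: "countable D" and D: "D \<subseteq> Q" "Q \<subseteq> closure D" and h: "continuous_on Q h"
    and Q: "convex Q" and uv: "u \<in> Q" "v \<in> Q"
  shows "ennreal \<bar>h u - h v\<bar> \<le>
    ennreal (dist u v) * (\<integral>\<^sup>+r\<in>{0..1}. steep D h n (u + r *\<^sub>R (v - u)) \<partial>lborel)"
proof -
  define \<gamma> where "\<gamma> r = u + r *\<^sub>R (v - u)" for r :: real
  have [measurable]: "\<gamma> \<in> borel_measurable borel"
    unfolding \<gamma>_def by measurable
  note [measurable] = steep_measurable[OF cD]
  have inQ: "\<gamma> r \<in> Q" if "0 \<le> r" "r \<le> 1" for r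
  proof -
    have "\<gamma> r = (1 - r) *\<^sub>R u + r *\<^sub>R v"
      by (simp add: \<gamma>_def algebra_simps)
    then show ?thesis
      using convexD[OF Q uv, of "1-r" r] that by simp
  qed
  have dist\<gamma>: "dist (\<gamma> a) (\<gamma> b) = \<bar>a - b\<bar> * dist u v" for a b
    by (simp add: \<gamma>_def dist_norm norm_minus_commute flip: scaleR_diff_left)
  define I where "I a b = (\<integral>\<^sup>+r\<in>{a..b}. steep D h n (\<gamma> r) \<partial>lborel)" for a b
  define P where "P a b \<longleftrightarrow> (0 \<le> a \<longrightarrow> b \<le> 1 \<longrightarrow> ennreal \<bar>h (\<gamma> a) - h (\<gamma> b)\<bar> \<le> ennreal (dist u v) * I a b)" for a b
  have "P 0 1"
  proof (rule Bolzano)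
    show "P a c" if "P a b" "P b c" and abc: "a \<le> b" "b \<le> c" for a b c
      unfolding P_def
    proof (intro impI)
      assume "0 \<le> a" "c \<le> 1"
      \<comment> \<open>The two closed pieces overlap in the null set consisting of
        \<open>b\<close>.\<close>
      have "AE r in lborel. r \<noteq> b"
        by (rule AE_lborel_singleton)
      then have "I a c = (\<integral>\<^sup>+r. steep D h n (\<gamma> r) * indicator {a..b} r + steep D h n (\<gamma> r) * indicator {b..c} r \<partial>lborel)"
        unfolding I_def using abc
        by (intro nn_integral_cong_AE) (auto elim!: eventually_mono split: split_indicator)
      also have "\<dots> = I a b + I b c"
        unfolding I_def by (intro nn_integral_add) auto
      finally have I: "I a c = I a b + I b c" .
      have "ennreal \<bar>h (\<gamma> a) - h (\<gamma> c)\<bar> \<le> ennreal (\<bar>h (\<gamma> a) - h (\<gamma> b)\<bar> + \<bar>h (\<gamma> b) - h (\<gamma> c)\<bar>)"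
        by (intro ennreal_leI) auto
      also have "\<dots> \<le> ennreal (dist u v) * I a b + ennreal (dist u v) * I b c"
        using that \<open>0 \<le> a\<close> \<open>c \<le> 1\<close> by (auto simp: P_def intro!: add_mono)
      finally show "ennreal \<bar>h (\<gamma> a) - h (\<gamma> c)\<bar> \<le> ennreal (dist u v) * I a c"
        by (simp add: I distrib_left)
    qed
    show "\<exists>d>0. \<forall>a b. a \<le> x \<and> x \<le> b \<and> b - a < d \<longrightarrow> P a b" for x
      unfolding P_def
    proof (intro exI[of _ "1 / real (Suc n) / (dist u v + 1)"] conjI allI impI)
      show "0 < 1 / real (Suc n) / (dist u v + 1)"
        by (simp add: add_nonneg_pos)
      fix a b assume ab: "a \<le> x \<and> x \<le> b \<and> b - a < 1 / real (Suc n) / (dist u v + 1)" "0 \<le> a" "b \<le> 1"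
      show "ennreal \<bar>h (\<gamma> a) - h (\<gamma> b)\<bar> \<le> ennreal (dist u v) * I a b"
      proof (cases "a = b")
        case False
        then have "a < b" using ab by simp
        have "(b - a) * (dist u v + 1) < 1 / real (Suc n)"
          using ab by (simp add: add_nonneg_pos pos_less_divide_eq mult_ac del: of_nat_Suc)
        then have small: "(b - a) * dist u v < 1 / real (Suc n)"
          using ab by (simp add: algebra_simps del: of_nat_Suc)
        have near: "dist (\<gamma> a) (\<gamma> r) < 1 / real (Suc n)" "dist (\<gamma> b) (\<gamma> r) < 1 / real (Suc n)"
          if "r \<in> {a..b}" for r
        proof -
          have "\<bar>a - r\<bar> * dist u v \<le> (b - a) * dist u v" "\<bar>b - r\<bar> * dist u v \<le> (b - a) * dist u v"
            using that by (auto intro!: mult_right_mono)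
          then show "dist (\<gamma> a) (\<gamma> r) < 1 / real (Suc n)" "dist (\<gamma> b) (\<gamma> r) < 1 / real (Suc n)"
            using small by (auto simp: dist\<gamma>)
        qed
        \<comment> \<open>The constant increment is integrated over the piece and the length
          \<open>b - a\<close> is cancelled at the end, which requires \<open>a < b\<close>.\<close>
        have "ennreal (b - a) * ennreal \<bar>h (\<gamma> a) - h (\<gamma> b)\<bar> =
            (\<integral>\<^sup>+r\<in>{a..b}. ennreal \<bar>h (\<gamma> a) - h (\<gamma> b)\<bar> \<partial>lborel)"
          using \<open>a < b\<close> by (simp add: nn_integral_cmult_indicator mult.commute[of "ennreal (b - a)"])
        also have "\<dots> \<le> (\<integral>\<^sup>+r\<in>{a..b}. ennreal ((b - a) * dist u v) * steep D h n (\<gamma> r) \<partial>lborel)"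
        proof (intro nn_integral_mono)
          fix r
          have "ennreal \<bar>h (\<gamma> a) - h (\<gamma> b)\<bar> \<le> ennreal (dist (\<gamma> a) (\<gamma> b)) * steep D h n (\<gamma> r)"
            if "r \<in> {a..b}"
            using ab near[OF that] by (intro steep_bound[OF D h] inQ) auto
          then show "ennreal \<bar>h (\<gamma> a) - h (\<gamma> b)\<bar> * indicator {a..b} r \<le>
              ennreal ((b - a) * dist u v) * steep D h n (\<gamma> r) * indicator {a..b} r"
            using \<open>a < b\<close> by (auto split: split_indicator simp: dist\<gamma>)
        qed
        also have "\<dots> = ennreal ((b - a) * dist u v) * I a b"
          unfolding I_def by (simp add: mult.assoc nn_integral_cmult)
        also have "\<dots> = ennreal (b - a) * (ennreal (dist u v) * I a b)"
          using \<open>a < b\<close> by (simp add: ennreal_mult mult.assoc)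
        finally show ?thesis
          using \<open>a < b\<close> by (simp add: ennreal_mult_le_mult_iff)
      qed simp
    qed
  qed simp
  then show ?thesis by (simp add: P_def I_def \<gamma>_def)
qed

text \<open>The limit of \<open>steep_segment\<close> for shrinking radii. Monotone convergence of a
  decreasing sequence needs finite integrals; the bound on \<open>steep D h N\<close> provides them,
  so the sequence starts at \<open>N\<close>.\<close>

lemma slope_segment:
  fixes Q D :: "'x::euclidean_space set"
  assumes cD: "countable D" and D: "D \<subseteq> Q" "Q \<subseteq> closure D" and h: "continuous_on Q h"
    and Q: "convex Q" and bdd: "\<And>z. z \<in> Q \<Longrightarrow> steep D h N z \<le> ennreal M"
    and uv: "u \<in> Q" "v \<in> Q"
  shows "ennreal \<bar>h u - h v\<bar> \<le>
    ennreal (dist u v) * (\<integral>\<^sup>+r\<in>{0..1}. slope D h (u + r *\<^sub>R (v - u)) \<partial>lborel)"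
proof -
  note [measurable] = steep_measurable[OF cD]
  define f where "f n r = steep D h (N + n) (u + r *\<^sub>R (v - u)) * indicator {0..1} r" for n r
  have inQ: "u + r *\<^sub>R (v - u) \<in> Q" if "0 \<le> r" "r \<le> 1" for r
  proof -
    have "u + r *\<^sub>R (v - u) = (1 - r) *\<^sub>R u + r *\<^sub>R v"
      by (simp add: algebra_simps)
    then show ?thesis
      using convexD[OF Q uv, of "1-r" r] that by simp
  qed
  have dec: "decseq f"
    by (intro decseq_SucI le_funI) (auto simp: f_def intro!: mult_right_mono steep_mono)
  have fin: "(\<integral>\<^sup>+r. f n r \<partial>lborel) < \<infinity>" for n
  proof -
    have "(\<integral>\<^sup>+r. f n r \<partial>lborel) \<le> (\<integral>\<^sup>+r. ennreal M * indicator {0..1::real} r \<partial>lborel)"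
    proof (intro nn_integral_mono)
      fix r :: real
      have "steep D h (N + n) (u + r *\<^sub>R (v - u)) \<le> ennreal M" if "r \<in> {0..1}"
        using that by (intro order_trans[OF steep_mono bdd[OF inQ]]) auto
      then show "f n r \<le> ennreal M * indicator {0..1} r"
        by (auto simp: f_def split: split_indicator)
    qed
    also have "\<dots> < \<infinity>"
      by (simp add: nn_integral_cmult_indicator ennreal_mult_less_top)
    finally show ?thesis .
  qed
  have meas: "f n \<in> borel_measurable lborel" for n
    unfolding f_def by measurable
  have fI: "(INF n. f n r) = slope D h (u + r *\<^sub>R (v - u)) * indicator {0..1} r" for r
  proof -
    have "\<exists>i. steep D h (N + i) z \<le> steep D h j z" for j z
      by (intro exI[of _ j] steep_mono) simp
    then have "(INF n. steep D h (N + n) z) = slope D h z" for z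
      unfolding slope_def by (intro INF_eq) auto
    then show ?thesis
      by (auto simp: f_def split: split_indicator)
  qed
  have "ennreal \<bar>h u - h v\<bar> \<le> ennreal (dist u v) * integral\<^sup>N lborel (f n)" for n
    using steep_segment[OF cD D h Q uv, of "N + n"] by (simp add: f_def[abs_def])
  moreover have "decseq (\<lambda>n. integral\<^sup>N lborel (f n))"
    by (intro decseq_SucI nn_integral_mono le_funD[OF decseq_SucD[OF dec]])
  then have "(\<lambda>n. ennreal (dist u v) * integral\<^sup>N lborel (f n)) \<longlonglongrightarrow>
      ennreal (dist u v) * (INF n. integral\<^sup>N lborel (f n))"
    by (intro ennreal_tendsto_cmult LIMSEQ_INF) auto
  ultimately have "ennreal \<bar>h u - h v\<bar> \<le> ennreal (dist u v) * (INF n. integral\<^sup>N lborel (f n))"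
    by (intro LIMSEQ_le_const) auto
  also have "(INF n. integral\<^sup>N lborel (f n)) = (\<integral>\<^sup>+r. (INF n. f n r) \<partial>lborel)"
    by (rule nn_integral_monotone_convergence_INF_decseq[OF dec meas fin, symmetric])
  finally show ?thesis
    by (simp add: fI)
qed

section \<open>Morrey's inequality on a convex compact set of volume one\<close>

text \<open>The homothety with centre \<open>u\<close> and ratio \<open>r\<close> multiplies volumes
  by \<open>r ^ DIM('x)\<close> and maps the convex set \<open>Q\<close> into itself. Enlarging the
  image to all of \<open>Q\<close> gives the inequality.\<close>

lemma nn_integral_homothety_le:
  fixes f :: "'x::euclidean_space \<Rightarrow> ennreal"
  assumes [measurable]: "f \<in> borel_measurable borel" "Q \<in> sets borel"
    and Q: "convex Q" and u: "u \<in> Q" and r: "0 < r" "r \<le> 1"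
  shows "(\<integral>\<^sup>+v\<in>Q. f (u + r *\<^sub>R (v - u)) \<partial>lborel) \<le> ennreal (r powr - real DIM('x)) * (\<integral>\<^sup>+w\<in>Q. f w \<partial>lborel)"
proof -
  define t where "t = u - r *\<^sub>R u"
  define g where "g w = f w * indicator Q w" for w
  have [measurable]: "g \<in> borel_measurable borel"
    unfolding g_def by measurable
  have g: "f (u + r *\<^sub>R (v - u)) * indicator Q v \<le> g (t + r *\<^sub>R v)" for v
  proof -
    have "u + r *\<^sub>R (v - u) \<in> Q" if "v \<in> Q"
      using convexD[OF Q u that, of "1-r" r] r by (simp add: algebra_simps)
    then show ?thesis
      by (auto simp: g_def t_def algebra_simps split: split_indicator)
  qed
  have "ennreal (r ^ DIM('x)) * (\<integral>\<^sup>+v. g (t + r *\<^sub>R v) \<partial>lborel) = (\<integral>\<^sup>+w. g w \<partial>lborel)"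
    using r by (subst (2) lborel_affine[of r t]) (simp_all add: nn_integral_density nn_integral_distr nn_integral_cmult)
  moreover have "ennreal (r powr - real DIM('x)) * ennreal (r ^ DIM('x)) = 1"
    using r by (simp add: powr_minus powr_realpow flip: ennreal_mult)
  ultimately have "(\<integral>\<^sup>+v. g (t + r *\<^sub>R v) \<partial>lborel) = ennreal (r powr - real DIM('x)) * (\<integral>\<^sup>+w. g w \<partial>lborel)"
    by (metis mult.assoc mult_1)
  moreover have "(\<integral>\<^sup>+v\<in>Q. f (u + r *\<^sub>R (v - u)) \<partial>lborel) \<le> (\<integral>\<^sup>+v. g (t + r *\<^sub>R v) \<partial>lborel)"
    by (intro nn_integral_mono g)
  ultimately show ?thesis by (simp add: g_def)
qed

lemma nn_integral_powr_unit_interval: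
  assumes "0 < a"
  shows "(\<integral>\<^sup>+r\<in>{0..1}. ennreal (r powr (a - 1)) \<partial>lborel) = ennreal (1 / a)"
  using nn_integral_has_integral_lebesgue'[OF _ has_integral_powr_from_0[of "a - 1" 1]] assms by simp

text \<open>With \<open>p - 1 < \<beta> < q - 1\<close>, where \<open>p\<close> is the dimension, both \<open>r powr (\<beta> - p)\<close> and
  \<open>r powr - (\<beta> / (q - 1))\<close> are integrable on \<open>[0, 1]\<close>; the split then takes the place of Hoelder's
  inequality in the proof of Morrey's inequality.\<close>

lemma young_split:
  fixes l r q \<beta> :: real
  assumes "0 \<le> l" "0 < r" "1 < q"
  shows "l \<le> r powr \<beta> * l powr q + r powr - (\<beta> / (q - 1))"
proof (cases "l \<le> r powr - (\<beta> / (q - 1))")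
  case True
  then show ?thesis by (simp add: add_increasing)
next
  case False
  then have l: "0 < l"
    using assms powr_ge_zero[of r "- (\<beta> / (q - 1))"] by linarith
  have "r powr - \<beta> = (r powr - (\<beta> / (q - 1))) powr (q - 1)"
    using assms by (simp add: powr_powr)
  also have "\<dots> \<le> l powr (q - 1)"
    using False assms by (intro powr_mono2) auto
  finally have "r powr \<beta> * r powr - \<beta> \<le> r powr \<beta> * l powr (q - 1)"
    by (intro mult_left_mono) auto
  then have "l * 1 \<le> l * (r powr \<beta> * l powr (q - 1))"
    using assms l by (intro mult_left_mono) (auto simp: powr_minus)
  also have "\<dots> = r powr \<beta> * l powr q"
    using l powr_mult_base[of l "q - 1"] by simp
  finally show ?thesis by (simp add: add_increasing2)
qed

text \<open>The number \<open>\<beta>\<close> is the midpoint of \<open>DIM('x) - 1\<close> and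
  \<open>q - 1\<close>, so both constants on the right are finite. In \<open>young_split\<close> the
  part carrying the \<open>q\<close>-th power has weight \<open>r powr \<beta>\<close>, and the
  homothety costs \<open>r powr - real DIM('x)\<close>. The resulting bound is the same for every
  \<open>u\<close>.\<close>

lemma average_bound:
  fixes l :: "'x::euclidean_space \<Rightarrow> ennreal"
  assumes l[measurable]: "l \<in> borel_measurable borel" and lfin: "\<And>z. z \<in> Q \<Longrightarrow> l z < \<infinity>"
    and Q: "compact Q" "convex Q" "emeasure lborel Q = 1" and u: "u \<in> Q" and q: "real DIM('x) < q"
  defines "\<beta> \<equiv> (real DIM('x) + q) / 2 - 1"
  shows "(\<integral>\<^sup>+v\<in>Q. (\<integral>\<^sup>+r\<in>{0..1}. l (u + r *\<^sub>R (v - u)) \<partial>lborel) \<partial>lborel) \<le>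
    ennreal (1 / (\<beta> - real DIM('x) + 1)) * (\<integral>\<^sup>+w\<in>Q. ennreal (enn2real (l w) powr q) \<partial>lborel) +
    ennreal (1 / (1 - \<beta> / (q - 1)))"
proof -
  have dim: "1 \<le> real DIM('x)"
    using DIM_positive[where 'a='x] by linarith
  have q1: "1 < q" using q dim by linarith
  have \<beta>: "0 < \<beta> - real DIM('x) + 1" "\<beta> < q - 1"
    using q by (auto simp: \<beta>_def field_simps)
  have [measurable]: "Q \<in> sets borel"
    using Q by (simp add: compact_imp_closed)
  define f where "f w = ennreal (enn2real (l w) powr q)" for w
  have f[measurable]: "f \<in> borel_measurable borel"
    unfolding f_def by measurable
  define J where "J = (\<integral>\<^sup>+w\<in>Q. f w \<partial>lborel)"
  have pt: "l (u + r *\<^sub>R (v - u)) \<le> ennreal (r powr \<beta>) * f (u + r *\<^sub>R (v - u)) + ennreal (r powr - (\<beta> / (q - 1)))"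
    if "v \<in> Q" "0 < r" "r \<le> 1" for r v
  proof -
    have "u + r *\<^sub>R (v - u) \<in> Q"
      using convexD[OF Q(2) u that(1), of "1-r" r] that by (simp add: algebra_simps)
    then obtain x where x: "l (u + r *\<^sub>R (v - u)) = ennreal x" "0 \<le> x"
      using lfin by (metis enn2real_nonneg ennreal_enn2real infinity_ennreal_def)
    then show ?thesis
      using young_split[OF x(2) that(2) q1, of \<beta>]
      by (simp add: f_def ennreal_leI flip: ennreal_mult ennreal_plus)
  qed
  have "(\<integral>\<^sup>+v\<in>Q. (\<integral>\<^sup>+r\<in>{0..1}. l (u + r *\<^sub>R (v - u)) \<partial>lborel) \<partial>lborel) =
      (\<integral>\<^sup>+v. (\<integral>\<^sup>+r. l (u + r *\<^sub>R (v - u)) * indicator {0..1} r * indicator Q v \<partial>lborel) \<partial>lborel)"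
    by (intro nn_integral_cong nn_integral_multc[symmetric]) measurable
  \<comment> \<open>With \<open>r\<close> fixed, the inner integral over \<open>v\<close> is one to
    which the homothety estimate applies.\<close>
  also have "\<dots> = (\<integral>\<^sup>+r. (\<integral>\<^sup>+v. l (u + r *\<^sub>R (v - u)) * indicator {0..1} r * indicator Q v \<partial>lborel) \<partial>lborel)"
    by (intro lborel_pair.Fubini'[symmetric]) measurable
  also have "\<dots> \<le> (\<integral>\<^sup>+r. ennreal (r powr (\<beta> - real DIM('x))) * indicator {0..1} r * J +
       ennreal (r powr - (\<beta> / (q - 1))) * indicator {0..1} r \<partial>lborel)"
  proof (intro nn_integral_mono_AE)
    \<comment> \<open>At \<open>r = 0\<close> every \<open>powr\<close> has the value 0, so the
      pointwise estimate can fail there.\<close>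
    have "AE r in lborel. r \<noteq> (0::real)"
      by (rule AE_lborel_singleton)
    then show "AE r in lborel. (\<integral>\<^sup>+v. l (u + r *\<^sub>R (v - u)) * indicator {0..1} r * indicator Q v \<partial>lborel) \<le>
       ennreal (r powr (\<beta> - real DIM('x))) * indicator {0..1} r * J +
       ennreal (r powr - (\<beta> / (q - 1))) * indicator {0..1} r"
    proof eventually_elim
      case (elim r)
      show ?case
      proof (cases "r \<in> {0..1}")
        case True
        with elim have r: "0 < r" "r \<le> 1" by auto
        have "(\<integral>\<^sup>+v. l (u + r *\<^sub>R (v - u)) * indicator {0..1} r * indicator Q v \<partial>lborel) \<le>
          (\<integral>\<^sup>+v. ennreal (r powr \<beta>) * (f (u + r *\<^sub>R (v - u)) * indicator Q v) +
             ennreal (r powr - (\<beta> / (q - 1))) * indicator Q v \<partial>lborel)"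
          using pt r True by (intro nn_integral_mono) (auto split: split_indicator)
        also have "\<dots> = ennreal (r powr \<beta>) * (\<integral>\<^sup>+v\<in>Q. f (u + r *\<^sub>R (v - u)) \<partial>lborel) + ennreal (r powr - (\<beta> / (q - 1)))"
          using Q by (simp add: nn_integral_add nn_integral_cmult nn_integral_cmult_indicator)
        also have "\<dots> \<le> ennreal (r powr \<beta>) * (ennreal (r powr - real DIM('x)) * J) + ennreal (r powr - (\<beta> / (q - 1)))"
          unfolding J_def using r u Q
          by (intro add_right_mono mult_left_mono nn_integral_homothety_le) auto
        also have "\<dots> = ennreal (r powr (\<beta> - real DIM('x))) * J + ennreal (r powr - (\<beta> / (q - 1)))"
          by (simp add: powr_add mult.assoc[symmetric] flip: ennreal_mult powr_add)
        finally show ?thesis using True by simp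
      qed simp
    qed
  qed
  also have "\<dots> = (\<integral>\<^sup>+r\<in>{0..1}. ennreal (r powr (\<beta> - real DIM('x) + 1 - 1)) \<partial>lborel) * J +
      (\<integral>\<^sup>+r\<in>{0..1}. ennreal (r powr (1 - \<beta> / (q - 1) - 1)) \<partial>lborel)"
    by (simp add: nn_integral_add nn_integral_multc)
  also have "\<dots> = ennreal (1 / (\<beta> - real DIM('x) + 1)) * J + ennreal (1 / (1 - \<beta> / (q - 1)))"
    using \<beta> q1 by (subst (1 2) nn_integral_powr_unit_interval) auto
  finally show ?thesis
    by (simp add: J_def f_def)
qed

text \<open>Both values are compared with \<open>h w\<close>, and \<open>w\<close> is averaged over
  \<open>Q\<close>, which has volume one. The numbers \<open>M\<close> and \<open>N\<close> make the
  slopes finite, so that \<open>enn2real\<close> loses nothing on \<open>Q\<close>, but they do not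
  enter the bound; this is what permits Lipschitz constants without any uniform control.\<close>

lemma morrey_oscillation:
  fixes Q D :: "'x::euclidean_space set"
  assumes cD: "countable D" and D: "D \<subseteq> Q" "Q \<subseteq> closure D" and h: "continuous_on Q h"
    and Q: "compact Q" "convex Q" "emeasure lborel Q = 1"
    and bdd: "\<And>z. z \<in> Q \<Longrightarrow> steep D h N z \<le> ennreal M"
    and uv: "u \<in> Q" "v \<in> Q" and q: "real DIM('x) < q"
  defines "\<beta> \<equiv> (real DIM('x) + q) / 2 - 1"
  shows "ennreal \<bar>h u - h v\<bar> \<le> ennreal (2 * diameter Q) *
   (ennreal (1 / (\<beta> - real DIM('x) + 1)) * (\<integral>\<^sup>+w\<in>Q. ennreal (enn2real (slope D h w) powr q) \<partial>lborel) +
    ennreal (1 / (1 - \<beta> / (q - 1))))" (is "_ \<le> _ * ?R")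
proof -
  note [measurable] = slope_measurable[OF cD]
  have [measurable]: "Q \<in> sets borel"
    using Q by (simp add: compact_imp_closed)
  define I where "I u w = (\<integral>\<^sup>+r\<in>{0..1}. slope D h (u + r *\<^sub>R (w - u)) \<partial>lborel)" for u w
  have [measurable]: "I u \<in> borel_measurable borel" for u
    unfolding I_def by measurable
  have fin: "slope D h z < \<infinity>" if "z \<in> Q" for z
  proof -
    have "slope D h z \<le> steep D h N z"
      unfolding slope_def by (rule INF_lower) auto
    then show ?thesis
      using bdd[OF that] by (simp add: order_le_less_trans[OF order_trans])
  qed
  have seg: "ennreal \<bar>h y - h w\<bar> \<le> ennreal (diameter Q) * I y w" if "y \<in> Q" "w \<in> Q" for y w
  proof -
    have "ennreal \<bar>h y - h w\<bar> \<le> ennreal (dist y w) * I y w"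
      unfolding I_def by (rule slope_segment[OF cD D h Q(2) bdd that])
    also have "\<dots> \<le> ennreal (diameter Q) * I y w"
      using diameter_bounded_bound[OF compact_imp_bounded[OF Q(1)] that]
      by (intro mult_right_mono ennreal_leI) auto
    finally show ?thesis .
  qed
  have avg: "(\<integral>\<^sup>+w\<in>Q. I y w \<partial>lborel) \<le> ?R" if "y \<in> Q" for y
    unfolding I_def \<beta>_def by (rule average_bound[OF _ fin Q that q]) auto
  have "ennreal \<bar>h u - h v\<bar> = (\<integral>\<^sup>+w\<in>Q. ennreal \<bar>h u - h v\<bar> \<partial>lborel)"
    using Q by (simp add: nn_integral_cmult_indicator)
  also have "\<dots> \<le> (\<integral>\<^sup>+w. ennreal (diameter Q) * (I u w * indicator Q w) +
     ennreal (diameter Q) * (I v w * indicator Q w) \<partial>lborel)"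
  proof (intro nn_integral_mono)
    fix w
    have "ennreal \<bar>h u - h v\<bar> \<le> ennreal (diameter Q) * I u w + ennreal (diameter Q) * I v w" if "w \<in> Q"
    proof -
      have "ennreal \<bar>h u - h v\<bar> \<le> ennreal \<bar>h u - h w\<bar> + ennreal \<bar>h v - h w\<bar>"
        by (simp flip: ennreal_plus)
      also have "\<dots> \<le> ennreal (diameter Q) * I u w + ennreal (diameter Q) * I v w"
        using that uv by (intro add_mono seg) auto
      finally show ?thesis .
    qed
    then show "ennreal \<bar>h u - h v\<bar> * indicator Q w \<le> ennreal (diameter Q) * (I u w * indicator Q w) +
      ennreal (diameter Q) * (I v w * indicator Q w)"
      by (auto split: split_indicator)
  qed
  also have "\<dots> = ennreal (diameter Q) * (\<integral>\<^sup>+w\<in>Q. I u w \<partial>lborel) + ennreal (diameter Q) * (\<integral>\<^sup>+w\<in>Q. I v w \<partial>lborel)"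
    by (simp add: nn_integral_add nn_integral_cmult)
  also have "\<dots> \<le> ennreal (diameter Q) * ?R + ennreal (diameter Q) * ?R"
    using uv by (intro add_mono mult_left_mono avg) auto
  also have "\<dots> = ennreal (2 * diameter Q) * ?R"
  proof -
    have "ennreal (2 * diameter Q) = ennreal (diameter Q) + ennreal (diameter Q)"
      using diameter_ge_0[OF compact_imp_bounded[OF Q(1)]] by (simp flip: ennreal_plus)
    then show ?thesis by (simp only: distrib_right)
  qed
  finally show ?thesis .
qed

section \<open>Strict differentiability of C^1 maps\<close>

lemma Ck_on_subset: "Ck_on k S f \<Longrightarrow> T \<subseteq> S \<Longrightarrow> Ck_on k T f"
  by (induction k arbitrary: f) (auto intro: continuous_on_subset)

text \<open>The mean value inequality on a ball where the derivative differs little from its value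
  at \<open>p\<close>. \<open>Ck_on\<close> provides continuity of the derivative only for each
  fixed direction, so the operator norm is estimated by a sum over the basis; hence the tolerance
  \<open>\<eta> / N\<close> with \<open>N\<close> the dimension.\<close>

lemma C1_strictly_differentiable:
  fixes f :: "'x::euclidean_space \<Rightarrow> 'y::real_normed_vector"
  assumes f: "Ck_on 1 S f" and S: "open S" "p \<in> S" and \<eta>: "0 < \<eta>"
  obtains \<delta> where "0 < \<delta>" "ball p \<delta> \<subseteq> S"
    "\<And>y z. y \<in> ball p \<delta> \<Longrightarrow> z \<in> ball p \<delta> \<Longrightarrow>
       norm (f z - f y - frechet_derivative f (at p) (z - y)) \<le> \<eta> * norm (z - y)"
proof -
  define f' where "f' q = frechet_derivative f (at q)" for q
  have der: "(f has_derivative f' q) (at q)" and cont: "continuous_on S (\<lambda>q. f' q v)" if "q \<in> S" for q v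
    using f that by (auto simp: f'_def frechet_derivative_works[symmetric])
  define N where "N = real DIM('x)"
  have N: "0 < N" by (simp add: N_def)
  have "eventually (\<lambda>q. dist (f' q i) (f' p i) < \<eta> / N) (nhds p)" for i
  proof -
    have "isCont (\<lambda>q. f' q i) p"
      using cont S continuous_on_eq_continuous_at[OF S(1)] by blast
    then show ?thesis
      using divide_pos_pos[OF \<eta> N] unfolding continuous_at tendsto_iff eventually_at_filter
      by (auto elim!: allE[of _ "\<eta> / N"] eventually_mono)
  qed
  then have "eventually (\<lambda>q. q \<in> S \<and> (\<forall>i\<in>Basis. dist (f' q i) (f' p i) < \<eta> / N)) (nhds p)"
    using S by (intro eventually_conj eventually_nhds_in_open eventually_ball_finite ballI) auto
  then obtain \<delta> where \<delta>: "0 < \<delta>" "\<And>q. dist q p < \<delta> \<Longrightarrow> q \<in> S"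
    "\<And>q i. dist q p < \<delta> \<Longrightarrow> i \<in> Basis \<Longrightarrow> dist (f' q i) (f' p i) < \<eta> / N"
    unfolding eventually_nhds_metric by blast
  have sub: "ball p \<delta> \<subseteq> S"
    using \<delta>(2) by (auto simp: dist_commute)
  have onorm: "onorm (f' q - f' p) \<le> \<eta>" if q: "q \<in> ball p \<delta>" for q
  proof -
    have "bounded_linear (f' q - f' p)"
      unfolding fun_diff_def
      using der[of q] der[of p] q sub S(2) by (intro bounded_linear_sub has_derivative_bounded_linear) auto
    then have "onorm (f' q - f' p) \<le> (\<Sum>i\<in>Basis. norm ((f' q - f' p) i))"
      by (rule onorm_componentwise)
    also have "\<dots> \<le> (\<Sum>i\<in>(Basis::'x set). \<eta> / N)"
      using \<delta>(3)[of q] q by (intro sum_mono) (auto simp: dist_norm[symmetric] dist_commute intro: less_imp_le)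
    also have "\<dots> = \<eta>" using N by (simp add: N_def)
    finally show ?thesis .
  qed
  have "norm (f z - f y - f' p (z - y)) \<le> norm (z - y) * \<eta>"
    if yz: "y \<in> ball p \<delta>" "z \<in> ball p \<delta>" for y z
  proof (rule differentiable_bound_linearization[where S = "ball p \<delta>" and f' = f'])
    fix t :: real assume t: "t \<in> {0..1}"
    then have "(1 - t) *\<^sub>R y + t *\<^sub>R z \<in> ball p \<delta>"
      using yz by (intro convexD[OF convex_ball]) auto
    then show "y + t *\<^sub>R (z - y) \<in> ball p \<delta>"
      by (simp add: algebra_simps)
  next
    fix q assume "q \<in> ball p \<delta>"
    then show "(f has_derivative f' q) (at q within ball p \<delta>)" "onorm (f' q - f' p) \<le> \<eta>"
      using has_derivative_at_withinI[OF der[of q]] sub onorm by auto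
  qed (use \<delta>(1) in simp)
  then show ?thesis
    using that[OF \<delta>(1) sub] by (simp add: f'_def mult.commute)
qed

section \<open>Riemannian length and distance\<close>

definition inner_form :: "('e::real_vector \<Rightarrow> 'e \<Rightarrow> real) \<Rightarrow> bool" where
  "inner_form b \<longleftrightarrow> bilinear b \<and> (\<forall>u v. b u v = b v u) \<and> (\<forall>v. v \<noteq> 0 \<longrightarrow> 0 < b v v)"

lemma
  assumes "inner_form b"
  shows inner_form_bilinear: "bilinear b"
    and inner_form_sym: "b u v = b v u"
    and inner_form_pos: "v \<noteq> 0 \<Longrightarrow> 0 < b v v"
    and inner_form_nonneg: "0 \<le> b v v"
proof -
  show b: "bilinear b" "b u v = b v u" and pos: "v \<noteq> 0 \<Longrightarrow> 0 < b v v"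
    using assms unfolding inner_form_def by blast+
  show "0 \<le> b v v"
    using pos bilinear_lzero[OF b(1)] by (cases "v = 0") auto
qed

lemma inner_form_Cauchy_Schwarz:
  assumes "inner_form b"
  shows "b u v \<le> sqrt (b u u) * sqrt (b v v)"
proof (cases "v = 0")
  case True
  then show ?thesis
    using bilinear_rzero[OF inner_form_bilinear[OF assms]] by simp
next
  case False
  note bl = inner_form_bilinear[OF assms]
  note lin = bilinear_ladd[OF bl] bilinear_radd[OF bl] bilinear_lmul[OF bl] bilinear_rmul[OF bl]
    bilinear_lsub[OF bl] bilinear_rsub[OF bl]
  have v: "0 < b v v"
    using False by (rule inner_form_pos[OF assms])
  \<comment> \<open>The coefficient of the orthogonal projection of \<open>u\<close> onto
    \<open>v\<close>.\<close>
  define t where "t = b u v / b v v"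
  have "0 \<le> b (u - t *\<^sub>R v) (u - t *\<^sub>R v)"
    by (rule inner_form_nonneg[OF assms])
  also have "\<dots> = b u u - 2 * t * b u v + t * t * b v v"
    using inner_form_sym[OF assms, of v u] by (simp add: lin algebra_simps)
  also have "\<dots> = b u u - (b u v)\<^sup>2 / b v v"
    using v by (simp add: t_def field_simps power2_eq_square)
  finally have "(b u v)\<^sup>2 \<le> b u u * b v v"
    using v by (simp add: field_simps)
  then have "sqrt ((b u v)\<^sup>2) \<le> sqrt (b u u * b v v)"
    by (rule real_sqrt_le_mono)
  then show ?thesis
    by (simp add: real_sqrt_mult)
qed

lemma inner_form_triangle:
  assumes "inner_form b"
  shows "sqrt (b (u + v) (u + v)) \<le> sqrt (b u u) + sqrt (b v v)"
proof (rule real_le_lsqrt)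
  note bl = inner_form_bilinear[OF assms]
  have "b (u + v) (u + v) = b u u + 2 * b u v + b v v"
    using inner_form_sym[OF assms, of v u] by (simp add: bilinear_ladd[OF bl] bilinear_radd[OF bl])
  also have "\<dots> \<le> b u u + 2 * (sqrt (b u u) * sqrt (b v v)) + b v v"
    using inner_form_Cauchy_Schwarz[OF assms, of u v] by simp
  also have "\<dots> = (sqrt (b u u) + sqrt (b v v))\<^sup>2"
    using inner_form_nonneg[OF assms] by (simp add: power2_sum)
  finally show "b (u + v) (u + v) \<le> (sqrt (b u u) + sqrt (b v v))\<^sup>2" .
qed (use inner_form_nonneg[OF assms] in auto)

lemma inner_form_scale:
  assumes "inner_form b"
  shows "sqrt (b (t *\<^sub>R v) (t *\<^sub>R v)) = \<bar>t\<bar> * sqrt (b v v)"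
proof -
  note bl = inner_form_bilinear[OF assms]
  have "b (t *\<^sub>R v) (t *\<^sub>R v) = t\<^sup>2 * b v v"
    by (simp add: bilinear_lmul[OF bl] bilinear_rmul[OF bl] power2_eq_square)
  then show ?thesis by (simp add: real_sqrt_mult)
qed

text \<open>The extreme values on the compact unit sphere, extended by homogeneity.\<close>

lemma inner_form_equiv_norm:
  fixes b :: "'e::euclidean_space \<Rightarrow> 'e \<Rightarrow> real"
  assumes "inner_form b"
  obtains m M where "0 < m" "0 < M" "\<And>v. m * norm v \<le> sqrt (b v v)" "\<And>v. sqrt (b v v) \<le> M * norm v"
proof -
  interpret b: bounded_bilinear b
    using inner_form_bilinear[OF assms] by (simp add: bilinear_conv_bounded_bilinear)
  have cont: "continuous_on (sphere 0 1) (\<lambda>v. sqrt (b v v))"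
    by (intro continuous_intros b.continuous_on)
  have ne: "sphere (0::'e) 1 \<noteq> {}"
    using vector_choose_size[of 1, where 'a='e] by auto
  obtain v0 where v0: "v0 \<in> sphere 0 1" "\<And>v. v \<in> sphere 0 1 \<Longrightarrow> sqrt (b v0 v0) \<le> sqrt (b v v)"
    using continuous_attains_inf[OF _ ne cont] by auto
  obtain v1 where v1: "v1 \<in> sphere 0 1" "\<And>v. v \<in> sphere 0 1 \<Longrightarrow> sqrt (b v v) \<le> sqrt (b v1 v1)"
    using continuous_attains_sup[OF _ ne cont] by auto
  have pos: "0 < sqrt (b v0 v0)" "0 < sqrt (b v1 v1)"
    using v0(1) v1(1) by (auto intro!: inner_form_pos[OF assms])
  have "sqrt (b v0 v0) * norm v \<le> sqrt (b v v) \<and> sqrt (b v v) \<le> sqrt (b v1 v1) * norm v" for v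
  proof (cases "v = 0")
    case False
    define w where "w = (1 / norm v) *\<^sub>R v"
    have w: "w \<in> sphere 0 1" "v = norm v *\<^sub>R w"
      using False by (auto simp: w_def)
    have "sqrt (b v v) = norm v * sqrt (b w w)"
      using inner_form_scale[OF assms, of "norm v" w] by (simp flip: w(2))
    then show ?thesis
      using v0(2)[OF w(1)] v1(2)[OF w(1)] by (simp add: mult.commute mult_left_mono)
  qed (simp add: b.zero_left)
  then show ?thesis
    using that pos by blast
qed

section \<open>Charts and the metric in coordinates\<close>

locale riemannian_atlas =
  fixes \<A> :: "('a::{t2_space, second_countable_topology}, 'e::euclidean_space) chart set"
    and g :: "'a \<Rightarrow> 'e \<Rightarrow> 'e \<Rightarrow> real"
  assumes atlas: "smooth_atlas \<A>" and metric: "riemannian_metric \<A> g"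
begin

abbreviation d :: "'a \<Rightarrow> 'a \<Rightarrow> real" where "d \<equiv> riemannian_dist \<A> g"

abbreviation pw_C1 :: "(real \<Rightarrow> 'a) \<Rightarrow> bool" where "pw_C1 \<equiv> piecewise_C1_curve \<A>"

abbreviation len :: "(real \<Rightarrow> 'a) \<Rightarrow> real" where "len \<equiv> curve_length \<A> g"

abbreviation img :: "('a, 'e) chart \<Rightarrow> 'e set" where "img c \<equiv> coord c ` dom_chart c"

lemma chart_at: "chart_at \<A> x \<in> \<A>" "x \<in> dom_chart (chart_at \<A> x)"
proof -
  have "x \<in> (\<Union>c\<in>\<A>. dom_chart c)"
    using atlas by (auto simp: smooth_atlas_def)
  then have "\<exists>c. c \<in> \<A> \<and> x \<in> dom_chart c" by auto
  then show "chart_at \<A> x \<in> \<A>" "x \<in> dom_chart (chart_at \<A> x)"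
    unfolding chart_at_def by (metis (mono_tags, lifting) someI_ex)+
qed

lemma
  assumes "c \<in> \<A>"
  shows open_dom: "open (dom_chart c)" and open_img: "open (img c)"
    and chart_homeomorphism: "homeomorphism (dom_chart c) (img c) (coord c) (coord_inv c)"
  using atlas assms by (auto simp: smooth_atlas_def)

lemma
  assumes "c \<in> \<A>"
  shows coord_inv_coord: "x \<in> dom_chart c \<Longrightarrow> coord_inv c (coord c x) = x"
    and coord_coord_inv: "q \<in> img c \<Longrightarrow> coord c (coord_inv c q) = q"
    and coord_inv_in: "q \<in> img c \<Longrightarrow> coord_inv c q \<in> dom_chart c"
    and continuous_coord: "continuous_on (dom_chart c) (coord c)"
    and continuous_coord_inv: "continuous_on (img c) (coord_inv c)"
  using chart_homeomorphism[OF assms] by (auto simp: homeomorphism_def)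

lemma open_coord_image:
  assumes c: "c \<in> \<A>" and U: "open U" "U \<subseteq> dom_chart c"
  shows "open (coord c ` U)"
proof -
  have "openin (top_of_set (img c)) (coord c ` U)"
    using homeomorphism_imp_open_map[OF chart_homeomorphism[OF c], of U] open_dom[OF c] U
    by (simp add: openin_open_eq)
  then show ?thesis
    using open_img[OF c] openin_open_trans by blast
qed

lemma open_coord_inv_image:
  assumes c: "c \<in> \<A>" and U: "open U" "U \<subseteq> img c"
  shows "open (coord_inv c ` U)"
proof -
  have "openin (top_of_set (dom_chart c)) (coord_inv c ` U)"
    using homeomorphism_imp_open_map[OF homeomorphism_symD[OF chart_homeomorphism[OF c]], of U] open_img[OF c] U
    by (simp add: openin_open_eq)
  then show ?thesis
    using open_dom[OF c] openin_open_trans by blast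
qed

lemma transition_Ck:
  assumes "c \<in> \<A>" "c' \<in> \<A>"
  shows "Ck_on k (coord c ` (dom_chart c \<inter> dom_chart c')) (coord c' \<circ> coord_inv c)"
  using atlas assms by (auto simp: smooth_atlas_def)

lemma transition_derivative:
  assumes c: "c \<in> \<A>" "c' \<in> \<A>" and x: "x \<in> dom_chart c" "x \<in> dom_chart c'"
  shows "((coord c' \<circ> coord_inv c) has_derivative
     frechet_derivative (coord c' \<circ> coord_inv c) (at (coord c x))) (at (coord c x))"
  using transition_Ck[OF c, of 1] x by (auto simp: frechet_derivative_works[symmetric])

lemma transition_derivative_continuous:
  assumes c: "c \<in> \<A>" "c' \<in> \<A>"
  shows "continuous_on (coord c ` (dom_chart c \<inter> dom_chart c'))
     (\<lambda>q. frechet_derivative (coord c' \<circ> coord_inv c) (at q) v)"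
  using transition_Ck[OF c, of 1] by auto

lemma linear_from_chart:
  assumes "c \<in> \<A>" "x \<in> dom_chart c"
  shows "linear (from_chart \<A> c x)"
  unfolding from_chart_def
  by (rule has_derivative_linear[OF transition_derivative]) (use assms chart_at in auto)

lemma from_chart_own:
  shows "from_chart \<A> (chart_at \<A> x) x v = v"
proof -
  let ?c = "chart_at \<A> x"
  have "((coord ?c \<circ> coord_inv ?c) has_derivative (\<lambda>v. v)) (at (coord ?c x))"
    by (rule has_derivative_transform_within_open[OF has_derivative_ident open_img[OF chart_at(1)]])
      (auto simp: chart_at coord_coord_inv coord_inv_coord)
  from frechet_derivative_at[OF this, symmetric] show ?thesis
    by (simp add: from_chart_def)
qed

lemma inner_form_metric: "inner_form (g x)"
  using metric by (simp add: riemannian_metric_def inner_form_def)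

text \<open>The coordinate expression of the metric. It varies continuously with \<open>q\<close>,
  whereas \<open>g x\<close> by itself refers to a chart that may jump with
  \<open>x\<close>.\<close>

definition metric_in :: "('a, 'e) chart \<Rightarrow> 'e \<Rightarrow> 'e \<Rightarrow> 'e \<Rightarrow> real" where
  "metric_in c q u v =
     g (coord_inv c q) (from_chart \<A> c (coord_inv c q) u) (from_chart \<A> c (coord_inv c q) v)"

lemma metric_in_continuous:
  assumes "c \<in> \<A>"
  shows "continuous_on (img c) (\<lambda>q. metric_in c q u v)"
proof -
  have "Ck_on 0 (img c) (\<lambda>q. metric_in c q u v)"
    using metric assms unfolding riemannian_metric_def metric_in_def by blast
  then show ?thesis by simp
qed

lemma metric_in_bilinear:
  assumes "c \<in> \<A>" "q \<in> img c"
  shows "bilinear (metric_in c q)"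
proof -
  note lin = linear_from_chart[OF assms(1) coord_inv_in[OF assms]]
  note bl = inner_form_bilinear[OF inner_form_metric, of "coord_inv c q"]
  show ?thesis
    unfolding bilinear_def metric_in_def
    using bl[unfolded bilinear_def]
    by (auto intro!: linear_compose[OF lin, unfolded o_def])
qed

text \<open>Regularity of the metric is given for each fixed pair of vectors. The expansion reduces
  statements about all \<open>w\<close> at once, or about a \<open>w\<close> that varies, to
  finitely many coefficients.\<close>

lemma metric_in_expand:
  assumes "c \<in> \<A>" "q \<in> img c"
  shows "metric_in c q w w = (\<Sum>(i, j)\<in>Basis \<times> Basis. (w \<bullet> i) * (w \<bullet> j) * metric_in c q i j)"
proof -
  note bl = metric_in_bilinear[OF assms]
  have "metric_in c q (\<Sum>i\<in>Basis. (w \<bullet> i) *\<^sub>R i) (\<Sum>i\<in>Basis. (w \<bullet> i) *\<^sub>R i) =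
     (\<Sum>(i, j)\<in>Basis \<times> Basis. metric_in c q ((w \<bullet> i) *\<^sub>R i) ((w \<bullet> j) *\<^sub>R j))"
    by (rule bilinear_sum[OF bl])
  then show ?thesis
    by (simp add: euclidean_representation bilinear_lmul[OF bl] bilinear_rmul[OF bl] mult_ac)
qed

lemma metric_in_own: "metric_in (chart_at \<A> x) (coord (chart_at \<A> x) x) = g x"
  by (intro ext) (simp add: metric_in_def coord_inv_coord chart_at from_chart_own)

lemma metric_in_compare:
  fixes x
  defines "c \<equiv> chart_at \<A> x"
  obtains R where "0 < R" "ball (coord c x) R \<subseteq> img c"
    "\<And>q w. q \<in> ball (coord c x) R \<Longrightarrow> sqrt (metric_in c q w w) \<le> 2 * rnorm g x w"
    "\<And>q w. q \<in> ball (coord c x) R \<Longrightarrow> rnorm g x w \<le> 2 * sqrt (metric_in c q w w)"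
proof -
  have c: "c \<in> \<A>" "x \<in> dom_chart c"
    by (simp_all add: c_def chart_at)
  let ?p = "coord c x"
  obtain m M where m: "0 < m" "\<And>v. m * norm v \<le> sqrt (g x v v)"
    using inner_form_equiv_norm[OF inner_form_metric] by metis
  \<comment> \<open>Summed over all pairs of basis vectors the error is at most 3/4 of
    \<open>g x w w\<close>. This leaves a factor 1/4 below and 7/4, hence at most 4, above; the
    square roots account for the two factors 2.\<close>
  define \<eta> where "\<eta> = (3/4) * m\<^sup>2 / real (card (Basis \<times> Basis :: ('e \<times> 'e) set))"
  have card0: "0 < real (card (Basis \<times> Basis :: ('e \<times> 'e) set))"
    by (simp add: card_cartesian_product)
  have \<eta>: "0 < \<eta>"
    using m(1) card0 unfolding \<eta>_def by (intro divide_pos_pos) auto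
  have p: "?p \<in> img c" using c by auto
  have ev: "eventually (\<lambda>q. dist (metric_in c q i j) (metric_in c ?p i j) < \<eta>) (nhds ?p)" for i j
  proof -
    have "isCont (\<lambda>q. metric_in c q i j) ?p"
      using metric_in_continuous[OF c(1)] p continuous_on_eq_continuous_at[OF open_img[OF c(1)]] by blast
    then show ?thesis
      using \<eta> unfolding continuous_at tendsto_iff eventually_at_filter
      by (auto elim!: allE[of _ \<eta>] eventually_mono)
  qed
  have "eventually (\<lambda>q. q \<in> img c \<and> (\<forall>i\<in>Basis. \<forall>j\<in>Basis. dist (metric_in c q i j) (metric_in c ?p i j) < \<eta>)) (nhds ?p)"
    using p open_img[OF c(1)] ev
    by (intro eventually_conj eventually_nhds_in_open eventually_ball_finite ballI) auto
  then obtain R where R: "0 < R" "\<And>q. dist q ?p < R \<Longrightarrow> q \<in> img c"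
    "\<And>q i j. dist q ?p < R \<Longrightarrow> i \<in> Basis \<Longrightarrow> j \<in> Basis \<Longrightarrow> dist (metric_in c q i j) (metric_in c ?p i j) < \<eta>"
    unfolding eventually_nhds_metric by blast
  have close: "\<bar>metric_in c q w w - g x w w\<bar> \<le> (3/4) * g x w w" if q: "q \<in> ball ?p R" for q w
  proof -
    have qR: "dist q ?p < R" using q by (simp add: dist_commute)
    have "\<bar>metric_in c q w w - g x w w\<bar> = \<bar>metric_in c q w w - metric_in c ?p w w\<bar>"
      using metric_in_own[of x] by (simp add: c_def)
    also have "\<dots> = \<bar>\<Sum>(i, j)\<in>Basis \<times> Basis. (w \<bullet> i) * (w \<bullet> j) * (metric_in c q i j - metric_in c ?p i j)\<bar>"
      using R(2)[OF qR] p by (simp add: metric_in_expand[OF c(1)] case_prod_beta sum_subtractf[symmetric] algebra_simps)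
    also have "\<dots> \<le> (\<Sum>(i, j)\<in>Basis \<times> Basis. \<bar>w \<bullet> i\<bar> * \<bar>w \<bullet> j\<bar> * \<bar>metric_in c q i j - metric_in c ?p i j\<bar>)"
      unfolding case_prod_beta by (rule order_trans[OF sum_abs]) (simp add: abs_mult)
    also have "\<dots> \<le> (\<Sum>(i, j)\<in>(Basis \<times> Basis :: ('e \<times> 'e) set). norm w * norm w * \<eta>)"
      using \<eta>
      by (intro sum_mono) (auto intro!: mult_mono Basis_le_norm less_imp_le[OF R(3)[OF qR, unfolded dist_real_def]])
    also have "\<dots> = (3/4) * (m * norm w)\<^sup>2"
      using card0 by (simp add: \<eta>_def power2_eq_square)
    also have "\<dots> \<le> (3/4) * (sqrt (g x w w))\<^sup>2"
      using m by (intro mult_left_mono power_mono) auto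
    also have "\<dots> = (3/4) * g x w w"
      using inner_form_nonneg[OF inner_form_metric] by simp
    finally show ?thesis .
  qed
  show ?thesis
  proof
    show "ball ?p R \<subseteq> img c"
      using R(2) by (auto simp: dist_commute)
    fix q w assume q: "q \<in> ball ?p R"
    have "metric_in c q w w \<le> 4 * g x w w"
      using close[OF q, of w, unfolded abs_le_iff] inner_form_nonneg[OF inner_form_metric, of x w] by linarith
    then have "metric_in c q w w \<le> 2\<^sup>2 * g x w w" by simp
    then have "sqrt (metric_in c q w w) \<le> sqrt (2\<^sup>2 * g x w w)"
      by (rule real_sqrt_le_mono)
    then show "sqrt (metric_in c q w w) \<le> 2 * rnorm g x w"
      by (simp add: real_sqrt_mult rnorm_def)
    have "g x w w \<le> 4 * metric_in c q w w"
      using close[OF q, of w, unfolded abs_le_iff] by linarith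
    then have "g x w w \<le> 2\<^sup>2 * metric_in c q w w" by simp
    then have "sqrt (g x w w) \<le> sqrt (2\<^sup>2 * metric_in c q w w)"
      by (rule real_sqrt_le_mono)
    then show "rnorm g x w \<le> 2 * sqrt (metric_in c q w w)"
      by (simp add: real_sqrt_mult rnorm_def)
  qed (fact R(1))
qed

section \<open>Speed and length of piecewise C^1 curves\<close>

definition speed :: "(real \<Rightarrow> 'a) \<Rightarrow> real \<Rightarrow> real" where
  "speed \<gamma> t = rnorm g (\<gamma> t) (vector_derivative (coord (chart_at \<A> (\<gamma> t)) \<circ> \<gamma>) (at t))"

lemma curve_length_speed: "len \<gamma> = integral {0..1} (speed \<gamma>)"
  by (simp add: curve_length_def speed_def[abs_def])

lemma speed_nonneg: "0 \<le> speed \<gamma> t"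
  by (simp add: speed_def rnorm_def inner_form_nonneg[OF inner_form_metric])

text \<open>The integrand of the length refers to a chart that changes with \<open>t\<close>. The
  chain rule through the transition map rewrites it in one fixed chart, where its continuity becomes
  visible.\<close>

lemma speed_eq:
  assumes c: "c \<in> \<A>" "\<gamma> t \<in> dom_chart c" and cont: "isCont \<gamma> t"
    and D: "((coord c \<circ> \<gamma>) has_vector_derivative D) (at t)"
  shows "speed \<gamma> t = rnorm g (\<gamma> t) (from_chart \<A> c (\<gamma> t) D)"
    "speed \<gamma> t = sqrt (metric_in c (coord c (\<gamma> t)) D D)"
proof -
  let ?c = "chart_at \<A> (\<gamma> t)"
  have lin: "linear (from_chart \<A> c (\<gamma> t))"
    by (rule linear_from_chart[OF c])
  have "((coord ?c \<circ> coord_inv c) has_derivative from_chart \<A> c (\<gamma> t)) (at (coord c (\<gamma> t)))"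
    unfolding from_chart_def by (rule transition_derivative) (use c chart_at in auto)
  then have "((coord ?c \<circ> coord_inv c) \<circ> (coord c \<circ> \<gamma>) has_derivative from_chart \<A> c (\<gamma> t) \<circ> (\<lambda>r. r *\<^sub>R D)) (at t)"
    using D unfolding has_vector_derivative_def by (intro diff_chain_at) auto
  moreover have "\<exists>U. open U \<and> t \<in> U \<and> (\<forall>s\<in>U. \<gamma> s \<in> dom_chart c)"
    using cont c open_dom[OF c(1)] unfolding continuous_at_open by blast
  then obtain U where "open U" "t \<in> U" "\<And>s. s \<in> U \<Longrightarrow> \<gamma> s \<in> dom_chart c"
    by blast
  ultimately have "(coord ?c \<circ> \<gamma> has_derivative from_chart \<A> c (\<gamma> t) \<circ> (\<lambda>r. r *\<^sub>R D)) (at t)"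
    by (elim has_derivative_transform_within_open) (auto simp: coord_inv_coord c)
  then have "(coord ?c \<circ> \<gamma> has_vector_derivative from_chart \<A> c (\<gamma> t) D) (at t)"
    unfolding has_vector_derivative_def by (simp add: o_def linear_scale[OF lin])
  then show "speed \<gamma> t = rnorm g (\<gamma> t) (from_chart \<A> c (\<gamma> t) D)"
    by (simp add: speed_def vector_derivative_at)
  then show "speed \<gamma> t = sqrt (metric_in c (coord c (\<gamma> t)) D D)"
    by (simp add: rnorm_def metric_in_def coord_inv_coord c)
qed

lemma C1_curve_piece:
  assumes \<gamma>: "C1_curve_on \<A> a b \<gamma>" and ab: "a < b" and c: "c \<in> \<A>" "\<gamma> ` {a..b} \<subseteq> dom_chart c"
  obtains D where "continuous_on {a..b} D"
    "\<And>t. t \<in> {a<..<b} \<Longrightarrow> ((coord c \<circ> \<gamma>) has_vector_derivative D t) (at t)"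
    "\<And>t. t \<in> {a<..<b} \<Longrightarrow> isCont \<gamma> t"
proof -
  have cont: "continuous_on {a..b} \<gamma>" and
    "\<forall>c\<in>\<A>. \<forall>a' b'. a \<le> a' \<and> a' < b' \<and> b' \<le> b \<and> \<gamma> ` {a'..b'} \<subseteq> dom_chart c \<longrightarrow>
        (\<exists>D. continuous_on {a'..b'} D \<and>
          (\<forall>t\<in>{a'..b'}. ((coord c \<circ> \<gamma>) has_vector_derivative D t) (at t within {a'..b'})))"
    using \<gamma> unfolding C1_curve_on_def by blast+
  then obtain D where D: "continuous_on {a..b} D"
    "\<forall>t\<in>{a..b}. ((coord c \<circ> \<gamma>) has_vector_derivative D t) (at t within {a..b})"
    using c ab by blast
  show ?thesis
  proof
    fix t assume t: "t \<in> {a<..<b}"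
    then have w: "at t within {a..b} = at t"
      by (intro at_within_interior) (simp add: interior_atLeastAtMost_real)
    show "((coord c \<circ> \<gamma>) has_vector_derivative D t) (at t)"
      using bspec[OF D(2), of t] t by (simp add: w)
    show "isCont \<gamma> t"
      using continuous_on_interior[OF cont, of t] t by (simp add: interior_atLeastAtMost_real)
  qed (fact D(1))
qed

text \<open>In a single chart the speed agrees with a continuous function except at the two end
  points, where the two-sided \<open>vector_derivative\<close> need not be meaningful.\<close>

lemma speed_integrable_piece:
  assumes \<gamma>: "C1_curve_on \<A> a b \<gamma>" and ab: "a < b" and c: "c \<in> \<A>" "\<gamma> ` {a..b} \<subseteq> dom_chart c"
  shows "speed \<gamma> integrable_on {a..b}"
proof -
  obtain D where D: "continuous_on {a..b} D"
    "\<And>t. t \<in> {a<..<b} \<Longrightarrow> ((coord c \<circ> \<gamma>) has_vector_derivative D t) (at t)"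
    "\<And>t. t \<in> {a<..<b} \<Longrightarrow> isCont \<gamma> t"
    using C1_curve_piece[OF assms] by metis
  have cont: "continuous_on {a..b} \<gamma>"
    using \<gamma> by (simp add: C1_curve_on_def)
  define f where "f t = sqrt (\<Sum>(i, j)\<in>Basis \<times> Basis. (D t \<bullet> i) * (D t \<bullet> j) * metric_in c (coord c (\<gamma> t)) i j)" for t
  have "continuous_on {a..b} (\<lambda>t. metric_in c (coord c (\<gamma> t)) i j)" for i j
    by (rule continuous_on_compose2[OF metric_in_continuous[OF c(1)]
          continuous_on_compose2[OF continuous_coord[OF c(1)] cont c(2)]]) (use c in auto)
  then have "continuous_on {a..b} f"
    unfolding f_def case_prod_beta by (intro continuous_intros D(1)) auto
  then have "f integrable_on {a..b}"
    by (rule integrable_continuous_real)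
  then show ?thesis
  proof (rule integrable_spike_finite[rotated -1])
    show "finite {a, b}" by simp
    fix t assume "t \<in> {a..b} - {a, b}"
    then have t: "t \<in> {a<..<b}" "\<gamma> t \<in> dom_chart c" using c by auto
    then show "speed \<gamma> t = f t"
      using speed_eq(2)[OF c(1) t(2) D(3)[OF t(1)] D(2)[OF t(1)]]
      by (simp add: f_def metric_in_expand[OF c(1)])
  qed
qed

text \<open>The radius does two things at once: it keeps the curve in a chart domain and separates
  \<open>x\<close> from all other break points.\<close>

lemma near_in_chart:
  fixes \<gamma> :: "real \<Rightarrow> 'a"
  assumes \<gamma>: "continuous_on {0..1} \<gamma>" and S: "finite S" and x: "x \<in> {0..1}" "\<gamma> x \<in> U" "open U"
  obtains e where "0 < e" "\<And>y. y \<in> {0..1} \<Longrightarrow> \<bar>y - x\<bar> < e \<Longrightarrow> \<gamma> y \<in> U"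
    "\<And>y. \<bar>y - x\<bar> < e \<Longrightarrow> y \<in> S \<Longrightarrow> y = x"
proof -
  obtain W where W: "open W" "W \<inter> {0..1} = \<gamma> -` U \<inter> {0..1}"
    using \<gamma> x(3) unfolding continuous_on_open_invariant by metis
  have "open (W - (S - {x}))" "x \<in> W - (S - {x})"
    using W x S by (auto intro!: open_Diff finite_imp_closed)
  then obtain e where "0 < e" "ball x e \<subseteq> W - (S - {x})"
    by (metis openE)
  then show ?thesis
    using W by (intro that[of e]) (auto simp: dist_real_def abs_minus_commute subset_iff)
qed

text \<open>The end points are added to the break points, because two-sided derivatives there depend
  on values of \<open>\<gamma>\<close> outside [0,1].\<close>

lemma piecewise_C1_derivative:
  assumes \<gamma>: "pw_C1 \<gamma>"
  obtains S where "finite S" "0 \<in> S" "1 \<in> S"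
    "\<And>t. t \<in> {0..1} - S \<Longrightarrow> isCont \<gamma> t"
    "\<And>t c. t \<in> {0..1} - S \<Longrightarrow> c \<in> \<A> \<Longrightarrow> \<gamma> t \<in> dom_chart c \<Longrightarrow>
       ((coord c \<circ> \<gamma>) has_vector_derivative vector_derivative (coord c \<circ> \<gamma>) (at t)) (at t)"
proof -
  obtain S where cont: "continuous_on {0..1} \<gamma>" and S: "finite S"
    "\<And>a b. 0 \<le> a \<Longrightarrow> a < b \<Longrightarrow> b \<le> 1 \<Longrightarrow> {a<..<b} \<inter> S = {} \<Longrightarrow> C1_curve_on \<A> a b \<gamma>"
    using \<gamma> unfolding piecewise_C1_curve_def by blast
  have *: "isCont \<gamma> t \<and>
       ((coord c \<circ> \<gamma>) has_vector_derivative vector_derivative (coord c \<circ> \<gamma>) (at t)) (at t)"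
    if t: "t \<in> {0..1} - insert 0 (insert 1 S)" and c: "c \<in> \<A>" "\<gamma> t \<in> dom_chart c" for t c
  proof -
    obtain e where e: "0 < e" "\<And>y. y \<in> {0..1} \<Longrightarrow> \<bar>y - t\<bar> < e \<Longrightarrow> \<gamma> y \<in> dom_chart c"
      "\<And>y. \<bar>y - t\<bar> < e \<Longrightarrow> y \<in> insert 0 (insert 1 S) \<Longrightarrow> y = t"
      using near_in_chart[OF cont _ _ c(2) open_dom[OF c(1)], of "insert 0 (insert 1 S)"] S t by auto
    define e' where "e' = Min {e / 2, t, 1 - t}"
    have e': "0 < e'" "e' < e" "e' \<le> t" "e' \<le> 1 - t"
      using e t by (auto simp: e'_def)
    have "\<bar>y - t\<bar> < e" if "y \<in> {t - e'..t + e'}" for y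
      using e' that by auto
    note near = this
    have "C1_curve_on \<A> (t - e') (t + e') \<gamma>"
    proof (rule S(2))
      have "y \<notin> S" if "y \<in> {t - e'<..<t + e'}" for y
        using e(3)[of y] near[of y] that t by auto
      then show "{t - e'<..<t + e'} \<inter> S = {}" by blast
    qed (use e' in auto)
    moreover have "\<gamma> ` {t - e'..t + e'} \<subseteq> dom_chart c"
    proof (rule image_subsetI)
      fix y assume "y \<in> {t - e'..t + e'}"
      then show "\<gamma> y \<in> dom_chart c"
        using e(2)[of y] near[of y] e' by auto
    qed
    moreover have "t - e' < t + e'" "t \<in> {t - e'<..<t + e'}"
      using e' by auto
    ultimately obtain D where "((coord c \<circ> \<gamma>) has_vector_derivative D t) (at t)" "isCont \<gamma> t"
      using C1_curve_piece c(1) by metis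
    then show ?thesis
      by (simp add: vector_derivative_at)
  qed
  show ?thesis
    using S(1) * chart_at by (intro that[of "insert 0 (insert 1 S)"]) blast+
qed

lemma speed_integrable:
  assumes \<gamma>: "pw_C1 \<gamma>"
  shows "speed \<gamma> integrable_on {0..1}"
proof -
  obtain S where cont: "continuous_on {0..1} \<gamma>" and S: "finite S"
    "\<And>a b. 0 \<le> a \<Longrightarrow> a < b \<Longrightarrow> b \<le> 1 \<Longrightarrow> {a<..<b} \<inter> S = {} \<Longrightarrow> C1_curve_on \<A> a b \<gamma>"
    using \<gamma> unfolding piecewise_C1_curve_def by blast
  define P where "P a b \<longleftrightarrow> (0 \<le> a \<longrightarrow> b \<le> 1 \<longrightarrow> speed \<gamma> integrable_on {a..b})" for a b
  have "P 0 1"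
  proof (rule Bolzano)
    show "P a c" if "P a b" "P b c" "a \<le> b" "b \<le> c" for a b c
      using that unfolding P_def by (auto intro: Henstock_Kurzweil_Integration.integrable_combine)
    fix x :: real assume x: "0 \<le> x" "x \<le> 1"
    let ?c = "chart_at \<A> (\<gamma> x)"
    obtain e where e: "0 < e" "\<And>y. y \<in> {0..1} \<Longrightarrow> \<bar>y - x\<bar> < e \<Longrightarrow> \<gamma> y \<in> dom_chart ?c"
      "\<And>y. \<bar>y - x\<bar> < e \<Longrightarrow> y \<in> S \<Longrightarrow> y = x"
      using near_in_chart[OF cont S(1) _ chart_at(2) open_dom[OF chart_at(1)]] x by auto
    show "\<exists>d>0. \<forall>a b. a \<le> x \<and> x \<le> b \<and> b - a < d \<longrightarrow> P a b"
      unfolding P_def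
    proof (intro exI[of _ e] conjI allI impI, fact e(1))
      fix a b assume ab: "a \<le> x \<and> x \<le> b \<and> b - a < e" "0 \<le> a" "b \<le> 1"
      \<comment> \<open>The point \<open>x\<close> may itself be a break point. Pieces on one side
        of it have no break point in their interior.\<close>
      have piece: "speed \<gamma> integrable_on {l..r}"
        if lr: "l \<le> r" "0 \<le> l" "r \<le> 1" "x - e < l" "r < x + e" "r \<le> x \<or> x \<le> l" for l r
      proof (cases "l = r")
        case False
        have "C1_curve_on \<A> l r \<gamma>"
        proof (rule S(2))
          have "y \<notin> S" if "l < y" "y < r" for y
            using e(3)[of y] that lr by auto
          then show "{l<..<r} \<inter> S = {}" by auto
        qed (use lr False in auto)
        moreover have "\<gamma> ` {l..r} \<subseteq> dom_chart ?c"
          using e(2) lr by force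
        ultimately show ?thesis
          using lr False chart_at by (intro speed_integrable_piece) auto
      qed (auto simp: integrable_on_def intro: has_integral_refl)
      show "speed \<gamma> integrable_on {a..b}"
        using ab by (intro Henstock_Kurzweil_Integration.integrable_combine[of a x b] piece) auto
    qed
  qed simp
  then show ?thesis by (simp add: P_def)
qed

lemma curve_length_nonneg:
  assumes "pw_C1 \<gamma>"
  shows "0 \<le> len \<gamma>"
  unfolding curve_length_speed
  by (intro integral_nonneg speed_integrable assms speed_nonneg)

text \<open>Agreement on an open set around \<open>t\<close> is all that is asked, since a join of
  two curves is a reparametrisation of either one only on half of its interval.\<close>

lemma speed_affine:
  assumes m: "0 < m" and \<eta>: "open U" "t \<in> U" "\<And>s. s \<in> U \<Longrightarrow> \<eta> s = \<gamma> (m * s + k)"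
    and cont: "isCont \<gamma> (m * t + k)"
    and D: "((coord (chart_at \<A> (\<eta> t)) \<circ> \<gamma>) has_vector_derivative D) (at (m * t + k))"
  shows "speed \<eta> t = m * speed \<gamma> (m * t + k)"
proof -
  let ?c = "chart_at \<A> (\<eta> t)"
  have \<eta>t: "\<eta> t = \<gamma> (m * t + k)" using \<eta> by auto
  have ev: "eventually (\<lambda>s. \<gamma> (m * s + k) = \<eta> s) (nhds t)"
    unfolding eventually_nhds using \<eta> by (intro exI[of _ U]) auto
  have "((\<lambda>s. m * s + k) has_vector_derivative m) (at t)"
    by (auto intro!: derivative_eq_intros)
  then have "((coord ?c \<circ> \<gamma>) \<circ> (\<lambda>s. m * s + k) has_vector_derivative m *\<^sub>R D) (at t)"
    using D by (rule vector_diff_chain_at)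
  then have D': "(coord ?c \<circ> \<eta> has_vector_derivative m *\<^sub>R D) (at t)"
    using \<eta> by (elim has_vector_derivative_transform_within_open) auto
  have "isCont (\<lambda>s. \<gamma> (m * s + k)) t"
    using isCont_o2[of t "\<lambda>s. m * s + k" \<gamma>] cont by simp
  then have cont': "isCont \<eta> t"
    using isCont_cong[OF ev] by simp
  have "speed \<eta> t = rnorm g (\<eta> t) (m *\<^sub>R from_chart \<A> ?c (\<eta> t) D)"
    using speed_eq(1)[OF chart_at cont' D'] linear_scale[OF linear_from_chart[OF chart_at]] by simp
  also have "\<dots> = m * rnorm g (\<eta> t) (from_chart \<A> ?c (\<eta> t) D)"
    using m by (simp add: rnorm_def inner_form_scale[OF inner_form_metric])
  also have "\<dots> = m * speed \<gamma> (m * t + k)"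
    using speed_eq(1)[OF chart_at(1) _ cont D] chart_at(2)[of "\<eta> t"] by (simp add: \<eta>t)
  finally show ?thesis .
qed

lemma C1_curve_on_affine:
  assumes \<gamma>: "C1_curve_on \<A> (m * a + k) (m * b + k) \<gamma>" and m: "0 < m"
    and \<eta>: "\<And>t. t \<in> {a..b} \<Longrightarrow> \<eta> t = \<gamma> (m * t + k)"
  shows "C1_curve_on \<A> a b \<eta>"
  unfolding C1_curve_on_def
proof (intro conjI ballI allI impI)
  have im: "(\<lambda>t. m * t + k) ` {a'..b'} = {m * a' + k..m * b' + k}" if "a' \<le> b'" for a' b'
    using m that by (auto simp: image_affinity_atLeastAtMost)
  have cont: "continuous_on {m * a + k..m * b + k} \<gamma>"
    using \<gamma> unfolding C1_curve_on_def by blast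
  have "continuous_on {a..b} (\<lambda>t. \<gamma> (m * t + k))"
    by (rule continuous_on_compose2[OF cont]) (use m in \<open>auto intro!: continuous_intros\<close>)
  then show "continuous_on {a..b} \<eta>"
    by (rule continuous_on_eq) (simp add: \<eta>)
  fix c a' b' assume c: "c \<in> \<A>" and ab: "a \<le> a' \<and> a' < b' \<and> b' \<le> b \<and> \<eta> ` {a'..b'} \<subseteq> dom_chart c"
  have "\<gamma> ` {m * a' + k..m * b' + k} \<subseteq> dom_chart c"
    using ab \<eta> by (subst im[symmetric]) auto
  moreover have "m * a + k \<le> m * a' + k" "m * a' + k < m * b' + k" "m * b' + k \<le> m * b + k"
    using ab m by auto
  ultimately obtain D where D: "continuous_on {m * a' + k..m * b' + k} D"
    "\<forall>t\<in>{m * a' + k..m * b' + k}. ((coord c \<circ> \<gamma>) has_vector_derivative D t) (at t within {m * a' + k..m * b' + k})"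
    using \<gamma> c unfolding C1_curve_on_def by blast
  show "\<exists>D. continuous_on {a'..b'} D \<and>
          (\<forall>t\<in>{a'..b'}. ((coord c \<circ> \<eta>) has_vector_derivative D t) (at t within {a'..b'}))"
  proof (intro exI[of _ "\<lambda>t. m *\<^sub>R D (m * t + k)"] conjI ballI)
    show "continuous_on {a'..b'} (\<lambda>t. m *\<^sub>R D (m * t + k))"
      using m by (intro continuous_intros continuous_on_compose2[OF D(1)]) auto
    fix t assume t: "t \<in> {a'..b'}"
    have "((coord c \<circ> \<gamma>) \<circ> (\<lambda>s. m * s + k) has_vector_derivative m *\<^sub>R D (m * t + k)) (at t within {a'..b'})"
      using D(2) t m ab
      by (intro vector_diff_chain_within) (auto simp: im intro!: derivative_eq_intros)
    then show "((coord c \<circ> \<eta>) has_vector_derivative m *\<^sub>R D (m * t + k)) (at t within {a'..b'})"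
      by (rule has_vector_derivative_transform[OF t, rotated]) (use \<eta> ab in auto)
  qed
qed

lemma piecewise_C1_join:
  assumes \<gamma>1: "pw_C1 \<gamma>1" and \<gamma>2: "pw_C1 \<gamma>2" and eq: "\<gamma>1 1 = \<gamma>2 0"
  shows "pw_C1 (\<gamma>1 +++ \<gamma>2)"
proof -
  obtain S1 where cont1: "continuous_on {0..1} \<gamma>1" and S1: "finite S1"
    "\<And>a b. 0 \<le> a \<Longrightarrow> a < b \<Longrightarrow> b \<le> 1 \<Longrightarrow> {a<..<b} \<inter> S1 = {} \<Longrightarrow> C1_curve_on \<A> a b \<gamma>1"
    using \<gamma>1 unfolding piecewise_C1_curve_def by blast
  obtain S2 where cont2: "continuous_on {0..1} \<gamma>2" and S2: "finite S2"
    "\<And>a b. 0 \<le> a \<Longrightarrow> a < b \<Longrightarrow> b \<le> 1 \<Longrightarrow> {a<..<b} \<inter> S2 = {} \<Longrightarrow> C1_curve_on \<A> a b \<gamma>2"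
    using \<gamma>2 unfolding piecewise_C1_curve_def by blast
  define S where "S = insert (1/2) ((\<lambda>s. s / 2) ` S1 \<union> (\<lambda>s. (s + 1) / 2) ` S2)"
  have "path (\<gamma>1 +++ \<gamma>2)"
    using cont1 cont2 eq by (intro path_join_imp) (auto simp: path_def pathfinish_def pathstart_def)
  then have "continuous_on {0..1} (\<gamma>1 +++ \<gamma>2)"
    by (simp add: path_def)
  moreover have "C1_curve_on \<A> a b (\<gamma>1 +++ \<gamma>2)"
    if ab: "0 \<le> a" "a < b" "b \<le> 1" "{a<..<b} \<inter> S = {}" for a b
  proof -
    have "1/2 \<notin> {a<..<b}"
      using ab(4) unfolding S_def by blast
    then consider "b \<le> 1/2" | "1/2 \<le> a" by fastforce
    then show ?thesis
    proof cases
      case 1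
      have "s \<notin> S1" if s: "s \<in> {2 * a<..<2 * b}" for s
      proof
        assume "s \<in> S1"
        then have "s / 2 \<in> S" by (simp add: S_def)
        moreover have "s / 2 \<in> {a<..<b}" using s by auto
        ultimately show False using ab(4) by blast
      qed
      then have "C1_curve_on \<A> (2 * a + 0) (2 * b + 0) \<gamma>1"
        using ab 1 by (intro S1(2)) auto
      then show ?thesis
        by (rule C1_curve_on_affine) (use 1 in \<open>auto simp: joinpaths_def\<close>)
    next
      case 2
      have "s \<notin> S2" if s: "s \<in> {2 * a - 1<..<2 * b - 1}" for s
      proof
        assume "s \<in> S2"
        then have "(s + 1) / 2 \<in> S" by (simp add: S_def)
        moreover have "(s + 1) / 2 \<in> {a<..<b}" using s by auto
        ultimately show False using ab(4) by blast
      qed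
      then have "C1_curve_on \<A> (2 * a + -1) (2 * b + -1) \<gamma>2"
        using ab 2 by (intro S2(2)) auto
      then show ?thesis
      proof (rule C1_curve_on_affine)
        fix t assume "t \<in> {a..b}"
        then consider "t = 1/2" | "1/2 < t" using 2 by fastforce
        then show "(\<gamma>1 +++ \<gamma>2) t = \<gamma>2 (2 * t + -1)"
        proof cases
          case 1
          show ?thesis unfolding 1 by (simp add: joinpaths_def eq)
        qed (simp add: joinpaths_def)
      qed simp
    qed
  qed
  moreover have "finite S" using S1 S2 by (simp add: S_def)
  ultimately show ?thesis
    unfolding piecewise_C1_curve_def by blast
qed

text \<open>The cases \<open>a = 0\<close> and \<open>a = 1/2\<close> are the two halves of a join.
  The interval in the hypothesis is open, so the value at the junction does not matter.\<close>

lemma integral_speed_affine: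
  assumes \<gamma>: "pw_C1 \<gamma>" and \<eta>: "\<And>t. t \<in> {a<..<a + 1/2} \<Longrightarrow> \<eta> t = \<gamma> (2 * t - 2 * a)"
  shows "(speed \<eta> has_integral len \<gamma>) {a..a + 1/2}"
proof -
  obtain T where T: "finite T" "0 \<in> T" "1 \<in> T" "\<And>t. t \<in> {0..1} - T \<Longrightarrow> isCont \<gamma> t"
    "\<And>t c. t \<in> {0..1} - T \<Longrightarrow> c \<in> \<A> \<Longrightarrow> \<gamma> t \<in> dom_chart c \<Longrightarrow>
       ((coord c \<circ> \<gamma>) has_vector_derivative vector_derivative (coord c \<circ> \<gamma>) (at t)) (at t)"
    using piecewise_C1_derivative[OF \<gamma>] by metis
  have "(speed \<gamma> has_integral len \<gamma>) (cbox 0 1)"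
    using speed_integrable[OF \<gamma>] by (simp add: curve_length_speed has_integral_integral)
  from has_integral_affinity[OF this, of 2 "- 2 * a"]
  have "((\<lambda>t. speed \<gamma> (2 * t + - 2 * a)) has_integral (1/2) * len \<gamma>) {a..a + 1/2}"
    using image_affinity_atLeastAtMost_div[of 2 a 0 1] by (simp add: add.commute)
  then have "((\<lambda>t. 2 * speed \<gamma> (2 * t + - 2 * a)) has_integral 2 * ((1/2) * len \<gamma>)) {a..a + 1/2}"
    by (rule has_integral_mult_right)
  then have int: "((\<lambda>t. 2 * speed \<gamma> (2 * t + - 2 * a)) has_integral len \<gamma>) {a..a + 1/2}"
    by simp
  show ?thesis
  proof (rule has_integral_spike_finite[OF _ _ int])
    show "finite ((\<lambda>s. s / 2 + a) ` T)" using T by simp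
    fix t assume t: "t \<in> {a..a + 1/2} - (\<lambda>s. s / 2 + a) ` T"
    have avoid: "t \<noteq> s / 2 + a" if "s \<in> T" for s
      using t that by blast
    have nT: "2 * t + - 2 * a \<notin> T"
    proof
      have "t = (2 * t + - 2 * a) / 2 + a" by (simp add: field_simps)
      then show "2 * t + - 2 * a \<in> T \<Longrightarrow> False" using avoid by blast
    qed
    have "t \<noteq> a" "t \<noteq> a + 1/2"
      using avoid[OF T(2)] avoid[OF T(3)] by auto
    then have t': "t \<in> {a<..<a + 1/2}"
      using t by auto
    then have \<eta>t: "\<eta> t = \<gamma> (2 * t + - 2 * a)" using \<eta> by auto
    have "2 * t + - 2 * a \<in> {0..1} - T" using t' nT by auto
    then show "speed \<eta> t = 2 * speed \<gamma> (2 * t + - 2 * a)"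
      using t' \<eta> chart_at(2)[of "\<eta> t"] \<eta>t
      by (intro speed_affine[OF _ open_greaterThanLessThan[of a "a + 1/2"] _ _ T(4) T(5)]) (auto simp: chart_at)
  qed
qed

lemma curve_length_join:
  assumes \<gamma>1: "pw_C1 \<gamma>1" and \<gamma>2: "pw_C1 \<gamma>2"
  shows "len (\<gamma>1 +++ \<gamma>2) = len \<gamma>1 + len \<gamma>2"
proof -
  have "(speed (\<gamma>1 +++ \<gamma>2) has_integral len \<gamma>1) {0..0 + 1/2}"
    by (rule integral_speed_affine[OF \<gamma>1]) (simp add: joinpaths_def)
  moreover have "(speed (\<gamma>1 +++ \<gamma>2) has_integral len \<gamma>2) {1/2..1/2 + 1/2}"
    by (rule integral_speed_affine[OF \<gamma>2]) (simp add: joinpaths_def)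
  ultimately have "(speed (\<gamma>1 +++ \<gamma>2) has_integral len \<gamma>1 + len \<gamma>2) {0..1}"
    by (intro has_integral_combine[of 0 "1/2" 1]) auto
  then show ?thesis
    by (simp add: curve_length_speed integral_unique)
qed

lemma segment_curve:
  assumes c: "c \<in> \<A>" and seg: "closed_segment p q \<subseteq> img c"
  defines "\<gamma> \<equiv> coord_inv c \<circ> linepath p q"
  shows "pw_C1 \<gamma>"
    and "t \<in> {0..1} \<Longrightarrow> speed \<gamma> t = sqrt (metric_in c (linepath p q t) (q - p) (q - p))"
proof -
  have inimg: "linepath p q t \<in> img c" if "t \<in> {0..1}" for t
    using seg that by (auto simp: linepath_image_01[symmetric])
  have cg: "coord c (\<gamma> t) = linepath p q t" "\<gamma> t \<in> dom_chart c" if "t \<in> {0..1}" for t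
    using inimg[OF that] by (auto simp: \<gamma>_def coord_coord_inv[OF c] coord_inv_in[OF c])
  \<comment> \<open>\<open>linepath\<close> is affine on the whole line and so remains in the open
    image of the chart slightly beyond [0,1]. This gives two-sided derivatives at the end points
    too.\<close>
  define U where "U = linepath p q -` img c"
  have contl: "continuous_on S (linepath p q)" for S
    unfolding linepath_def by (intro continuous_intros)
  have U: "open U" "{0..1} \<subseteq> U"
    using inimg open_img[OF c] contl by (auto simp: U_def intro!: open_vimage)
  have contU: "continuous_on U \<gamma>"
    unfolding \<gamma>_def by (intro continuous_on_compose contl continuous_on_subset[OF continuous_coord_inv[OF c]])
      (auto simp: U_def)
  have lp: "(linepath p q has_vector_derivative (q - p)) (at t within S)" for t S
    by (rule has_vector_derivative_linepath_within)
  have "C1_curve_on \<A> a b \<gamma>" if ab: "0 \<le> a" "a < b" "b \<le> 1" for a b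
    unfolding C1_curve_on_def
  proof (intro conjI ballI allI impI)
    show "continuous_on {a..b} \<gamma>"
      using contU U ab by (elim continuous_on_subset) auto
    fix c' a' b' assume c': "c' \<in> \<A>" and ab': "a \<le> a' \<and> a' < b' \<and> b' \<le> b \<and> \<gamma> ` {a'..b'} \<subseteq> dom_chart c'"
    let ?D = "\<lambda>t. frechet_derivative (coord c' \<circ> coord_inv c) (at (linepath p q t)) (q - p)"
    have in': "linepath p q t = coord c (\<gamma> t)" "\<gamma> t \<in> dom_chart c \<inter> dom_chart c'" if "t \<in> {a'..b'}" for t
      using cg[of t] that ab ab' by auto
    show "\<exists>D. continuous_on {a'..b'} D \<and>
          (\<forall>t\<in>{a'..b'}. ((coord c' \<circ> \<gamma>) has_vector_derivative D t) (at t within {a'..b'}))"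
    proof (intro exI[of _ ?D] conjI ballI)
      show "continuous_on {a'..b'} ?D"
      proof (rule continuous_on_compose2[OF transition_derivative_continuous[OF c c'] contl])
        show "linepath p q ` {a'..b'} \<subseteq> coord c ` (dom_chart c \<inter> dom_chart c')"
          using in' by blast
      qed
      fix t assume t: "t \<in> {a'..b'}"
      have der: "((coord c' \<circ> coord_inv c) has_derivative
         frechet_derivative (coord c' \<circ> coord_inv c) (at (linepath p q t))) (at (linepath p q t))"
        unfolding in'(1)[OF t] using in'(2)[OF t] by (intro transition_derivative[OF c c']) auto
      have "((coord c' \<circ> coord_inv c) \<circ> linepath p q has_derivative
         frechet_derivative (coord c' \<circ> coord_inv c) (at (linepath p q t)) \<circ> (\<lambda>r. r *\<^sub>R (q - p))) (at t)"
        by (rule diff_chain_at[OF lp[unfolded has_vector_derivative_def] der])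
      moreover have "frechet_derivative (coord c' \<circ> coord_inv c) (at (linepath p q t)) \<circ> (\<lambda>r. r *\<^sub>R (q - p)) = (\<lambda>r. r *\<^sub>R ?D t)"
        by (rule ext) (simp add: linear_scale[OF has_derivative_linear[OF der]])
      ultimately show "((coord c' \<circ> \<gamma>) has_vector_derivative ?D t) (at t within {a'..b'})"
        unfolding has_vector_derivative_def \<gamma>_def o_assoc by (simp add: has_derivative_at_withinI)
    qed
  qed
  moreover have "continuous_on {0..1} \<gamma>"
    using contU U by (elim continuous_on_subset) auto
  ultimately show "pw_C1 \<gamma>"
    unfolding piecewise_C1_curve_def by (intro conjI exI[of _ "{}"]) auto
  show "speed \<gamma> t = sqrt (metric_in c (linepath p q t) (q - p) (q - p))" if t: "t \<in> {0..1}"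
  proof -
    have "isCont \<gamma> t"
      using contU U t continuous_on_eq_continuous_at[OF U(1)] by blast
    moreover have "((coord c \<circ> \<gamma>) has_vector_derivative (q - p)) (at t)"
      by (rule has_vector_derivative_transform_within_open[OF lp U(1)])
        (use t U in \<open>auto simp: U_def \<gamma>_def coord_coord_inv[OF c]\<close>)
    ultimately show ?thesis
      using speed_eq(2)[where \<gamma>=\<gamma> and t=t, OF c cg(2)[OF t]] cg(1)[OF t] by simp
  qed
qed

lemma segment_curve_length:
  assumes c: "c \<in> \<A>" and seg: "closed_segment p q \<subseteq> img c"
    and B: "\<And>z. z \<in> closed_segment p q \<Longrightarrow> sqrt (metric_in c z (q - p) (q - p)) \<le> B"
  shows "len (coord_inv c \<circ> linepath p q) \<le> B"
proof -
  have "len (coord_inv c \<circ> linepath p q) \<le> integral {0..1::real} (\<lambda>_. B)"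
    unfolding curve_length_speed
    by (intro integral_le speed_integrable segment_curve(1)[OF c seg])
      (auto simp: segment_curve(2)[OF c seg] linepath_image_01[symmetric] intro!: B)
  then show ?thesis by simp
qed

lemma dist_le_length:
  assumes "pw_C1 \<gamma>"
  shows "d (\<gamma> 0) (\<gamma> 1) \<le> len \<gamma>"
  unfolding riemannian_dist_def
  by (rule cInf_lower) (use assms curve_length_nonneg in \<open>auto intro!: bdd_belowI[of _ 0]\<close>)

lemma dist_segment:
  assumes c: "c \<in> \<A>" and seg: "closed_segment p q \<subseteq> img c"
    and B: "\<And>z. z \<in> closed_segment p q \<Longrightarrow> sqrt (metric_in c z (q - p) (q - p)) \<le> B"
  shows "d (coord_inv c p) (coord_inv c q) \<le> B"
  using dist_le_length[OF segment_curve(1)[OF c seg]] segment_curve_length[OF assms]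
  by (simp add: linepath_def)

text \<open>Coordinate segments compete in the infimum that defines the distance. A ball is convex,
  so they stay where the metric is comparable to \<open>g x\<close>.\<close>

lemma dist_upper:
  fixes x
  defines "c \<equiv> chart_at \<A> x"
  obtains R where "0 < R" "ball (coord c x) R \<subseteq> img c"
    "\<And>p q. p \<in> ball (coord c x) R \<Longrightarrow> q \<in> ball (coord c x) R \<Longrightarrow>
       d (coord_inv c p) (coord_inv c q) \<le> 2 * rnorm g x (q - p)"
proof -
  obtain R where R: "0 < R" "ball (coord c x) R \<subseteq> img c"
    "\<And>q w. q \<in> ball (coord c x) R \<Longrightarrow> sqrt (metric_in c q w w) \<le> 2 * rnorm g x w"
    using metric_in_compare[of x] unfolding c_def by metis
  have "d (coord_inv c p) (coord_inv c q) \<le> 2 * rnorm g x (q - p)"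
    if "p \<in> ball (coord c x) R" "q \<in> ball (coord c x) R" for p q
  proof -
    have "closed_segment p q \<subseteq> ball (coord c x) R"
      using that by (intro closed_segment_subset) auto
    then show ?thesis
      using R chart_at(1) by (intro dist_segment) (auto simp: c_def)
  qed
  then show ?thesis using that R by blast
qed

text \<open>A curve that starts near \<open>x\<close> either stays in a small chart ball, where the metric is comparable
  to its value at \<open>x\<close>, or it is long already when it leaves that ball.\<close>

lemma length_lower:
  fixes x
  defines "c \<equiv> chart_at \<A> x"
  obtains r e where "0 < r" "0 < e"
    "\<forall>\<gamma>. pw_C1 \<gamma> \<longrightarrow> \<gamma> 0 \<in> dom_chart c \<longrightarrow> dist (coord c x) (coord c (\<gamma> 0)) < r \<longrightarrow>
       len \<gamma> < e \<longrightarrow>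
       \<gamma> 1 \<in> dom_chart c \<and> rnorm g x (coord c (\<gamma> 1) - coord c (\<gamma> 0)) \<le> 2 * len \<gamma>"
proof -
  have c: "c \<in> \<A>" by (simp add: c_def chart_at)
  let ?p = "coord c x"
  obtain R where R: "0 < R" "ball ?p R \<subseteq> img c"
    "\<And>q w. q \<in> ball ?p R \<Longrightarrow> rnorm g x w \<le> 2 * sqrt (metric_in c q w w)"
    using metric_in_compare[of x] unfolding c_def by metis
  obtain m where m: "0 < m" "\<And>v. m * norm v \<le> rnorm g x v"
    using inner_form_equiv_norm[OF inner_form_metric] unfolding rnorm_def by metis
  note bl = inner_form_bilinear[OF inner_form_metric, of x]
  have initial: "rnorm g x (coord c (\<gamma> \<tau>) - coord c (\<gamma> 0)) \<le> 2 * len \<gamma>"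
    if \<gamma>: "pw_C1 \<gamma>" and \<tau>: "0 \<le> \<tau>" "\<tau> \<le> 1"
      and inb: "\<And>t. t \<in> {0..\<tau>} \<Longrightarrow> \<gamma> t \<in> dom_chart c \<and> coord c (\<gamma> t) \<in> ball ?p R" for \<gamma> \<tau>
  proof -
    obtain S where S: "finite S" "0 \<in> S" "1 \<in> S" "\<And>t. t \<in> {0..1} - S \<Longrightarrow> isCont \<gamma> t"
      "\<And>t c. t \<in> {0..1} - S \<Longrightarrow> c \<in> \<A> \<Longrightarrow> \<gamma> t \<in> dom_chart c \<Longrightarrow>
         ((coord c \<circ> \<gamma>) has_vector_derivative vector_derivative (coord c \<circ> \<gamma>) (at t)) (at t)"
      using piecewise_C1_derivative[OF \<gamma>] by metis
    define \<Delta> where "\<Delta> = coord c (\<gamma> \<tau>) - coord c (\<gamma> 0)"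
    define D where "D t = vector_derivative (coord c \<circ> \<gamma>) (at t)" for t
    \<comment> \<open>The displacement \<open>\<Delta>\<close> is tested against itself: this
      functional increases by the square of \<open>rnorm g x \<Delta>\<close>, while Cauchy-Schwarz
      bounds its derivative by \<open>rnorm g x \<Delta>\<close> times twice the speed. One factor
      is then cancelled.\<close>
    define f where "f t = g x \<Delta> (coord c (\<gamma> t))" for t
    define f' where "f' t = (if t \<in> S then 0 else g x \<Delta> (D t))" for t
    interpret b: bounded_bilinear "g x"
      using bl by (simp add: bilinear_conv_bounded_bilinear)
    have blin: "bounded_linear (g x \<Delta>)"
      by (rule b.bounded_linear_right)
    have "continuous_on {0..\<tau>} \<gamma>"
      using \<gamma> \<tau> unfolding piecewise_C1_curve_def by (auto elim: continuous_on_subset)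
    then have cont: "continuous_on {0..\<tau>} (\<lambda>t. coord c (\<gamma> t))"
      by (rule continuous_on_compose2[OF continuous_coord[OF c]]) (use inb in auto)
    have "(f' has_integral (f \<tau> - f 0)) {0..\<tau>}"
    proof (rule fundamental_theorem_of_calculus_interior_strong[OF S(1) \<tau>(1)])
      show "continuous_on {0..\<tau>} f"
        unfolding f_def by (rule bounded_linear.continuous_on[OF blin cont])
      fix t assume t: "t \<in> {0<..<\<tau>} - S"
      then have "((coord c \<circ> \<gamma>) has_vector_derivative D t) (at t)"
        unfolding D_def using \<tau> inb[of t] by (intro S(5) c) auto
      from bounded_linear.has_vector_derivative[OF blin this] show "(f has_vector_derivative f' t) (at t)"
        using t by (simp add: f_def[abs_def] f'_def)
    qed
    moreover have "speed \<gamma> integrable_on {0..\<tau>}"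
      using speed_integrable[OF \<gamma>] \<tau> by (auto intro: integrable_on_subinterval)
    then have "((\<lambda>t. (2 * rnorm g x \<Delta>) * speed \<gamma> t) has_integral (2 * rnorm g x \<Delta>) * integral {0..\<tau>} (speed \<gamma>)) {0..\<tau>}"
      by (intro has_integral_mult_right integrable_integral)
    moreover have "f' t \<le> (2 * rnorm g x \<Delta>) * speed \<gamma> t" if t: "t \<in> {0..\<tau>}" for t
    proof (cases "t \<in> S")
      case True
      then show ?thesis
        by (simp add: f'_def speed_nonneg rnorm_def inner_form_nonneg[OF inner_form_metric])
    next
      case False
      then have tS: "t \<in> {0..1} - S" using t \<tau> by auto
      have "f' t \<le> rnorm g x \<Delta> * rnorm g x (D t)"
        using False inner_form_Cauchy_Schwarz[OF inner_form_metric] by (simp add: f'_def rnorm_def)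
      also have "\<dots> \<le> rnorm g x \<Delta> * (2 * sqrt (metric_in c (coord c (\<gamma> t)) (D t) (D t)))"
        using inb[OF t] R(3)
        by (intro mult_left_mono) (auto simp: rnorm_def inner_form_nonneg[OF inner_form_metric])
      also have "sqrt (metric_in c (coord c (\<gamma> t)) (D t) (D t)) = speed \<gamma> t"
        unfolding D_def using inb[OF t] speed_eq(2)[OF c _ S(4)[OF tS] S(5)[OF tS c]] by simp
      finally show ?thesis by simp
    qed
    ultimately have "f \<tau> - f 0 \<le> (2 * rnorm g x \<Delta>) * integral {0..\<tau>} (speed \<gamma>)"
      by (rule has_integral_le)
    moreover have "f \<tau> - f 0 = (rnorm g x \<Delta>)\<^sup>2"
      by (simp add: f_def \<Delta>_def rnorm_def inner_form_nonneg[OF inner_form_metric] flip: b.diff_right)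
    ultimately have "rnorm g x \<Delta> * rnorm g x \<Delta> \<le> rnorm g x \<Delta> * (2 * integral {0..\<tau>} (speed \<gamma>))"
      by (simp add: power2_eq_square algebra_simps)
    moreover have "0 \<le> integral {0..\<tau>} (speed \<gamma>)"
      using \<open>speed \<gamma> integrable_on {0..\<tau>}\<close> by (intro integral_nonneg speed_nonneg)
    moreover have "0 \<le> rnorm g x \<Delta>"
      by (simp add: rnorm_def inner_form_nonneg[OF inner_form_metric])
    ultimately have "rnorm g x \<Delta> \<le> 2 * integral {0..\<tau>} (speed \<gamma>)"
      by (cases "rnorm g x \<Delta> = 0") (auto simp: mult_le_cancel_left)
    moreover have "integral {0..\<tau>} (speed \<gamma>) \<le> len \<gamma>"
      unfolding curve_length_speed using \<tau> speed_integrable[OF \<gamma>] \<open>speed \<gamma> integrable_on {0..\<tau>}\<close>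
      by (intro integral_subset_le) (auto simp: speed_nonneg)
    ultimately show ?thesis by (simp add: \<Delta>_def)
  qed
  define W where "W = coord_inv c ` ball ?p (R/2)"
  \<comment> \<open>\<open>K\<close> is compact and hence closed in the Hausdorff space
    \<open>M\<close>. A curve that is about to leave \<open>W\<close> thus cannot leave the chart
    domain at that very moment.\<close>
  define K where "K = coord_inv c ` cball ?p (R/2)"
  have bR: "ball ?p (R/2) \<subseteq> img c" "cball ?p (R/2) \<subseteq> ball ?p R"
    using R by auto
  have W: "open W"
    unfolding W_def by (rule open_coord_inv_image[OF c]) (use bR in auto)
  have K: "closed K"
    unfolding K_def
    by (intro compact_imp_closed compact_continuous_image continuous_on_subset[OF continuous_coord_inv[OF c]])
      (use bR R in auto)
  have K': "y \<in> dom_chart c \<and> dist ?p (coord c y) \<le> R/2" if y: "y \<in> K" for y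
  proof -
    obtain q where q: "q \<in> cball ?p (R/2)" "y = coord_inv c q" using y unfolding K_def by blast
    then have "q \<in> img c" using bR R(2) by blast
    then show ?thesis
      using q coord_coord_inv[OF c] coord_inv_in[OF c] by auto
  qed
  have WK: "W \<subseteq> K" by (auto simp: W_def K_def)
  have inW: "y \<in> W" if "y \<in> dom_chart c" "dist ?p (coord c y) < R/2" for y
    unfolding W_def using that coord_inv_coord[OF c that(1)] by (intro rev_image_eqI[of "coord c y"]) auto
  \<comment> \<open>A curve that starts within \<open>R / 4\<close> of the centre and leaves the
    ball of radius \<open>R / 2\<close> moves its coordinates by at least \<open>R / 4\<close>. By
    \<open>initial\<close> this forces \<open>m * R / 4 \<le> 2 * len \<gamma>\<close>, whence the
    threshold \<open>m * R / 8\<close>.\<close>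
  have main: "\<gamma> 1 \<in> dom_chart c \<and> rnorm g x (coord c (\<gamma> 1) - coord c (\<gamma> 0)) \<le> 2 * len \<gamma>"
    if \<gamma>: "pw_C1 \<gamma>" and 0: "\<gamma> 0 \<in> dom_chart c" "dist ?p (coord c (\<gamma> 0)) < R / 4"
      and len: "len \<gamma> < m * R / 8" for \<gamma>
  proof -
    have cont: "continuous_on {0..1} \<gamma>"
      using \<gamma> unfolding piecewise_C1_curve_def by blast
    have 0: "\<gamma> 0 \<in> W" "\<gamma> 0 \<in> dom_chart c" "dist ?p (coord c (\<gamma> 0)) < R / 4"
      using 0 R(1) by (auto intro!: inW)
    have "\<gamma> t \<in> W" if "t \<in> {0..1}" for t
    proof (rule ccontr)
      assume "\<gamma> t \<notin> W"
      define T where "T = {t \<in> {0..1}. \<gamma> t \<in> - W}"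
      have "closed T"
        unfolding T_def using continuous_closed_preimage[OF cont _ closed_Compl[OF W]]
        by (simp add: vimage_def Int_def conj_commute)
      moreover have "T \<noteq> {}" "bdd_below T"
        using \<open>\<gamma> t \<notin> W\<close> \<open>t \<in> {0..1}\<close> by (auto simp: T_def)
      ultimately have \<tau>T: "Inf T \<in> T"
        by (intro closed_contains_Inf)
      define \<tau> where "\<tau> = Inf T"
      have \<tau>: "0 \<le> \<tau>" "\<tau> \<le> 1" "\<gamma> \<tau> \<notin> W"
        using \<tau>T by (auto simp: T_def \<tau>_def)
      have before: "\<gamma> s \<in> W" if "s \<in> {0..<\<tau>}" for s
      proof (rule ccontr)
        assume "\<gamma> s \<notin> W"
        then have "s \<in> T" using that \<tau> by (auto simp: T_def)
        then have "\<tau> \<le> s"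
          unfolding \<tau>_def using \<open>bdd_below T\<close> by (rule cInf_lower)
        then show False using that by simp
      qed
      have "\<tau> \<noteq> 0" using 0 \<tau> by auto
      then have cl: "closure {0..<\<tau>} = {0..\<tau>}"
        using \<tau> by (simp add: closure_atLeastLessThan)
      \<comment> \<open>The first exit time \<open>\<tau>\<close> is included, so the coordinates of
        the exit point make sense.\<close>
      have inK: "\<gamma> s \<in> K" if "s \<in> {0..\<tau>}" for s
      proof -
        have "\<gamma> ` closure {0..<\<tau>} \<subseteq> K"
          using before WK
          by (intro image_closure_subset continuous_on_subset[OF cont] K) (use cl \<tau> in auto)
        then show ?thesis using that cl by auto
      qed
      have "rnorm g x (coord c (\<gamma> \<tau>) - coord c (\<gamma> 0)) \<le> 2 * len \<gamma>"
      proof (rule initial[OF \<gamma> \<tau>(1,2)])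
        fix s assume "s \<in> {0..\<tau>}"
        from K'[OF inK[OF this]] show "\<gamma> s \<in> dom_chart c \<and> coord c (\<gamma> s) \<in> ball ?p R"
          using R(1) by auto
      qed
      also have "\<dots> < m * R / 4" using len by simp
      finally have "m * norm (coord c (\<gamma> \<tau>) - coord c (\<gamma> 0)) < m * (R / 4)"
        using m(2)[of "coord c (\<gamma> \<tau>) - coord c (\<gamma> 0)"] by simp
      then have "dist (coord c (\<gamma> \<tau>)) (coord c (\<gamma> 0)) < R / 4"
        using m(1) by (simp add: dist_norm)
      moreover have "\<not> dist ?p (coord c (\<gamma> \<tau>)) < R / 2"
        using inW[of "\<gamma> \<tau>"] K'[OF inK, of \<tau>] \<tau> by auto
      ultimately show False
        using 0(3) dist_triangle[of ?p "coord c (\<gamma> \<tau>)" "coord c (\<gamma> 0)"] by (simp add: dist_commute)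
    qed
    then have inb: "\<gamma> t \<in> dom_chart c \<and> coord c (\<gamma> t) \<in> ball ?p R" if "t \<in> {0..1}" for t
      using K'[of "\<gamma> t"] WK R(1) that by fastforce
    then show ?thesis
      using initial[OF \<gamma> _ _ inb, of 1] by auto
  qed
  show ?thesis
    by (rule that[of "R/4" "m * R / 8"]) (use R(1) m(1) main in auto)
qed

end

section \<open>The Riemannian distance on a connected manifold\<close>

text \<open>The property and its negation both have to hold on open sets; therefore the local
  hypothesis is an equivalence.\<close>

lemma connected_UNIV_induct:
  fixes P :: "'a::topological_space \<Rightarrow> bool"
  assumes conn: "connected (UNIV :: 'a set)" and "P x"
    and loc: "\<And>x. \<exists>U. open U \<and> x \<in> U \<and> (\<forall>y\<in>U. P x \<longleftrightarrow> P y)"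
  shows "P y"
proof -
  have loc': "\<exists>T. open T \<and> z \<in> T \<and> T \<subseteq> {y. P y \<longleftrightarrow> P z}" for z
    using loc[of z] by auto
  have 1: "open {y. P y}"
  proof (rule iffD2[OF open_subopen], rule ballI)
    fix z assume "z \<in> {y. P y}"
    then show "\<exists>T. open T \<and> z \<in> T \<and> T \<subseteq> {y. P y}"
      using loc'[of z] by simp
  qed
  have 2: "open {y. \<not> P y}"
  proof (rule iffD2[OF open_subopen], rule ballI)
    fix z assume "z \<in> {y. \<not> P y}"
    then show "\<exists>T. open T \<and> z \<in> T \<and> T \<subseteq> {y. \<not> P y}"
      using loc'[of z] by simp
  qed
  have "{y. P y} \<inter> UNIV = {} \<or> {y. \<not> P y} \<inter> UNIV = {}"
    by (rule connectedD[OF conn 1 2]) auto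
  moreover have "x \<in> {y. P y}" using \<open>P x\<close> by simp
  ultimately have "{y. \<not> P y} = {}" by (metis Int_UNIV_right empty_iff)
  then show ?thesis by simp
qed

text \<open>Connectedness ensures that the infimum in \<open>riemannian_dist\<close> is taken over a
  nonempty set, so that near-minimal curves exist.\<close>

locale riemannian_manifold = riemannian_atlas \<A> g
  for \<A> :: "('a::{t2_space, second_countable_topology}, 'e::euclidean_space) chart set" and g +
  assumes conn: "connected (UNIV :: 'a set)"
begin

text \<open>Near each point segments are available in both directions. This yields the equivalence
  required by \<open>connected_UNIV_induct\<close> without reversing a curve.\<close>

lemma curve_exists: "\<exists>\<gamma>. pw_C1 \<gamma> \<and> \<gamma> 0 = x \<and> \<gamma> 1 = y"
proof -
  define P where "P y \<longleftrightarrow> (\<exists>\<gamma>. pw_C1 \<gamma> \<and> \<gamma> 0 = x \<and> \<gamma> 1 = y)" for y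
  have seg: "\<exists>\<gamma>. pw_C1 \<gamma> \<and> \<gamma> 0 = coord_inv c p \<and> \<gamma> 1 = coord_inv c q"
    if "c \<in> \<A>" "ball z R \<subseteq> img c" "p \<in> ball z R" "q \<in> ball z R" for c p q z R
  proof -
    have "closed_segment p q \<subseteq> img c"
      using that(2) closed_segment_subset[OF that(3,4)] by auto
    from segment_curve(1)[OF that(1) this] show ?thesis
      by (intro exI[of _ "coord_inv c \<circ> linepath p q"]) (auto simp: linepath_def)
  qed
  have join: "P z" if y: "P y" and z: "\<exists>\<gamma>. pw_C1 \<gamma> \<and> \<gamma> 0 = y \<and> \<gamma> 1 = z" for y z
  proof -
    from y[unfolded P_def] obtain \<gamma>1 where 1: "pw_C1 \<gamma>1 \<and> \<gamma>1 0 = x \<and> \<gamma>1 1 = y"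
      by (rule exE)
    from z obtain \<gamma>2 where 2: "pw_C1 \<gamma>2 \<and> \<gamma>2 0 = y \<and> \<gamma>2 1 = z"
      by (rule exE)
    note \<gamma> = 1 2
    then have "pw_C1 (\<gamma>1 +++ \<gamma>2)"
      by (intro piecewise_C1_join) auto
    then show ?thesis
      unfolding P_def using \<gamma> by (intro exI[of _ "\<gamma>1 +++ \<gamma>2"]) (auto simp: joinpaths_def)
  qed
  have loc: "\<exists>U. open U \<and> y \<in> U \<and> (\<forall>z\<in>U. \<exists>\<gamma>. pw_C1 \<gamma> \<and> \<gamma> 0 = y \<and> \<gamma> 1 = z)
     \<and> (\<forall>z\<in>U. \<exists>\<gamma>. pw_C1 \<gamma> \<and> \<gamma> 0 = z \<and> \<gamma> 1 = y)" for y
  proof -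
    let ?c = "chart_at \<A> y"
    obtain R where R: "0 < R" "ball (coord ?c y) R \<subseteq> img ?c"
      using open_img[OF chart_at(1)] chart_at(2) by (metis imageI openE)
    have y: "coord ?c y \<in> ball (coord ?c y) R" "coord_inv ?c (coord ?c y) = y"
      using R by (auto simp: chart_at coord_inv_coord)
    show ?thesis
    proof (intro exI[of _ "coord_inv ?c ` ball (coord ?c y) R"] conjI ballI)
      show "open (coord_inv ?c ` ball (coord ?c y) R)"
        by (rule open_coord_inv_image[OF chart_at(1)]) (use R in auto)
      show "y \<in> coord_inv ?c ` ball (coord ?c y) R"
        using y by (metis imageI)
      fix z assume "z \<in> coord_inv ?c ` ball (coord ?c y) R"
      then obtain q where q: "q \<in> ball (coord ?c y) R" "z = coord_inv ?c q" by blast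
      show "\<exists>\<gamma>. pw_C1 \<gamma> \<and> \<gamma> 0 = y \<and> \<gamma> 1 = z"
        using seg[OF chart_at(1) R(2) y(1) q(1)] y(2) q(2) by simp
      show "\<exists>\<gamma>. pw_C1 \<gamma> \<and> \<gamma> 0 = z \<and> \<gamma> 1 = y"
        using seg[OF chart_at(1) R(2) q(1) y(1)] y(2) q(2) by simp
    qed
  qed
  have "P x"
  proof -
    obtain U where "x \<in> U" "\<forall>z\<in>U. \<exists>\<gamma>. pw_C1 \<gamma> \<and> \<gamma> 0 = x \<and> \<gamma> 1 = z"
      using loc[of x] by blast
    then show ?thesis by (auto simp: P_def)
  qed
  then have "P y"
  proof (rule connected_UNIV_induct[OF conn])
    fix y
    obtain U where U: "open U" "y \<in> U"
      "\<And>z. z \<in> U \<Longrightarrow> \<exists>\<gamma>. pw_C1 \<gamma> \<and> \<gamma> 0 = y \<and> \<gamma> 1 = z"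
      "\<And>z. z \<in> U \<Longrightarrow> \<exists>\<gamma>. pw_C1 \<gamma> \<and> \<gamma> 0 = z \<and> \<gamma> 1 = y"
      using loc[of y] by blast
    have "P y \<longleftrightarrow> P z" if "z \<in> U" for z
      using join[OF _ U(3)[OF that]] join[OF _ U(4)[OF that]] by blast
    then show "\<exists>U. open U \<and> y \<in> U \<and> (\<forall>z\<in>U. P y \<longleftrightarrow> P z)"
      using U(1,2) by blast
  qed
  then show ?thesis
    unfolding P_def .
qed

lemma dist_less_curve:
  assumes "d x y < r"
  shows "\<exists>\<gamma>. pw_C1 \<gamma> \<and> \<gamma> 0 = x \<and> \<gamma> 1 = y \<and> len \<gamma> < r"
proof -
  have "{len \<gamma> | \<gamma>. pw_C1 \<gamma> \<and> \<gamma> 0 = x \<and> \<gamma> 1 = y} \<noteq> {}"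
    using curve_exists[of x y] by blast
  from cInf_lessD[OF this assms[unfolded riemannian_dist_def]] show ?thesis
    by blast
qed

lemma dist_nonneg: "0 \<le> d x y"
proof (rule ccontr)
  assume "\<not> 0 \<le> d x y"
  then have "d x y < 0" by simp
  from dist_less_curve[OF this] obtain \<gamma>
    where "pw_C1 \<gamma> \<and> \<gamma> 0 = x \<and> \<gamma> 1 = y \<and> len \<gamma> < 0"
    by (rule exE)
  then show False using curve_length_nonneg[of \<gamma>] by simp
qed

lemma dist_triangle_inequality: "d x z \<le> d x y + d y z"
proof (rule field_le_epsilon)
  fix e :: real assume e: "0 < e"
  have "d x y < d x y + e / 2" "d y z < d y z + e / 2" using e by auto
  note near = this[THEN dist_less_curve]
  from near(1) obtain \<gamma>1 where "pw_C1 \<gamma>1 \<and> \<gamma>1 0 = x \<and> \<gamma>1 1 = y \<and> len \<gamma>1 < d x y + e / 2"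
    by (rule exE)
  then have 1: "pw_C1 \<gamma>1" "\<gamma>1 0 = x" "\<gamma>1 1 = y" "len \<gamma>1 < d x y + e / 2"
    by simp_all
  from near(2) obtain \<gamma>2 where "pw_C1 \<gamma>2 \<and> \<gamma>2 0 = y \<and> \<gamma>2 1 = z \<and> len \<gamma>2 < d y z + e / 2"
    by (rule exE)
  then have 2: "pw_C1 \<gamma>2" "\<gamma>2 0 = y" "\<gamma>2 1 = z" "len \<gamma>2 < d y z + e / 2"
    by simp_all
  have "d ((\<gamma>1 +++ \<gamma>2) 0) ((\<gamma>1 +++ \<gamma>2) 1) \<le> len (\<gamma>1 +++ \<gamma>2)"
    using 1 2 by (intro dist_le_length piecewise_C1_join) auto
  moreover have "(\<gamma>1 +++ \<gamma>2) 0 = x" "(\<gamma>1 +++ \<gamma>2) 1 = z"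
    using 1 2 by (auto simp: joinpaths_def)
  ultimately show "d x z \<le> d x y + d y z + e"
    using 1(4) 2(4) curve_length_join[OF 1(1) 2(1)] by simp
qed

text \<open>Near-minimal curves from \<open>y\<close> to \<open>z\<close> obey
  \<open>length_lower\<close>, and their lengths may be taken down to \<open>d y z\<close>. That
  \<open>z\<close> lies in the chart domain belongs to the conclusion, which makes
  \<open>dist_nhds\<close> possible.\<close>

lemma dist_lower:
  fixes x
  defines "c \<equiv> chart_at \<A> x"
  obtains r e where "0 < r" "0 < e"
    "\<And>y z. y \<in> dom_chart c \<Longrightarrow> dist (coord c x) (coord c y) < r \<Longrightarrow> d y z < e \<Longrightarrow>
       z \<in> dom_chart c \<and> rnorm g x (coord c z - coord c y) \<le> 2 * d y z"
proof -
  obtain r e where re: "0 < r" "0 < e"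
    "\<forall>\<gamma>. pw_C1 \<gamma> \<longrightarrow> \<gamma> 0 \<in> dom_chart c \<longrightarrow> dist (coord c x) (coord c (\<gamma> 0)) < r \<longrightarrow>
       len \<gamma> < e \<longrightarrow>
       \<gamma> 1 \<in> dom_chart c \<and> rnorm g x (coord c (\<gamma> 1) - coord c (\<gamma> 0)) \<le> 2 * len \<gamma>"
    by (rule length_lower[of x, folded c_def])
  have "z \<in> dom_chart c \<and> rnorm g x (coord c z - coord c y) \<le> 2 * d y z"
    if y: "y \<in> dom_chart c" "dist (coord c x) (coord c y) < r" and z: "d y z < e" for y z
  proof -
    have curve: "z \<in> dom_chart c \<and> rnorm g x (coord c z - coord c y) \<le> 2 * L" if L: "d y z < L" "L \<le> e" for L
    proof -
      from dist_less_curve[OF L(1)] obtain \<gamma>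
        where "pw_C1 \<gamma> \<and> \<gamma> 0 = y \<and> \<gamma> 1 = z \<and> len \<gamma> < L"
        by (rule exE)
      then show ?thesis
        using spec[OF re(3), of \<gamma>] y L(2) by auto
    qed
    have "rnorm g x (coord c z - coord c y) / 2 \<le> d y z"
    proof (rule dense_ge_bounded[OF z])
      fix L assume "d y z < L" "L < e"
      then show "rnorm g x (coord c z - coord c y) / 2 \<le> L"
        using curve[of L] by simp
    qed
    then show ?thesis
      using curve[of e] z by simp
  qed
  then show ?thesis using that re by blast
qed

text \<open>One half of the agreement between \<open>d\<close> and the topology of \<open>M\<close>;
  it turns Lipschitz maps into continuous ones. The other half is
  \<open>dist_continuous\<close>.\<close>

lemma dist_nhds:
  assumes W: "open W" "x \<in> W"
  obtains \<epsilon> where "0 < \<epsilon>" "\<And>z. d x z < \<epsilon> \<Longrightarrow> z \<in> W"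
proof -
  define c where "c = chart_at \<A> x"
  have c: "c \<in> \<A>" "x \<in> dom_chart c" by (simp_all add: c_def chart_at)
  obtain r e where re: "0 < r" "0 < e"
    "\<And>y z. y \<in> dom_chart c \<Longrightarrow> dist (coord c x) (coord c y) < r \<Longrightarrow> d y z < e \<Longrightarrow>
       z \<in> dom_chart c \<and> rnorm g x (coord c z - coord c y) \<le> 2 * d y z"
    using dist_lower[of x] unfolding c_def by blast
  obtain m where m: "0 < m" "\<And>v. m * norm v \<le> rnorm g x v"
    using inner_form_equiv_norm[OF inner_form_metric] unfolding rnorm_def by metis
  have "open (coord c ` (W \<inter> dom_chart c))"
    using open_coord_image[OF c(1)] W open_dom[OF c(1)] by auto
  then obtain \<rho> where \<rho>: "0 < \<rho>" "ball (coord c x) \<rho> \<subseteq> coord c ` (W \<inter> dom_chart c)"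
    using W c by (metis IntI imageI openE)
  show ?thesis
  proof
    show "0 < min e (m * \<rho> / 2)" using re m \<rho> by simp
    fix z assume z: "d x z < min e (m * \<rho> / 2)"
    then have zd: "z \<in> dom_chart c" "rnorm g x (coord c z - coord c x) \<le> 2 * d x z"
      using re(3)[of x z] c re by auto
    have "m * norm (coord c z - coord c x) < m * \<rho>"
      using m(2)[of "coord c z - coord c x"] zd z by auto
    then have "coord c z \<in> ball (coord c x) \<rho>"
      using m by (simp add: dist_norm norm_minus_commute)
    then obtain w where "w \<in> W" "w \<in> dom_chart c" "coord c z = coord c w"
      using \<rho> by blast
    then show "z \<in> W"
      using zd coord_inv_coord[OF c(1)] by metis
  qed
qed

text \<open>Both orders of the arguments are assumed, so that symmetry of \<open>d\<close> never has
  to be established.\<close>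

lemma dist_diff_le:
  assumes "d y z \<le> b" "d z y \<le> b"
  shows "\<bar>d x y - d x z\<bar> \<le> b"
  using dist_triangle_inequality[of x y z] dist_triangle_inequality[of x z y] assms by linarith

lemma dist_continuous: "continuous_on UNIV (d w)"
proof -
  have "isCont (d w) x" for x
    unfolding continuous_at
  proof (rule tendstoI)
    fix e :: real assume e: "0 < e"
    define c where "c = chart_at \<A> x"
    have c: "c \<in> \<A>" "x \<in> dom_chart c" by (simp_all add: c_def chart_at)
    obtain R where R: "0 < R" "ball (coord c x) R \<subseteq> img c"
      "\<And>p q. p \<in> ball (coord c x) R \<Longrightarrow> q \<in> ball (coord c x) R \<Longrightarrow>
         d (coord_inv c p) (coord_inv c q) \<le> 2 * rnorm g x (q - p)"
      using dist_upper[of x] unfolding c_def by blast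
    obtain M where M: "0 < M" "\<And>v. rnorm g x v \<le> M * norm v"
      using inner_form_equiv_norm[OF inner_form_metric] unfolding rnorm_def by metis
    define \<rho> where "\<rho> = min R (e / (2 * M))"
    have \<rho>: "0 < \<rho>" "\<rho> \<le> R" "2 * M * \<rho> \<le> e"
      using R M e by (auto simp: \<rho>_def field_simps min_def)
    define U where "U = coord_inv c ` ball (coord c x) \<rho>"
    have sub: "ball (coord c x) \<rho> \<subseteq> img c" using R(2) \<rho>(2) by auto
    have "open U"
      unfolding U_def by (rule open_coord_inv_image[OF c(1) _ sub]) auto
    moreover have "x \<in> U"
      unfolding U_def using \<rho> coord_inv_coord[OF c] by (intro rev_image_eqI[of "coord c x"]) auto
    moreover have "dist (d w y) (d w x) < e" if y: "y \<in> U" for y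
    proof -
      obtain q where q: "q \<in> ball (coord c x) \<rho>" "y = coord_inv c q"
        using y unfolding U_def by blast
      have near: "norm (q - coord c x) < \<rho>" "norm (coord c x - q) < \<rho>"
        using q by (auto simp: dist_norm norm_minus_commute)
      have le: "2 * rnorm g x v \<le> 2 * M * norm v" for v
        using M(2)[of v] by simp
      have "d x y \<le> 2 * M * norm (q - coord c x)" "d y x \<le> 2 * M * norm (coord c x - q)"
        using R(3)[of "coord c x" q] R(3)[of q "coord c x"] q \<rho> coord_inv_coord[OF c] R(1)
        by (auto intro: order_trans[OF _ le])
      then have "\<bar>d w y - d w x\<bar> \<le> 2 * M * norm (q - coord c x)"
        by (intro dist_diff_le) (auto simp: norm_minus_commute)
      also have "\<dots> < 2 * M * \<rho>"
        using near M by (intro mult_strict_left_mono) auto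
      finally show ?thesis using \<rho> by (simp add: dist_real_def)
    qed
    ultimately show "eventually (\<lambda>y. dist (d w y) (d w x) < e) (at x)"
      unfolding eventually_at_topological by blast
  qed
  then show ?thesis by (simp add: continuous_on_eq_continuous_at)
qed

lemma lipschitz_imp_continuous:
  fixes \<sigma> :: "'x::metric_space \<Rightarrow> 'a"
  assumes "\<And>u v. u \<in> Q \<Longrightarrow> v \<in> Q \<Longrightarrow> d (\<sigma> u) (\<sigma> v) \<le> C * dist u v"
  shows "continuous_on Q \<sigma>"
  unfolding continuous_on_def
proof (intro ballI topological_tendstoI)
  fix u W assume u: "u \<in> Q" and W: "open W" "\<sigma> u \<in> W"
  obtain \<epsilon> where \<epsilon>: "0 < \<epsilon>" "\<And>z. d (\<sigma> u) z < \<epsilon> \<Longrightarrow> z \<in> W"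
    using dist_nhds[OF W] by blast
  have "eventually (\<lambda>v. \<bar>C\<bar> * dist u v < \<epsilon>) (at u within Q)"
    by (rule order_tendstoD(2)[of _ 0]) (auto intro!: tendsto_eq_intros simp: \<epsilon>)
  moreover have "eventually (\<lambda>v. v \<in> Q) (at u within Q)"
    by (simp add: eventually_at_filter)
  ultimately show "eventually (\<lambda>v. \<sigma> v \<in> W) (at u within Q)"
  proof eventually_elim
    case (elim v)
    have "d (\<sigma> u) (\<sigma> v) \<le> \<bar>C\<bar> * dist u v"
      using assms[OF u elim(2)] by (rule order_trans) (auto intro!: mult_right_mono)
    then show ?case using elim \<epsilon> by auto
  qed
qed

section \<open>The norm of the derivative as a local Lipschitz constant\<close>

lemma op_norm_bound:
  assumes L: "linear L"
  shows "rnorm g y (L v) \<le> op_norm g x y L * rnorm g x v" "0 \<le> op_norm g x y L"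
proof -
  obtain m where m: "0 < m" "\<And>v. m * norm v \<le> rnorm g x v"
    using inner_form_equiv_norm[OF inner_form_metric] unfolding rnorm_def by metis
  obtain M where M: "0 < M" "\<And>v. rnorm g y v \<le> M * norm v"
    using inner_form_equiv_norm[OF inner_form_metric] unfolding rnorm_def by metis
  obtain B where B: "0 < B" "\<And>v. norm (L v) \<le> B * norm v"
    using linear_bounded_pos[OF L] by blast
  let ?S = "{rnorm g y (L v) | v. rnorm g x v \<le> 1}"
  \<comment> \<open>A supremum of reals says something only about a bounded set; comparing both
    norms with the Euclidean one bounds it.\<close>
  have bdd: "bdd_above ?S"
  proof (rule bdd_aboveI)
    fix s assume "s \<in> ?S"
    then obtain v where v: "s = rnorm g y (L v)" "rnorm g x v \<le> 1" by blast
    have "norm v \<le> 1 / m"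
      using m(1) m(2)[of v] v(2) by (simp add: field_simps)
    have "s \<le> M * (B * norm v)"
      unfolding v(1) using M B by (intro order_trans[OF M(2)] mult_left_mono) auto
    also have "\<dots> \<le> M * (B * (1 / m))"
      using \<open>norm v \<le> 1 / m\<close> M B by (intro mult_left_mono) auto
    finally show "s \<le> M * (B * (1 / m))" .
  qed
  have le: "rnorm g y (L v) \<le> op_norm g x y L" if "rnorm g x v \<le> 1" for v
    unfolding op_norm_def by (rule cSup_upper[OF _ bdd]) (use that in blast)
  have zero: "rnorm g z 0 = 0" for z
    using bilinear_lzero[OF inner_form_bilinear[OF inner_form_metric]] by (simp add: rnorm_def)
  show "0 \<le> op_norm g x y L"
    using le[of 0] zero[of x] zero[of y] linear_0[OF L] by simp
  show "rnorm g y (L v) \<le> op_norm g x y L * rnorm g x v"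
  proof (cases "v = 0")
    case False
    then have pos: "0 < rnorm g x v"
      by (simp add: rnorm_def inner_form_pos[OF inner_form_metric])
    let ?t = "1 / rnorm g x v"
    have "rnorm g x (?t *\<^sub>R v) = 1"
      using pos by (simp add: rnorm_def inner_form_scale[OF inner_form_metric])
    then have "rnorm g y (L (?t *\<^sub>R v)) \<le> op_norm g x y L"
      by (intro le) simp
    then have "?t * rnorm g y (L v) \<le> op_norm g x y L"
      using pos by (simp add: linear_scale[OF L] rnorm_def inner_form_scale[OF inner_form_metric])
    then show ?thesis using pos by (simp add: field_simps)
  qed (simp add: zero linear_0[OF L])
qed

text \<open>The factor 4 is a product of two factors 2, one from \<open>dist_upper\<close> at the
  image point and one from \<open>dist_lower\<close> at \<open>x\<close>. In between stands the
  linear approximation of \<open>f\<close> in coordinates.\<close>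

lemma C1_map_locally_lipschitz:
  assumes W: "open W" "x \<in> W" and f: "Ck_map_on 1 \<A> W f" and \<epsilon>: "0 < \<epsilon>"
  obtains U where "open U" "x \<in> U" "U \<subseteq> W"
    "\<And>y z. y \<in> U \<Longrightarrow> z \<in> U \<Longrightarrow> d (f y) (f z) \<le> (4 * tangent_norm \<A> g f x + \<epsilon>) * d y z"
proof -
  define c where "c = chart_at \<A> x"
  define c' where "c' = chart_at \<A> (f x)"
  have c: "c \<in> \<A>" "x \<in> dom_chart c" and c': "c' \<in> \<A>" "f x \<in> dom_chart c'"
    by (simp_all add: c_def c'_def chart_at)
  let ?p = "coord c x"
  obtain R where R: "0 < R" "ball ?p R \<subseteq> img c"
    "\<And>p q. p \<in> ball ?p R \<Longrightarrow> q \<in> ball ?p R \<Longrightarrow>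
       d (coord_inv c p) (coord_inv c q) \<le> 2 * rnorm g x (q - p)"
    using dist_upper[of x] unfolding c_def by blast
  obtain R' where R': "0 < R'" "ball (coord c' (f x)) R' \<subseteq> img c'"
    "\<And>p q. p \<in> ball (coord c' (f x)) R' \<Longrightarrow> q \<in> ball (coord c' (f x)) R' \<Longrightarrow>
       d (coord_inv c' p) (coord_inv c' q) \<le> 2 * rnorm g (f x) (q - p)"
    using dist_upper[of "f x"] unfolding c'_def by blast
  obtain r e where re: "0 < r" "0 < e"
    "\<And>y z. y \<in> dom_chart c \<Longrightarrow> dist (coord c x) (coord c y) < r \<Longrightarrow> d y z < e \<Longrightarrow>
       z \<in> dom_chart c \<and> rnorm g x (coord c z - coord c y) \<le> 2 * d y z"
    using dist_lower[of x] unfolding c_def by blast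
  obtain m M where mM: "0 < m" "0 < M" "\<And>v. m * norm v \<le> rnorm g x v" "\<And>v. rnorm g x v \<le> M * norm v"
    using inner_form_equiv_norm[OF inner_form_metric, of x] unfolding rnorm_def by blast
  obtain M' where M': "0 < M'" "\<And>v. rnorm g (f x) v \<le> M' * norm v"
    using inner_form_equiv_norm[OF inner_form_metric] unfolding rnorm_def by metis
  define \<phi> where "\<phi> = coord c' \<circ> f \<circ> coord_inv c"
  define \<phi>' where "\<phi>' q = frechet_derivative \<phi> (at q)" for q
  define tn where "tn = tangent_norm \<A> g f x"
  have tn: "tn = op_norm g x (f x) (\<phi>' ?p)"
    by (simp add: tn_def tangent_norm_def tangent_map_def \<phi>'_def \<phi>_def c_def c'_def)
  have f_cont: "continuous_on W f" and \<phi>_C1: "Ck_on 1 (coord c ` (W \<inter> dom_chart c \<inter> f -` dom_chart c')) \<phi>"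
    using f c c' unfolding Ck_map_on_def \<phi>_def by blast+
  define V' where "V' = coord_inv c' ` ball (coord c' (f x)) R'"
  have V': "open V'" "f x \<in> V'" "V' \<subseteq> dom_chart c'"
    unfolding V'_def using open_coord_inv_image[OF c'(1) _ R'(2)] R' c' coord_inv_coord[OF c'(1)]
      coord_inv_in[OF c'(1)] by (auto intro!: rev_image_eqI[of "coord c' (f x)"])
  \<comment> \<open>Preimages are taken of \<open>V'\<close> and not of the whole chart domain,
    since \<open>dist_upper\<close> holds only in the coordinate ball.\<close>
  define \<Omega> where "\<Omega> = coord c ` (W \<inter> dom_chart c \<inter> f -` V')"
  have "open (W \<inter> f -` V')"
    by (rule continuous_open_preimage[OF f_cont W(1) V'(1)])
  then have \<Omega>: "open \<Omega>"
    unfolding \<Omega>_def using open_dom[OF c(1)]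
    by (intro open_coord_image[OF c(1)]) (auto simp: Int_assoc Int_left_commute[of _ "dom_chart c"])
  have \<Omega>sub: "\<Omega> \<subseteq> coord c ` (W \<inter> dom_chart c \<inter> f -` dom_chart c')"
    unfolding \<Omega>_def using V' by auto
  have p: "?p \<in> \<Omega>"
    unfolding \<Omega>_def using W c V' by auto
  \<comment> \<open>The remainder passes through the constants \<open>M'\<close> and
    \<open>1 / m\<close> and two factors 2, so that it contributes exactly
    \<open>\<epsilon>\<close>.\<close>
  define \<eta> where "\<eta> = \<epsilon> * m / (4 * M')"
  have \<eta>: "0 < \<eta>" "M' * \<eta> / m = \<epsilon> / 4"
    using \<epsilon> mM M' by (auto simp: \<eta>_def)
  have \<phi>\<Omega>: "Ck_on 1 \<Omega> \<phi>"
    by (rule Ck_on_subset[OF \<phi>_C1 \<Omega>sub])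
  obtain \<delta> where \<delta>: "0 < \<delta>" "ball ?p \<delta> \<subseteq> \<Omega>"
    "\<And>y z. y \<in> ball ?p \<delta> \<Longrightarrow> z \<in> ball ?p \<delta> \<Longrightarrow> norm (\<phi> z - \<phi> y - \<phi>' ?p (z - y)) \<le> \<eta> * norm (z - y)"
    using C1_strictly_differentiable[OF \<phi>\<Omega> \<Omega> p \<eta>(1)] unfolding \<phi>'_def by blast
  have lin: "linear (\<phi>' ?p)"
    using \<phi>\<Omega> p unfolding \<phi>'_def by (auto intro!: linear_frechet_derivative)
  \<comment> \<open>Distances inside \<open>U\<close> stay below \<open>4 * M * \<rho>\<close>; the
    last entry brings this under the threshold \<open>e\<close> of
    \<open>dist_lower\<close>.\<close>
  define \<rho> where "\<rho> = Min {R, r, \<delta>, e / (4 * M)}"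
  have \<rho>: "0 < \<rho>" "\<rho> \<le> R" "\<rho> \<le> r" "\<rho> \<le> \<delta>" "\<rho> \<le> e / (4 * M)"
    using R re \<delta> mM by (auto simp: \<rho>_def)
  have \<rho>e: "4 * M * \<rho> \<le> e" using \<rho>(5) mM by (simp add: field_simps)
  define U where "U = coord_inv c ` ball ?p \<rho>"
  have sub: "ball ?p \<rho> \<subseteq> img c" using R(2) \<rho>(2) by auto
  have UW: "coord c y \<in> ball ?p \<rho>" "y \<in> dom_chart c" "y \<in> W" "f y \<in> V'" if y: "y \<in> U" for y
  proof -
    obtain q where q: "q \<in> ball ?p \<rho>" "y = coord_inv c q"
      using y unfolding U_def by blast
    have "q \<in> \<Omega>" using q(1) \<rho>(4) \<delta>(2) by auto
    then obtain w where w: "w \<in> W" "w \<in> dom_chart c" "f w \<in> V'" "q = coord c w"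
      unfolding \<Omega>_def by blast
    then have "y = w" using q coord_inv_coord[OF c(1)] by simp
    then show "coord c y \<in> ball ?p \<rho>" "y \<in> dom_chart c" "y \<in> W" "f y \<in> V'"
      using w q by auto
  qed
  show ?thesis
  proof
    show "open U"
      unfolding U_def by (rule open_coord_inv_image[OF c(1) _ sub]) auto
    show "x \<in> U"
      unfolding U_def using \<rho>(1) coord_inv_coord[OF c] by (intro rev_image_eqI[of ?p]) auto
    show "U \<subseteq> W" using UW by blast
    fix y z assume y: "y \<in> U" and z: "z \<in> U"
    define \<Delta> where "\<Delta> = coord c z - coord c y"
    have "d y z \<le> 2 * rnorm g x \<Delta>"
      using R(3)[of "coord c y" "coord c z"] UW[OF y] UW[OF z] \<rho>(2) coord_inv_coord[OF c(1)]
      by (auto simp: \<Delta>_def)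
    also have "\<dots> \<le> 2 * (M * norm \<Delta>)"
      using mM by simp
    also have "\<dots> < 2 * (M * (2 * \<rho>))"
    proof -
      have "norm \<Delta> \<le> dist ?p (coord c y) + dist ?p (coord c z)"
        unfolding \<Delta>_def dist_norm[symmetric] by (metis dist_commute dist_triangle add.commute)
      also have "\<dots> < 2 * \<rho>" using UW(1)[OF y] UW(1)[OF z] by simp
      finally show ?thesis using mM by simp
    qed
    finally have "d y z < e" using \<rho>e by simp
    then have low: "rnorm g x \<Delta> \<le> 2 * d y z"
      unfolding \<Delta>_def using UW(1)[OF y] \<rho>(3) by (intro conjunct2[OF re(3)] UW(2)[OF y]) auto
    define E where "E = \<phi> (coord c z) - \<phi> (coord c y) - \<phi>' ?p \<Delta>"
    have "norm E \<le> norm \<Delta> * \<eta>"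
      using \<delta>(3)[of "coord c y" "coord c z"] UW(1)[OF y] UW(1)[OF z] \<rho>(4)
      by (auto simp: E_def \<Delta>_def mult.commute)
    then have E: "rnorm g (f x) E \<le> \<epsilon> / 4 * rnorm g x \<Delta>"
    proof -
      have "rnorm g (f x) E \<le> M' * norm E" by (rule M'(2))
      also have "\<dots> \<le> M' * (norm \<Delta> * \<eta>)"
        using \<open>norm E \<le> norm \<Delta> * \<eta>\<close> M' by (intro mult_left_mono) auto
      also have "\<dots> = (M' * \<eta> / m) * (m * norm \<Delta>)"
        using mM(1) by simp
      also have "\<dots> \<le> \<epsilon> / 4 * rnorm g x \<Delta>"
        unfolding \<eta>(2) using mM \<epsilon> by (intro mult_left_mono) auto
      finally show ?thesis .
    qed
    have \<phi>eq: "\<phi> (coord c y) = coord c' (f y)" if "y \<in> U" for y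
      using UW(2)[OF that] by (simp add: \<phi>_def coord_inv_coord[OF c(1)])
    have fb: "coord c' (f y) \<in> ball (coord c' (f x)) R'" "f y \<in> dom_chart c'" if yU: "y \<in> U" for y
    proof -
      obtain q where "q \<in> ball (coord c' (f x)) R'" "f y = coord_inv c' q"
        using UW(4)[OF yU] unfolding V'_def by blast
      then show "coord c' (f y) \<in> ball (coord c' (f x)) R'" "f y \<in> dom_chart c'"
        using R'(2) coord_coord_inv[OF c'(1), of q] coord_inv_in[OF c'(1), of q] by auto
    qed
    have "d (f y) (f z) \<le> 2 * rnorm g (f x) (coord c' (f z) - coord c' (f y))"
      using R'(3)[OF fb(1)[OF y] fb(1)[OF z]] coord_inv_coord[OF c'(1)] fb(2)[OF y] fb(2)[OF z] by simp
    also have "coord c' (f z) - coord c' (f y) = \<phi>' ?p \<Delta> + E"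
      by (simp add: E_def \<phi>eq y z)
    also have "2 * rnorm g (f x) (\<phi>' ?p \<Delta> + E) \<le> 2 * (rnorm g (f x) (\<phi>' ?p \<Delta>) + rnorm g (f x) E)"
      using inner_form_triangle[OF inner_form_metric, of "f x" "\<phi>' ?p \<Delta>" E] by (simp add: rnorm_def)
    also have "\<dots> \<le> 2 * (tn * rnorm g x \<Delta> + \<epsilon> / 4 * rnorm g x \<Delta>)"
      unfolding tn using op_norm_bound(1)[OF lin] E
      by (intro mult_left_mono add_mono) auto
    also have "\<dots> = 2 * (tn + \<epsilon> / 4) * rnorm g x \<Delta>"
      by (simp add: algebra_simps)
    also have "\<dots> \<le> 2 * (tn + \<epsilon> / 4) * (2 * d y z)"
      using low op_norm_bound(2)[OF lin] \<epsilon> unfolding tn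
      by (intro mult_left_mono) auto
    finally show "d (f y) (f z) \<le> (4 * tangent_norm \<A> g f x + \<epsilon>) * d y z"
      by (simp add: tn_def algebra_simps)
  qed
qed

subsection \<open>Paths of a partial flow\<close>

text \<open>The almost sure regularity in \<open>partial_flow\<close> for one fixed outcome, so that
  the lemmas below are deterministic. The blow-up property is kept apart, as its null set may depend
  on the compact set.\<close>

definition flow_path :: "('a \<Rightarrow> ereal) \<Rightarrow> (real \<Rightarrow> 'a \<Rightarrow> 'a) \<Rightarrow> bool" where
  "flow_path \<zeta> \<phi> \<longleftrightarrow> (\<forall>x. 0 < \<zeta> x \<and> \<phi> 0 x = x) \<and>
     (\<forall>t\<ge>0. open {x. ereal t < \<zeta> x} \<and> Ck_diffeo_onto_open 1 \<A> {x. ereal t < \<zeta> x} (\<phi> t)) \<and>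
     C1_compact_continuous \<A> (\<lambda>t. {x. ereal t < \<zeta> x}) \<phi>"

lemma
  assumes "flow_path \<zeta> \<phi>"
  shows flow_path_pos: "0 < \<zeta> x"
    and flow_path_open: "0 \<le> t \<Longrightarrow> open {x. ereal t < \<zeta> x}"
    and flow_path_C1: "0 \<le> t \<Longrightarrow> Ck_map_on 1 \<A> {x. ereal t < \<zeta> x} (\<phi> t)"
    and flow_path_continuous: "0 \<le> t \<Longrightarrow> continuous_on {x. ereal t < \<zeta> x} (\<phi> t)"
  using assms unfolding flow_path_def Ck_diffeo_onto_open_def Ck_map_on_def by auto

text \<open>\<open>C1_compact_continuous\<close> deals with compact sets inside one chart that are
  mapped into one chart. A small closed coordinate ball is such a set, and uniform closeness in time
  keeps its image in \<open>W\<close>.\<close>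

lemma flow_path_nhds:
  assumes flow: "flow_path \<zeta> \<phi>" and t: "0 \<le> t" "ereal t < \<zeta> x" and W: "open W" "\<phi> t x \<in> W"
  obtains U e where "open U" "x \<in> U" "0 < e"
    "\<And>s z. 0 \<le> s \<Longrightarrow> \<bar>s - t\<bar> < e \<Longrightarrow> z \<in> U \<Longrightarrow> ereal s < \<zeta> z \<and> \<phi> s z \<in> W"
proof -
  define c where "c = chart_at \<A> x"
  define c' where "c' = chart_at \<A> (\<phi> t x)"
  have c: "c \<in> \<A>" "x \<in> dom_chart c" and c': "c' \<in> \<A>" "\<phi> t x \<in> dom_chart c'"
    by (simp_all add: c_def c'_def chart_at)
  let ?D = "\<lambda>t. {x. ereal t < \<zeta> x}"
  let ?q = "coord c' (\<phi> t x)"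
  have "open (coord c' ` (W \<inter> dom_chart c'))" "?q \<in> coord c' ` (W \<inter> dom_chart c')"
    using open_coord_image[OF c'(1)] W open_dom[OF c'(1)] c' by auto
  then obtain \<epsilon> where \<epsilon>: "0 < \<epsilon>" "ball ?q \<epsilon> \<subseteq> coord c' ` (W \<inter> dom_chart c')"
    by (metis openE)
  have "ball ?q (\<epsilon>/2) \<subseteq> ball ?q \<epsilon>" using \<epsilon>(1) by (intro subset_ball) simp
  then have sub: "ball ?q (\<epsilon>/2) \<subseteq> img c'" using \<epsilon>(2) by blast
  \<comment> \<open>Half of \<open>\<epsilon>\<close> is spent on the position at time
    \<open>t\<close>, the other half on the change of time.\<close>
  define V where "V = coord_inv c' ` ball ?q (\<epsilon>/2)"
  have V: "open V" "\<phi> t x \<in> V"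
    unfolding V_def using open_coord_inv_image[OF c'(1) _ sub] \<epsilon>(1) coord_inv_coord[OF c']
    by (auto intro!: rev_image_eqI[of ?q])
  have V': "y \<in> dom_chart c'" "coord c' y \<in> ball ?q (\<epsilon>/2)" if "y \<in> V" for y
    using that sub coord_inv_in[OF c'(1)] coord_coord_inv[OF c'(1)] unfolding V_def by auto
  have "open (?D t \<inter> \<phi> t -` V)"
    using continuous_open_preimage[OF flow_path_continuous[OF flow] flow_path_open[OF flow] V(1)] t by blast
  then have "open (coord c ` (dom_chart c \<inter> (?D t \<inter> \<phi> t -` V)))"
    using open_dom[OF c(1)] by (intro open_coord_image[OF c(1)]) auto
  moreover have "coord c x \<in> coord c ` (dom_chart c \<inter> (?D t \<inter> \<phi> t -` V))"
    using c t V by auto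
  ultimately obtain \<rho> where \<rho>: "0 < \<rho>" "cball (coord c x) \<rho> \<subseteq> coord c ` (dom_chart c \<inter> (?D t \<inter> \<phi> t -` V))"
    by (metis open_contains_cball)
  have sub': "cball (coord c x) \<rho> \<subseteq> img c" using \<rho>(2) by blast
  then have sub'': "ball (coord c x) \<rho> \<subseteq> img c" using ball_subset_cball by blast
  define L where "L = coord_inv c ` cball (coord c x) \<rho>"
  define U where "U = coord_inv c ` ball (coord c x) \<rho>"
  have "compact L"
    unfolding L_def by (intro compact_continuous_image continuous_on_subset[OF continuous_coord_inv[OF c(1)] sub']) auto
  moreover have L: "y \<in> dom_chart c \<and> ereal t < \<zeta> y \<and> \<phi> t y \<in> V" if y: "y \<in> L" for y
  proof -
    obtain q where q: "q \<in> cball (coord c x) \<rho>" "y = coord_inv c q"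
      using y unfolding L_def by blast
    then obtain w where "w \<in> dom_chart c" "ereal t < \<zeta> w" "\<phi> t w \<in> V" "q = coord c w"
      using \<rho>(2) by blast
    then show ?thesis using q coord_inv_coord[OF c(1)] by simp
  qed
  ultimately have ev: "\<forall>\<^sub>F s in at t within {0..}. L \<subseteq> ?D s \<and> \<phi> s ` L \<subseteq> dom_chart c'"
    and ul: "uniform_limit L (\<lambda>s z. coord c' (\<phi> s z)) (\<lambda>z. coord c' (\<phi> t z)) (at t within {0..})"
  proof -
    assume "compact L"
    moreover have "L \<subseteq> dom_chart c \<inter> ?D t" "\<phi> t ` L \<subseteq> dom_chart c'"
      using L V' by auto
    ultimately show
     "\<forall>\<^sub>F s in at t within {0..}. L \<subseteq> ?D s \<and> \<phi> s ` L \<subseteq> dom_chart c'"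
     "uniform_limit L (\<lambda>s z. coord c' (\<phi> s z)) (\<lambda>z. coord c' (\<phi> t z)) (at t within {0..})"
      using flow c(1) c'(1) t(1) unfolding flow_path_def C1_compact_continuous_def by blast+
  qed
  have "\<forall>\<^sub>F s in at t within {0..}. \<forall>z\<in>L. dist (coord c' (\<phi> s z)) (coord c' (\<phi> t z)) < \<epsilon>/2"
    using ul \<epsilon>(1) half_gt_zero unfolding uniform_limit_iff by blast
  with ev have "\<forall>\<^sub>F s in at t within {0..}. \<forall>z\<in>L. ereal s < \<zeta> z \<and> \<phi> s z \<in> W"
  proof eventually_elim
    case (elim s)
    show ?case
    proof
      fix z assume z: "z \<in> L"
      have "dist ?q (coord c' (\<phi> s z)) < \<epsilon>"
        using bspec[OF elim(2) z] V'(2)[of "\<phi> t z"] L[OF z]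
          dist_triangle[of ?q "coord c' (\<phi> s z)" "coord c' (\<phi> t z)"] by (simp add: dist_commute)
      then have "coord c' (\<phi> s z) \<in> ball ?q \<epsilon>" by simp
      then obtain w where w: "w \<in> W" "w \<in> dom_chart c'" "coord c' (\<phi> s z) = coord c' w"
        using \<epsilon>(2) by blast
      have "\<phi> s z \<in> dom_chart c'" using elim(1) z by blast
      then have "\<phi> s z = w" using w coord_inv_coord[OF c'(1)] by metis
      then show "ereal s < \<zeta> z \<and> \<phi> s z \<in> W" using w elim(1) z by blast
    qed
  qed
  then obtain e where e: "0 < e" "\<And>s. 0 \<le> s \<Longrightarrow> s \<noteq> t \<Longrightarrow> dist s t < e \<Longrightarrow> \<forall>z\<in>L. ereal s < \<zeta> z \<and> \<phi> s z \<in> W"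
    unfolding eventually_at by auto
  have VW: "y \<in> W" if "y \<in> V" for y
  proof -
    have "coord c' y \<in> ball ?q \<epsilon>" using V'(2)[OF that] \<epsilon>(1) by simp
    then obtain w where w: "w \<in> W" "w \<in> dom_chart c'" "coord c' y = coord c' w"
      using \<epsilon>(2) by blast
    then have "y = w" using coord_inv_coord[OF c'(1)] V'(1)[OF that] by metis
    then show ?thesis using w by simp
  qed
  show ?thesis
  proof
    show "open U"
      unfolding U_def by (rule open_coord_inv_image[OF c(1) _ sub'']) auto
    show "x \<in> U"
      unfolding U_def using \<rho>(1) coord_inv_coord[OF c] by (intro rev_image_eqI[of "coord c x"]) auto
    show "0 < e" by (fact e(1))
    fix s z assume s: "0 \<le> s" "\<bar>s - t\<bar> < e" and "z \<in> U"
    then have z: "z \<in> L" by (auto simp: U_def L_def)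
    \<comment> \<open>The filter \<open>at t within {0..}\<close> is punctured, so
      \<open>s = t\<close> is treated separately.\<close>
    show "ereal s < \<zeta> z \<and> \<phi> s z \<in> W"
    proof (cases "s = t")
      case True
      then show ?thesis using L[OF z] VW by auto
    qed (use e(2)[OF s(1)] s z in \<open>auto simp: dist_real_def\<close>)
  qed
qed

lemma flow_path_jointly_continuous:
  assumes flow: "flow_path \<zeta> \<phi>"
  shows "continuous_on {(t, x). 0 \<le> t \<and> ereal t < \<zeta> x} (\<lambda>(t, x). \<phi> t x)"
  unfolding continuous_on_topological
proof (clarify)
  fix t x W assume t: "0 \<le> t" "ereal t < \<zeta> x" and W: "open W" "\<phi> t x \<in> W"
  obtain U e where U: "open U" "x \<in> U" "0 < e"
    "\<And>s z. 0 \<le> s \<Longrightarrow> \<bar>s - t\<bar> < e \<Longrightarrow> z \<in> U \<Longrightarrow> ereal s < \<zeta> z \<and> \<phi> s z \<in> W"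
    by (rule flow_path_nhds[OF flow t W]) blast
  show "\<exists>A. open A \<and> (t, x) \<in> A \<and>
    (\<forall>y\<in>{(t, x). 0 \<le> t \<and> ereal t < \<zeta> x}. y \<in> A \<longrightarrow> (case y of (t, x) \<Rightarrow> \<phi> t x) \<in> W)"
    using U by (intro exI[of _ "ball t e \<times> U"]) (auto intro: open_Times simp: dist_real_def abs_minus_commute)
qed

text \<open>Life times are locally bounded away from 0, and finitely many neighbourhoods cover
  \<open>K\<close>. Positivity guarantees positive times just before an explosion.\<close>

lemma explosion_time_pos:
  assumes flow: "flow_path \<zeta> \<phi>" and K: "compact K"
  shows "0 < (INF x\<in>K. \<zeta> x)"
proof -
  have "\<exists>U e. open U \<and> x \<in> U \<and> 0 < e \<and> (\<forall>z\<in>U. ereal e < \<zeta> z)" for x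
  proof -
    obtain U e where U: "open U" "x \<in> U" "0 < e"
      "\<And>s z. 0 \<le> s \<Longrightarrow> \<bar>s - 0\<bar> < e \<Longrightarrow> z \<in> U \<Longrightarrow> ereal s < \<zeta> z \<and> \<phi> s z \<in> UNIV"
      using flow_path_nhds[OF flow _ _ open_UNIV, of 0 x] flow_path_pos[OF flow, of x]
      by (auto simp: zero_ereal_def)
    then show ?thesis
      by (intro exI[of _ U] exI[of _ "e/2"]) auto
  qed
  then obtain U e where U: "\<And>x. open (U x)" "\<And>x. x \<in> U x" "\<And>x. 0 < e x" "\<And>x z. z \<in> U x \<Longrightarrow> ereal (e x) < \<zeta> z"
    by metis
  obtain T where T: "T \<subseteq> K" "finite T" "K \<subseteq> (\<Union>x\<in>T. U x)"
    using compactE_image[OF K, of K U] U by blast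
  define \<delta> where "\<delta> = Min (insert 1 (e ` T))"
  have "0 < \<delta>"
    unfolding \<delta>_def using T U by (subst Min_gr_iff) auto
  moreover have "ereal \<delta> \<le> (INF x\<in>K. \<zeta> x)"
  proof (rule INF_greatest)
    fix x assume "x \<in> K"
    then obtain y where y: "y \<in> T" "x \<in> U y" using T by blast
    have "\<delta> \<le> e y" unfolding \<delta>_def using T y by (intro Min_le) auto
    then have "ereal \<delta> \<le> ereal (e y)" by simp
    also have "\<dots> \<le> \<zeta> x" using U(4)[OF y(2)] by (rule less_imp_le)
    finally show "ereal \<delta> \<le> \<zeta> x" .
  qed
  ultimately show ?thesis
    using less_le_trans[of 0 "ereal \<delta>" "INF x\<in>K. \<zeta> x"] by simp
qed

lemma flow_path_bounded:
  assumes flow: "flow_path \<zeta> \<phi>" and K: "compact K" and s: "\<And>x. x \<in> K \<Longrightarrow> ereal s < \<zeta> x"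
  obtains R where "\<And>r x. r \<in> {0..s} \<Longrightarrow> x \<in> K \<Longrightarrow> d b (\<phi> r x) \<le> R"
proof -
  have live: "ereal r < \<zeta> x" if "r \<in> {0..s}" "x \<in> K" for r x
    using s[OF that(2)] that(1) by (intro le_less_trans[of "ereal r" "ereal s"]) auto
  have "continuous_on ({0..s} \<times> K) (\<lambda>(t, x). \<phi> t x)"
    by (rule continuous_on_subset[OF flow_path_jointly_continuous[OF flow]]) (use live in auto)
  then have "continuous_on ({0..s} \<times> K) (\<lambda>y. d b ((\<lambda>(t, x). \<phi> t x) y))"
    by (rule continuous_on_compose2[OF dist_continuous]) auto
  then have "compact ((\<lambda>y. d b ((\<lambda>(t, x). \<phi> t x) y)) ` ({0..s} \<times> K))"
    by (intro compact_continuous_image compact_Times K) auto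
  then have "bdd_above ((\<lambda>y. d b ((\<lambda>(t, x). \<phi> t x) y)) ` ({0..s} \<times> K))"
    by (intro bounded_imp_bdd_above compact_imp_bounded)
  then obtain R where "\<And>y. y \<in> {0..s} \<times> K \<Longrightarrow> d b ((\<lambda>(t, x). \<phi> t x) y) \<le> R"
    unfolding bdd_above_def by auto
  then show ?thesis using that by fastforce
qed

lemma tangent_norm_nonneg:
  assumes flow: "flow_path \<zeta> \<phi>" and s: "0 \<le> s" "ereal s < \<zeta> x"
  shows "0 \<le> tangent_norm \<A> g (\<phi> s) x"
proof -
  let ?c = "chart_at \<A> x" and ?c' = "chart_at \<A> (\<phi> s x)"
  have "Ck_on 1 (coord ?c ` ({x. ereal s < \<zeta> x} \<inter> dom_chart ?c \<inter> \<phi> s -` dom_chart ?c')) (coord ?c' \<circ> \<phi> s \<circ> coord_inv ?c)"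
    using flow_path_C1[OF flow s(1)] chart_at unfolding Ck_map_on_def by blast
  moreover have "x \<in> {x. ereal s < \<zeta> x} \<inter> dom_chart ?c \<inter> \<phi> s -` dom_chart ?c'"
    using s chart_at by auto
  ultimately have "(coord ?c' \<circ> \<phi> s \<circ> coord_inv ?c) differentiable (at (coord ?c x))"
    by auto
  then have "linear (tangent_map \<A> (\<phi> s) x)"
    unfolding tangent_map_def by (rule linear_frechet_derivative)
  then show ?thesis
    unfolding tangent_norm_def by (rule op_norm_bound(2))
qed

text \<open>A composition of three maps: \<open>\<sigma>\<close> with constant \<open>C\<close>, the
  flow at time \<open>s\<close> with a local constant from its derivative, and the distance from
  \<open>b\<close> with constant 1. The tolerance \<open>\<epsilon> / C\<close> becomes
  \<open>\<epsilon>\<close> after composition with \<open>\<sigma>\<close>.\<close>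

lemma flow_path_locally_lipschitz:
  fixes \<sigma> :: "'x::metric_space \<Rightarrow> 'a"
  assumes flow: "flow_path \<zeta> \<phi>" and s: "0 \<le> s" "ereal s < \<zeta> (\<sigma> u)" and u: "u \<in> Q" and \<epsilon>: "0 < \<epsilon>" and C: "0 < C"
    and \<sigma>: "\<And>u v. u \<in> Q \<Longrightarrow> v \<in> Q \<Longrightarrow> d (\<sigma> u) (\<sigma> v) \<le> C * dist u v"
  obtains e where "0 < e" "\<And>v. v \<in> Q \<inter> ball u e \<Longrightarrow> ereal s < \<zeta> (\<sigma> v)"
    "\<And>v w. v \<in> Q \<inter> ball u e \<Longrightarrow> w \<in> Q \<inter> ball u e \<Longrightarrow>
      \<bar>d b (\<phi> s (\<sigma> v)) - d b (\<phi> s (\<sigma> w))\<bar> \<le> (4 * tangent_norm \<A> g (\<phi> s) (\<sigma> u) * C + \<epsilon>) * dist v w"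
proof -
  let ?tn = "tangent_norm \<A> g (\<phi> s) (\<sigma> u)"
  have live: "\<sigma> u \<in> {x. ereal s < \<zeta> x}" and pos: "0 < \<epsilon> / C" using s \<epsilon> C by auto
  obtain U where U: "open U" "\<sigma> u \<in> U" "U \<subseteq> {x. ereal s < \<zeta> x}"
    "\<And>y z. y \<in> U \<Longrightarrow> z \<in> U \<Longrightarrow> d (\<phi> s y) (\<phi> s z) \<le> (4 * ?tn + \<epsilon> / C) * d y z"
    by (rule C1_map_locally_lipschitz[OF flow_path_open[OF flow s(1)] live flow_path_C1[OF flow s(1)] pos]) blast
  have tn: "0 \<le> ?tn"
    by (rule tangent_norm_nonneg[OF flow s])
  obtain e where e: "0 < e" "\<And>v. v \<in> Q \<Longrightarrow> dist v u < e \<Longrightarrow> \<sigma> v \<in> U"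
  proof -
    have "continuous_on Q \<sigma>"
      using \<sigma> by (rule lipschitz_imp_continuous)
    then have "(\<sigma> \<longlongrightarrow> \<sigma> u) (at u within Q)"
      using u unfolding continuous_on_def by blast
    from topological_tendstoD[OF this U(1,2)] have "eventually (\<lambda>v. \<sigma> v \<in> U) (at u within Q)" .
    then show ?thesis
      using that U(2) unfolding eventually_at by metis
  qed
  show ?thesis
  proof
    fix v assume "v \<in> Q \<inter> ball u e"
    then have "\<sigma> v \<in> U" using e(2)[of v] by (auto simp: dist_commute)
    then show "ereal s < \<zeta> (\<sigma> v)" using U(3) by auto
  next
    fix v w assume v: "v \<in> Q \<inter> ball u e" and w: "w \<in> Q \<inter> ball u e"
    then have inU: "\<sigma> v \<in> U" "\<sigma> w \<in> U" using e(2)[of v] e(2)[of w] by (auto simp: dist_commute)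
    have k: "0 \<le> 4 * ?tn + \<epsilon> / C" using tn \<epsilon> C by simp
    have le: "(4 * ?tn + \<epsilon> / C) * d (\<sigma> v') (\<sigma> w') \<le> (4 * ?tn * C + \<epsilon>) * dist v w"
      if "v' \<in> Q" "w' \<in> Q" "dist v' w' = dist v w" for v' w'
    proof -
      have "(4 * ?tn + \<epsilon> / C) * d (\<sigma> v') (\<sigma> w') \<le> (4 * ?tn + \<epsilon> / C) * (C * dist v w)"
        using \<sigma>[OF that(1,2)] that(3) k by (intro mult_left_mono) auto
      also have "\<dots> = (4 * ?tn * C + \<epsilon>) * dist v w"
        using C by (simp add: field_simps)
      finally show ?thesis .
    qed
    show "\<bar>d b (\<phi> s (\<sigma> v)) - d b (\<phi> s (\<sigma> w))\<bar> \<le> (4 * ?tn * C + \<epsilon>) * dist v w"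
      using v w by (intro dist_diff_le order_trans[OF U(4) le] inU) (auto simp: dist_commute)
  qed (fact e(1))
qed

end

text \<open>The random bounds below are suprema over rational times, so the blow-up has to be
  detected at a rational time.\<close>

lemma tendsto_infinity_at_left_rational:
  fixes f :: "real \<Rightarrow> ereal"
  assumes "(f \<longlongrightarrow> \<infinity>) (at_left \<tau>)" "0 < \<tau>"
  obtains r where "r \<in> \<rat>" "0 < r" "r < \<tau>" "ereal N < f r"
proof -
  have "eventually (\<lambda>t. ereal N < f t) (at_left \<tau>)"
    using order_tendstoD(1)[OF assms(1), of "ereal N"] by simp
  then obtain b where b: "b < \<tau>" "\<And>t. b < t \<Longrightarrow> t < \<tau> \<Longrightarrow> ereal N < f t"
    unfolding eventually_at_left_field by blast
  then obtain r where "r \<in> \<rat>" "max 0 b < r" "r < \<tau>"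
    using Rats_dense_in_real[of "max 0 b" \<tau>] assms(2) by auto
  then show ?thesis using that b by auto
qed

section \<open>Non-explosion on Lipschitz cubes\<close>

text \<open>The exceptional null set in \<open>blow_up\<close> may depend on \<open>K\<close>;
  accordingly one cube is fixed at a time.\<close>

locale stochastic_flow = riemannian_manifold \<A> g + prob_space P
  for \<A> :: "('a::{t2_space, second_countable_topology}, 'e::euclidean_space) chart set"
    and g and P :: "'w measure" +
  fixes \<xi> :: "'a \<Rightarrow> 'w \<Rightarrow> ereal" and \<Phi> :: "real \<Rightarrow> 'a \<Rightarrow> 'w \<Rightarrow> 'a"
  assumes flow_measurable:
      "\<And>t x U. 0 \<le> t \<Longrightarrow> open U \<Longrightarrow> {\<omega> \<in> space P. ereal t < \<xi> x \<omega> \<and> \<Phi> t x \<omega> \<in> U} \<in> sets P"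
    and flow_paths: "AE \<omega> in P. flow_path (\<lambda>x. \<xi> x \<omega>) (\<lambda>t x. \<Phi> t x \<omega>)"
    and blow_up: "\<And>K. compact K \<Longrightarrow> AE \<omega> in P. (INF x\<in>K. \<xi> x \<omega>) < \<infinity> \<longrightarrow>
       (\<forall>b. ((\<lambda>t. SUP x\<in>K. ereal (d b (\<Phi> t x \<omega>))) \<longlongrightarrow> \<infinity>) (at_left (real_of_ereal (INF x\<in>K. \<xi> x \<omega>))))"

begin

abbreviation sup_tangent_norm :: "real \<Rightarrow> real \<Rightarrow> 'a \<Rightarrow> 'w \<Rightarrow> ennreal" where
  "sup_tangent_norm T q x \<omega> \<equiv> (SUP s\<in>{0..T}. ennreal (tangent_norm \<A> g (\<lambda>z. \<Phi> s z \<omega>) x powr q) *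
     indicator {s. ereal s < \<xi> x \<omega>} s)"

end

locale stochastic_cube = stochastic_flow \<A> g P \<xi> \<Phi>
  for \<A> :: "('a::{t2_space, second_countable_topology}, 'e::euclidean_space) chart set"
    and g and P :: "'w measure" and \<xi> \<Phi> +
  fixes Q D :: "'x::euclidean_space set" and \<sigma> :: "'x \<Rightarrow> 'a" and C :: real and y0 :: 'a
  assumes Q: "compact Q" "convex Q" "emeasure lborel Q = 1"
    and D: "countable D" "D \<subseteq> Q" "Q \<subseteq> closure D"
    and \<sigma>: "\<And>u v. u \<in> Q \<Longrightarrow> v \<in> Q \<Longrightarrow> d (\<sigma> u) (\<sigma> v) \<le> C * dist u v" and C: "0 < C"
begin

text \<open>The default 0 after the life time makes this a random variable on all of
  \<open>space P\<close>.\<close>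

definition height :: "real \<Rightarrow> 'x \<Rightarrow> 'w \<Rightarrow> real" where
  "height s v \<omega> = (if ereal s < \<xi> (\<sigma> v) \<omega> then d y0 (\<Phi> s (\<sigma> v) \<omega>) else 0)"

text \<open>Almost surely this is the event that no point of \<open>\<sigma> ` Q\<close> has exploded up to time \<open>s\<close>,
  expressed through countably many random variables.\<close>

definition bounded_until :: "real \<Rightarrow> 'w \<Rightarrow> bool" where
  "bounded_until s \<omega> \<longleftrightarrow> (\<forall>v\<in>D. ereal s < \<xi> (\<sigma> v) \<omega>) \<and>
     (\<exists>N::nat. \<forall>r\<in>\<rat> \<inter> {0..s}. \<forall>v\<in>D. height r v \<omega> \<le> real N)"

abbreviation path :: "'w \<Rightarrow> bool" where
  "path \<omega> \<equiv> flow_path (\<lambda>x. \<xi> x \<omega>) (\<lambda>t x. \<Phi> t x \<omega>)"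

abbreviation \<tau> :: "'w \<Rightarrow> ereal" where
  "\<tau> \<omega> \<equiv> (INF x\<in>\<sigma> ` Q. \<xi> x \<omega>)"

lemma closure_D: "closure D = Q"
  using D Q by (intro antisym closure_minimal compact_imp_closed)

lemma \<sigma>_continuous: "continuous_on Q \<sigma>"
  using \<sigma> by (rule lipschitz_imp_continuous)

lemma compact_image_\<sigma>: "compact (\<sigma> ` Q)"
  by (intro compact_continuous_image \<sigma>_continuous Q)

lemma alive: "ereal s < \<tau> \<omega> \<Longrightarrow> v \<in> Q \<Longrightarrow> ereal s < \<xi> (\<sigma> v) \<omega>"
  by (rule less_le_trans[OF _ INF_lower]) auto

lemma height_alive: "ereal s < \<tau> \<omega> \<Longrightarrow> v \<in> Q \<Longrightarrow> height s v \<omega> = d y0 (\<Phi> s (\<sigma> v) \<omega>)"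
  by (simp add: height_def alive)

lemma alive_sets: "0 \<le> s \<Longrightarrow> {\<omega> \<in> space P. ereal s < \<xi> x \<omega>} \<in> sets P"
  using flow_measurable[of s UNIV x] by simp

lemma height_measurable: "0 \<le> s \<Longrightarrow> height s v \<in> borel_measurable P"
  unfolding borel_measurable_iff_greater
proof
  fix a :: real assume s: "0 \<le> s"
  show "{\<omega> \<in> space P. a < height s v \<omega>} \<in> sets P"
  proof (cases "a < 0")
    case True
    then have "{\<omega> \<in> space P. a < height s v \<omega>} = space P"
      using dist_nonneg by (auto simp: height_def intro: less_le_trans)
    then show ?thesis by simp
  next
    case False
    then have "{\<omega> \<in> space P. a < height s v \<omega>} =
        {\<omega> \<in> space P. ereal s < \<xi> (\<sigma> v) \<omega> \<and> \<Phi> s (\<sigma> v) \<omega> \<in> d y0 -` {a<..}}"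
      by (auto simp: height_def split: if_splits)
    also have "\<dots> \<in> sets P"
      using dist_continuous by (intro flow_measurable s open_vimage) auto
    finally show ?thesis .
  qed
qed

lemma bounded_until_sets:
  assumes s: "0 \<le> s"
  shows "{\<omega> \<in> space P. bounded_until s \<omega>} \<in> sets P"
  unfolding bounded_until_def
proof (intro sets.sets_Collect_conj sets.sets_Collect_countable_Ex)
  show "{\<omega> \<in> space P. \<forall>v\<in>D. ereal s < \<xi> (\<sigma> v) \<omega>} \<in> sets P"
    by (intro sets.sets_Collect_countable_All' alive_sets s D)
  show "{\<omega> \<in> space P. \<forall>r\<in>\<rat> \<inter> {0..s}. \<forall>v\<in>D. height r v \<omega> \<le> real N} \<in> sets P" for N
  proof (intro sets.sets_Collect_countable_All' D)
    show "countable (\<rat> \<inter> {0..s})" using countable_rat by blast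
    fix r v assume "r \<in> \<rat> \<inter> {0..s}"
    then have [measurable]: "height r v \<in> borel_measurable P" by (intro height_measurable) auto
    show "{\<omega> \<in> space P. height r v \<omega> \<le> real N} \<in> sets P" by measurable
  qed
qed

lemma bounded_until_of_less:
  assumes path: "path \<omega>" and s: "0 \<le> s" "ereal s < \<tau> \<omega>"
  shows "bounded_until s \<omega>"
proof -
  have "ereal s < \<xi> x \<omega>" if "x \<in> \<sigma> ` Q" for x
    using alive[OF s(2)] that by auto
  then obtain R where R: "\<And>r x. r \<in> {0..s} \<Longrightarrow> x \<in> \<sigma> ` Q \<Longrightarrow> d y0 (\<Phi> r x \<omega>) \<le> R"
    using flow_path_bounded[OF path compact_image_\<sigma>, of s y0] by blast
  have "height r v \<omega> \<le> real (nat \<lceil>R\<rceil>)" if "r \<in> \<rat> \<inter> {0..s}" "v \<in> D" for r v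
  proof -
    have "ereal r < \<tau> \<omega>" using that s by (intro le_less_trans[of "ereal r" "ereal s"]) auto
    then have "height r v \<omega> \<le> R"
      using height_alive[of r \<omega> v] R[of r "\<sigma> v"] that D by auto
    then show ?thesis by linarith
  qed
  then show ?thesis
    unfolding bounded_until_def using alive[OF s(2)] D by blast
qed

lemma height_continuous:
  assumes path: "path \<omega>" and s: "0 \<le> s" "ereal s < \<tau> \<omega>"
  shows "continuous_on Q (\<lambda>v. height s v \<omega>)"
proof -
  have "continuous_on Q (\<lambda>v. \<Phi> s (\<sigma> v) \<omega>)"
    by (rule continuous_on_compose2[OF flow_path_continuous[OF path s(1)] \<sigma>_continuous]) (use alive[OF s(2)] in auto)
  then have "continuous_on Q (\<lambda>v. d y0 (\<Phi> s (\<sigma> v) \<omega>))"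
    by (rule continuous_on_compose2[OF dist_continuous]) auto
  then show ?thesis
    by (rule continuous_on_eq) (simp add: height_alive[OF s(2)])
qed

lemma SUP_dist_le:
  assumes path: "path \<omega>" and s: "0 \<le> s" "ereal s < \<tau> \<omega>" and le: "\<And>v. v \<in> D \<Longrightarrow> height s v \<omega> \<le> N"
  shows "(SUP x\<in>\<sigma> ` Q. ereal (d y0 (\<Phi> s x \<omega>))) \<le> ereal N"
proof -
  have cont: "continuous_on (closure D) (\<lambda>v. height s v \<omega>)"
    unfolding closure_D by (rule height_continuous[OF path s])
  have "d y0 (\<Phi> s (\<sigma> v) \<omega>) \<le> N" if "v \<in> Q" for v
    using continuous_le_on_closure[OF cont _ le, of v] that height_alive[OF s(2) that]
    by (simp add: closure_D)
  then show ?thesis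
    by (intro SUP_least) auto
qed

text \<open>Before the explosion, continuity extends the bound from \<open>D\<close> to all of
  \<open>Q\<close>, so an explosion up to time \<open>s\<close> would contradict the blow-up. With
  \<open>bounded_until_of_less\<close> this identifies the event described at
  \<open>bounded_until\<close>.\<close>

lemma less_of_bounded_until:
  assumes path: "path \<omega>"
    and blow: "\<tau> \<omega> < \<infinity> \<Longrightarrow> ((\<lambda>t. SUP x\<in>\<sigma> ` Q. ereal (d y0 (\<Phi> t x \<omega>))) \<longlongrightarrow> \<infinity>) (at_left (real_of_ereal (\<tau> \<omega>)))"
    and s: "0 \<le> s" "bounded_until s \<omega>"
  shows "ereal s < \<tau> \<omega>"
proof (rule ccontr)
  assume "\<not> ereal s < \<tau> \<omega>"
  then have le: "\<tau> \<omega> \<le> ereal s" by simp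
  have pos: "0 < \<tau> \<omega>"
    by (rule explosion_time_pos[OF path compact_image_\<sigma>])
  then obtain T where T: "\<tau> \<omega> = ereal T" "0 < T" "T \<le> s"
    using le by (cases "\<tau> \<omega>") auto
  obtain N :: nat where N: "\<And>r v. r \<in> \<rat> \<inter> {0..s} \<Longrightarrow> v \<in> D \<Longrightarrow> height r v \<omega> \<le> real N"
    using s(2) unfolding bounded_until_def by blast
  have "((\<lambda>t. SUP x\<in>\<sigma> ` Q. ereal (d y0 (\<Phi> t x \<omega>))) \<longlongrightarrow> \<infinity>) (at_left T)"
    using blow T by simp
  from tendsto_infinity_at_left_rational[OF this T(2)] obtain r where
    r: "r \<in> \<rat>" "0 < r" "r < T" "ereal (real N) < (SUP x\<in>\<sigma> ` Q. ereal (d y0 (\<Phi> r x \<omega>)))"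
    by blast
  have "(SUP x\<in>\<sigma> ` Q. ereal (d y0 (\<Phi> r x \<omega>))) \<le> ereal (real N)"
    using r T N by (intro SUP_dist_le[OF path]) auto
  then show False using r(4) by simp
qed

text \<open>The local Lipschitz constant of the flow at \<open>\<sigma> u\<close> bounds all slopes
  taken close enough to \<open>u\<close>. Here the derivative is exchanged for a quantity that is
  measurable in the outcome.\<close>

lemma slope_le_tangent_norm:
  assumes path: "path \<omega>" and s: "0 \<le> s" "ereal s < \<xi> (\<sigma> u) \<omega>" and u: "u \<in> Q"
  shows "enn2real (slope D (\<lambda>v. height s v \<omega>) u) \<le> 4 * C * tangent_norm \<A> g (\<lambda>z. \<Phi> s z \<omega>) (\<sigma> u)"
proof (rule field_le_epsilon)
  let ?tn = "tangent_norm \<A> g (\<lambda>z. \<Phi> s z \<omega>) (\<sigma> u)" and ?h = "\<lambda>v. height s v \<omega>"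
  fix \<epsilon> :: real assume \<epsilon>: "0 < \<epsilon>"
  obtain e where e: "0 < e" "\<And>v. v \<in> Q \<inter> ball u e \<Longrightarrow> ereal s < \<xi> (\<sigma> v) \<omega>"
    "\<And>v w. v \<in> Q \<inter> ball u e \<Longrightarrow> w \<in> Q \<inter> ball u e \<Longrightarrow>
      \<bar>d y0 (\<Phi> s (\<sigma> v) \<omega>) - d y0 (\<Phi> s (\<sigma> w) \<omega>)\<bar> \<le> (4 * ?tn * C + \<epsilon>) * dist v w"
    using flow_path_locally_lipschitz[OF path s u \<epsilon> C \<sigma>, of y0] by blast
  obtain n where n: "1 / real (Suc n) < e"
    using e(1) by (metis nat_approx_posE)
  have near: "v \<in> Q \<inter> ball u e" if "v \<in> D" "dist v u < 1 / real (Suc n)" for v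
    using that n D by (auto simp: dist_commute)
  have "steep D ?h n u \<le> ennreal (max 0 (4 * ?tn * C + \<epsilon>))"
  proof (rule steep_leI)
    fix v w assume v: "v \<in> D" "dist v u < 1 / real (Suc n)" and w: "w \<in> D" "dist w u < 1 / real (Suc n)"
    note nv = near[OF v] and nw = near[OF w]
    have "\<bar>?h v - ?h w\<bar> \<le> (4 * ?tn * C + \<epsilon>) * dist v w"
      using e(2)[OF nv] e(2)[OF nw] e(3)[OF nv nw] by (simp add: height_def)
    also have "\<dots> \<le> max 0 (4 * ?tn * C + \<epsilon>) * dist v w"
      by (intro mult_right_mono) auto
    finally show "\<bar>?h v - ?h w\<bar> \<le> max 0 (4 * ?tn * C + \<epsilon>) * dist v w" .
  qed simp
  moreover have "slope D ?h u \<le> steep D ?h n u"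
    unfolding slope_def by (rule INF_lower) simp
  ultimately have "slope D ?h u \<le> ennreal (max 0 (4 * ?tn * C + \<epsilon>))"
    by (rule order_trans[rotated])
  then have "enn2real (slope D ?h u) \<le> max 0 (4 * ?tn * C + \<epsilon>)"
    by (intro enn2real_leI) auto
  moreover have "0 \<le> 4 * ?tn * C + \<epsilon>"
    using tangent_norm_nonneg[OF path s] \<epsilon> C by auto
  ultimately show "enn2real (slope D ?h u) \<le> 4 * C * ?tn + \<epsilon>"
    by (simp add: mult_ac)
qed

text \<open>Compactness of \<open>Q\<close> yields a uniform bound on some \<open>steep\<close>, as
  \<open>morrey_oscillation\<close> requires. That bound depends on \<open>s\<close> and the outcome
  and disappears from the result.\<close>

lemma height_oscillation:
  assumes path: "path \<omega>" and s: "0 \<le> s" "ereal s < \<tau> \<omega>" and uv: "u \<in> Q" "v \<in> Q"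
    and q: "real DIM('x) < q"
  defines "\<beta> \<equiv> (real DIM('x) + q) / 2 - 1"
  shows "ennreal \<bar>height s u \<omega> - height s v \<omega>\<bar> \<le> ennreal (2 * diameter Q) *
   (ennreal (1 / (\<beta> - real DIM('x) + 1)) * (\<integral>\<^sup>+w\<in>Q. ennreal (enn2real (slope D (\<lambda>v. height s v \<omega>) w) powr q) \<partial>lborel) +
    ennreal (1 / (1 - \<beta> / (q - 1))))"
proof -
  let ?h = "\<lambda>v. height s v \<omega>"
  have loc: "\<exists>M. \<exists>e>0. \<forall>v\<in>Q \<inter> ball u e. \<forall>w\<in>Q \<inter> ball u e. \<bar>?h v - ?h w\<bar> \<le> M * dist v w" if u: "u \<in> Q" for u
  proof -
    let ?M = "4 * tangent_norm \<A> g (\<lambda>z. \<Phi> s z \<omega>) (\<sigma> u) * C + 1"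
    obtain e where e: "0 < e" "\<And>v. v \<in> Q \<inter> ball u e \<Longrightarrow> ereal s < \<xi> (\<sigma> v) \<omega>"
      "\<And>v w. v \<in> Q \<inter> ball u e \<Longrightarrow> w \<in> Q \<inter> ball u e \<Longrightarrow>
        \<bar>d y0 (\<Phi> s (\<sigma> v) \<omega>) - d y0 (\<Phi> s (\<sigma> w) \<omega>)\<bar> \<le> ?M * dist v w"
      using flow_path_locally_lipschitz[OF path s(1) alive[OF s(2) u] u zero_less_one C \<sigma>, of y0] by blast
    have "\<bar>?h v - ?h w\<bar> \<le> ?M * dist v w" if "v \<in> Q \<inter> ball u e" "w \<in> Q \<inter> ball u e" for v w
      using e(3)[OF that] height_alive[OF s(2), of v] height_alive[OF s(2), of w] that by simp
    then show ?thesis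
      using e(1) by blast
  qed
  obtain M e where Me: "0 < e" "0 \<le> M"
    "\<And>u v w. u \<in> Q \<Longrightarrow> v \<in> Q \<inter> ball u e \<Longrightarrow> w \<in> Q \<inter> ball u e \<Longrightarrow> \<bar>?h v - ?h w\<bar> \<le> M * dist v w"
    by (rule locally_lipschitz_uniform[of Q "\<lambda>v w. \<bar>?h v - ?h w\<bar>", OF Q(1) loc]) (assumption, rule that)
  obtain n where n: "1 / real (Suc n) < e"
    using Me(1) by (metis nat_approx_posE)
  have "steep D ?h n z \<le> ennreal M" if z: "z \<in> Q" for z
  proof (rule steep_leI[OF _ Me(2)])
    fix v w assume "v \<in> D" "w \<in> D" "dist v z < 1 / real (Suc n)" "dist w z < 1 / real (Suc n)"
    then show "\<bar>?h v - ?h w\<bar> \<le> M * dist v w"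
      using n D by (intro Me(3)[OF z]) (auto simp: dist_commute)
  qed
  then show ?thesis
    unfolding \<beta>_def
    by (intro morrey_oscillation[OF D(1) D(2,3) height_continuous[OF path s] Q _ uv q])
qed

text \<open>The indicator discards times at which part of the cube may have exploded: there the
  height contains default values, and its slope is unrelated to the derivative of the flow.\<close>

definition running_slope :: "real \<Rightarrow> real \<Rightarrow> 'x \<Rightarrow> 'w \<Rightarrow> ennreal" where
  "running_slope T q u \<omega> = (SUP s\<in>\<rat> \<inter> {0..T}. indicator {\<omega> \<in> space P. bounded_until s \<omega>} \<omega> *
     ennreal (enn2real (slope D (\<lambda>v. height s v \<omega>) u) powr q))"

text \<open>Measurability jointly in the point and the outcome is what Tonelli's theorem asks for.
  It rests on the restriction to rational times and to slopes within the countable set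
  \<open>D\<close>.\<close>

lemma running_slope_measurable:
  "(\<lambda>(u, \<omega>). running_slope T q u \<omega>) \<in> borel_measurable (lborel \<Otimes>\<^sub>M P)"
  unfolding running_slope_def case_prod_beta
proof (intro borel_measurable_SUP)
  show "countable (\<rat> \<inter> {0..T})" using countable_rat by blast
  fix s :: real assume "s \<in> \<rat> \<inter> {0..T}"
  then have s: "0 \<le> s" by simp
  note [measurable] = height_measurable[OF s] bounded_until_sets[OF s]
  have "(\<lambda>x. slope D (\<lambda>v. height s v (snd x)) (fst x)) \<in> borel_measurable (lborel \<Otimes>\<^sub>M P)"
    unfolding slope_def steep_def case_prod_beta
    by (intro borel_measurable_INF borel_measurable_SUP countable_SIGMA D) measurable
  then show "(\<lambda>x. indicator {\<omega> \<in> space P. bounded_until s \<omega>} (snd x) *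
      ennreal (enn2real (slope D (\<lambda>v. height s v (snd x)) (fst x)) powr q)) \<in> borel_measurable (lborel \<Otimes>\<^sub>M P)"
    by measurable
qed

lemma bounded_until_less_AE: "AE \<omega> in P. \<forall>s\<ge>0. bounded_until s \<omega> \<longrightarrow> ereal s < \<tau> \<omega>"
  using flow_paths blow_up[OF compact_image_\<sigma>]
proof eventually_elim
  case (elim \<omega>)
  then show ?case
    using less_of_bounded_until[of \<omega>] by blast
qed

lemma running_slope_le:
  assumes path: "path \<omega>" and less: "\<And>s. 0 \<le> s \<Longrightarrow> bounded_until s \<omega> \<Longrightarrow> ereal s < \<tau> \<omega>"
    and u: "u \<in> Q" and q: "0 < q"
  shows "running_slope T q u \<omega> \<le> ennreal ((4 * C) powr q) * sup_tangent_norm T q (\<sigma> u) \<omega>"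
  unfolding running_slope_def
proof (rule SUP_least)
  fix s :: real assume "s \<in> \<rat> \<inter> {0..T}"
  then have s: "0 \<le> s" "s \<in> {0..T}" by auto
  let ?tn = "tangent_norm \<A> g (\<lambda>z. \<Phi> s z \<omega>) (\<sigma> u)"
  show "indicator {\<omega> \<in> space P. bounded_until s \<omega>} \<omega> * ennreal (enn2real (slope D (\<lambda>v. height s v \<omega>) u) powr q)
      \<le> ennreal ((4 * C) powr q) * sup_tangent_norm T q (\<sigma> u) \<omega>"
  proof (cases "bounded_until s \<omega>")
    case True
    have live: "ereal s < \<xi> (\<sigma> u) \<omega>"
      by (rule alive[OF less[OF s(1) True] u])
    have tn: "0 \<le> ?tn" by (rule tangent_norm_nonneg[OF path s(1) live])
    have "enn2real (slope D (\<lambda>v. height s v \<omega>) u) powr q \<le> (4 * C * ?tn) powr q"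
      using slope_le_tangent_norm[OF path s(1) live u] q by (intro powr_mono2) auto
    also have "\<dots> = (4 * C) powr q * ?tn powr q"
      using C tn by (simp add: powr_mult)
    finally have "ennreal (enn2real (slope D (\<lambda>v. height s v \<omega>) u) powr q) \<le>
        ennreal ((4 * C) powr q) * (ennreal (?tn powr q) * indicator {s. ereal s < \<xi> (\<sigma> u) \<omega>} s)"
      using live by (simp add: ennreal_leI flip: ennreal_mult)
    also have "\<dots> \<le> ennreal ((4 * C) powr q) * sup_tangent_norm T q (\<sigma> u) \<omega>"
      by (intro mult_left_mono SUP_upper s) auto
    finally show ?thesis
      by (auto split: split_indicator)
  qed simp
qed

text \<open>For fixed \<open>u\<close> the lower integral of the derivative norm dominates the
  expectation of the measurable running slope, by monotonicity alone. The integrals over the cube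
  and over the outcomes are interchanged only for the running slope.\<close>

lemma running_slope_finite:
  assumes q: "real DIM('x) < q"
    and fin: "(SUP x\<in>\<sigma> ` Q. \<integral>\<^sup>+\<omega>. sup_tangent_norm T q x \<omega> \<partial>P) < \<infinity>"
  shows "AE \<omega> in P. (\<integral>\<^sup>+u\<in>Q. running_slope T q u \<omega> \<partial>lborel) < \<infinity>"
proof -
  define S where "S = (SUP x\<in>\<sigma> ` Q. \<integral>\<^sup>+\<omega>. sup_tangent_norm T q x \<omega> \<partial>P)"
  define a where "a = (4 * C) powr q"
  have a: "0 < a" using C by (simp add: a_def)
  have aa: "ennreal (1 / a) * ennreal a = 1" "ennreal a * ennreal (1 / a) = 1"
    using a by (simp_all flip: ennreal_mult)
  have [measurable]: "Q \<in> sets borel"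
    using Q by (simp add: compact_imp_closed)
  interpret pair_sigma_finite lborel P ..
  note [measurable] = running_slope_measurable
  have meas_u: "running_slope T q u \<in> borel_measurable P" for u
  proof -
    have "(\<lambda>\<omega>. (\<lambda>(u, \<omega>). running_slope T q u \<omega>) (u, \<omega>)) \<in> borel_measurable P"
      by measurable
    then show ?thesis by simp
  qed
  have bound: "(\<integral>\<^sup>+\<omega>. running_slope T q u \<omega> \<partial>P) \<le> ennreal a * S" if u: "u \<in> Q" for u
  proof -
    \<comment> \<open>The constant stands on the measurable side, where it can be taken out of the
      integral.\<close>
    have "AE \<omega> in P. ennreal (1 / a) * running_slope T q u \<omega> \<le> sup_tangent_norm T q (\<sigma> u) \<omega>"
      using flow_paths bounded_until_less_AE
    proof eventually_elim
      case (elim \<omega>)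
      have "running_slope T q u \<omega> \<le> ennreal a * sup_tangent_norm T q (\<sigma> u) \<omega>"
        unfolding a_def using elim q by (intro running_slope_le u) auto
      then have "ennreal (1 / a) * running_slope T q u \<omega> \<le> ennreal (1 / a) * (ennreal a * sup_tangent_norm T q (\<sigma> u) \<omega>)"
        by (rule mult_left_mono) simp
      then show ?case by (simp only: mult.assoc[symmetric] aa mult_1)
    qed
    then have "(\<integral>\<^sup>+\<omega>. ennreal (1 / a) * running_slope T q u \<omega> \<partial>P) \<le> (\<integral>\<^sup>+\<omega>. sup_tangent_norm T q (\<sigma> u) \<omega> \<partial>P)"
      by (rule nn_integral_mono_AE)
    also have "\<dots> \<le> S"
      unfolding S_def using u by (intro SUP_upper) auto
    finally have "ennreal (1 / a) * (\<integral>\<^sup>+\<omega>. running_slope T q u \<omega> \<partial>P) \<le> S"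
      by (simp add: nn_integral_cmult[OF meas_u])
    then have "ennreal a * (ennreal (1 / a) * (\<integral>\<^sup>+\<omega>. running_slope T q u \<omega> \<partial>P)) \<le> ennreal a * S"
      by (rule mult_left_mono) simp
    then show ?thesis by (simp only: mult.assoc[symmetric] aa mult_1)
  qed
  have "(\<integral>\<^sup>+\<omega>. (\<integral>\<^sup>+u\<in>Q. running_slope T q u \<omega> \<partial>lborel) \<partial>P) =
      (\<integral>\<^sup>+u. (\<integral>\<^sup>+\<omega>. running_slope T q u \<omega> * indicator Q u \<partial>P) \<partial>lborel)"
    by (intro Fubini') measurable
  also have "\<dots> = (\<integral>\<^sup>+u. (\<integral>\<^sup>+\<omega>. running_slope T q u \<omega> \<partial>P) * indicator Q u \<partial>lborel)"
    by (intro nn_integral_cong nn_integral_multc meas_u)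
  also have "\<dots> \<le> (\<integral>\<^sup>+u. ennreal a * S * indicator Q u \<partial>lborel)"
    using bound by (intro nn_integral_mono) (auto split: split_indicator)
  also have "\<dots> = ennreal a * S"
    using Q by (simp add: nn_integral_cmult_indicator)
  also have "\<dots> < \<infinity>"
    using fin unfolding S_def by (simp add: ennreal_mult_less_top)
  finally have "(\<integral>\<^sup>+\<omega>. (\<integral>\<^sup>+u\<in>Q. running_slope T q u \<omega> \<partial>lborel) \<partial>P) \<noteq> \<infinity>"
    by simp
  moreover have "(\<lambda>\<omega>. \<integral>\<^sup>+u\<in>Q. running_slope T q u \<omega> \<partial>lborel) \<in> borel_measurable P"
    using measurable_pair_swap[OF running_slope_measurable[of T q]]
    by (intro lborel.borel_measurable_nn_integral) (simp add: case_prod_beta)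
  ultimately have "AE \<omega> in P. (\<integral>\<^sup>+u\<in>Q. running_slope T q u \<omega> \<partial>lborel) \<noteq> \<infinity>"
    by (intro nn_integral_PInf_AE)
  then show ?thesis
    by eventually_elim (simp add: less_top)
qed

text \<open>If the cube exploded at \<open>T\<close>, the height at \<open>u\<close> would be
  bounded on [0,T] and the oscillation over the cube would be at most the same \<open>B\<close> at
  every rational time before \<open>T\<close>. This contradicts the blow-up at
  \<open>T\<close>.\<close>

lemma no_explosion_path:
  assumes \<omega>: "\<omega> \<in> space P" and path: "path \<omega>"
    and blow: "\<tau> \<omega> < \<infinity> \<Longrightarrow> ((\<lambda>t. SUP x\<in>\<sigma> ` Q. ereal (d y0 (\<Phi> t x \<omega>))) \<longlongrightarrow> \<infinity>) (at_left (real_of_ereal (\<tau> \<omega>)))"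
    and u: "u \<in> Q" "\<xi> (\<sigma> u) \<omega> = \<infinity>"
    and q: "\<And>n::nat. real DIM('x) < q n"
    and fin: "\<And>n::nat. (\<integral>\<^sup>+u\<in>Q. running_slope (real (Suc n)) (q n) u \<omega> \<partial>lborel) < \<infinity>"
  shows "\<tau> \<omega> = \<infinity>"
proof (rule ccontr)
  assume "\<tau> \<omega> \<noteq> \<infinity>"
  moreover have "0 < \<tau> \<omega>"
    by (rule explosion_time_pos[OF path compact_image_\<sigma>])
  ultimately obtain T where T: "\<tau> \<omega> = ereal T" "0 < T"
    by (cases "\<tau> \<omega>") auto
  obtain n where n: "T \<le> real (Suc n)"
    by (metis less_imp_le real_arch_simple le_SucI of_nat_le_iff order_trans)
  define J where "J = (\<integral>\<^sup>+u\<in>Q. running_slope (real (Suc n)) (q n) u \<omega> \<partial>lborel)"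
  define \<beta> where "\<beta> = (real DIM('x) + q n) / 2 - 1"
  define B where "B = ennreal (2 * diameter Q) *
   (ennreal (1 / (\<beta> - real DIM('x) + 1)) * J + ennreal (1 / (1 - \<beta> / (q n - 1))))"
  have "B < \<infinity>"
    using fin[of n] unfolding B_def J_def[symmetric] by (simp add: ennreal_mult_less_top)
  \<comment> \<open>Since \<open>\<sigma> u\<close> never explodes, its trajectory is bounded on the
    closed interval up to and including \<open>T\<close>.\<close>
  have "ereal T < \<xi> x \<omega>" if "x \<in> {\<sigma> u}" for x
    using that u by simp
  from flow_path_bounded[OF path _ this] obtain R0 where R0: "\<And>r. r \<in> {0..T} \<Longrightarrow> d y0 (\<Phi> r (\<sigma> u) \<omega>) \<le> R0"
    by (metis compact_sing singletonI)
  have "(SUP x\<in>\<sigma> ` Q. ereal (d y0 (\<Phi> r x \<omega>))) \<le> ereal (R0 + enn2real B)"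
    if r: "r \<in> \<rat>" "0 < r" "r < T" for r
  proof -
    have r\<tau>: "0 \<le> r" "ereal r < \<tau> \<omega>" using r T by auto
    have bu: "bounded_until r \<omega>" by (rule bounded_until_of_less[OF path r\<tau>])
    have "(\<integral>\<^sup>+w\<in>Q. ennreal (enn2real (slope D (\<lambda>v. height r v \<omega>) w) powr q n) \<partial>lborel) \<le> J"
      unfolding J_def
    proof (intro nn_integral_mono mult_right_mono)
      fix w
      show "ennreal (enn2real (slope D (\<lambda>v. height r v \<omega>) w) powr q n) \<le> running_slope (real (Suc n)) (q n) w \<omega>"
        unfolding running_slope_def using r n bu \<omega> by (intro SUP_upper2[of r]) auto
    qed simp
    then have osc: "ennreal \<bar>height r u \<omega> - height r v \<omega>\<bar> \<le> B" if "v \<in> Q" for v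
      unfolding B_def \<beta>_def
      by (intro order_trans[OF height_oscillation[OF path r\<tau> u(1) that q[of n]]] mult_left_mono add_right_mono) auto
    have "height r v \<omega> \<le> R0 + enn2real B" if "v \<in> D" for v
    proof -
      have "\<bar>height r u \<omega> - height r v \<omega>\<bar> \<le> enn2real B"
        using osc[of v] that D(2) \<open>B < \<infinity>\<close> by (cases B) auto
      moreover have "height r u \<omega> \<le> R0"
        using R0[of r] r height_alive[OF r\<tau>(2) u(1)] by simp
      ultimately show ?thesis by linarith
    qed
    then show ?thesis by (rule SUP_dist_le[OF path r\<tau>])
  qed
  moreover have "((\<lambda>t. SUP x\<in>\<sigma> ` Q. ereal (d y0 (\<Phi> t x \<omega>))) \<longlongrightarrow> \<infinity>) (at_left T)"
    using blow T by simp
  from tendsto_infinity_at_left_rational[OF this T(2)] obtain r where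
    "r \<in> \<rat>" "0 < r" "r < T" "ereal (R0 + enn2real B) < (SUP x\<in>\<sigma> ` Q. ereal (d y0 (\<Phi> r x \<omega>)))"
    by blast
  ultimately show False
    by (simp add: leD)
qed

lemma no_explosion:
  assumes u: "u \<in> Q" "AE \<omega> in P. \<xi> (\<sigma> u) \<omega> = \<infinity>"
    and moments: "\<And>T. 0 < T \<Longrightarrow> \<exists>q>real DIM('x). (SUP x\<in>\<sigma> ` Q. \<integral>\<^sup>+\<omega>. sup_tangent_norm T q x \<omega> \<partial>P) < \<infinity>"
  shows "AE \<omega> in P. \<tau> \<omega> = \<infinity>"
proof -
  \<comment> \<open>The exponent may depend on the horizon, and the horizon needed depends on the
    outcome; integer horizons leave countably many null sets.\<close>
  have "\<exists>q. real DIM('x) < q \<and> (SUP x\<in>\<sigma> ` Q. \<integral>\<^sup>+\<omega>. sup_tangent_norm (real (Suc n)) q x \<omega> \<partial>P) < \<infinity>" for n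
    using moments[of "real (Suc n)"] by simp
  then obtain q where q: "\<forall>n. real DIM('x) < q n \<and> (SUP x\<in>\<sigma> ` Q. \<integral>\<^sup>+\<omega>. sup_tangent_norm (real (Suc n)) (q n) x \<omega> \<partial>P) < \<infinity>"
    by (rule exE[OF choice[OF allI]])
  have "AE \<omega> in P. \<forall>n. (\<integral>\<^sup>+u\<in>Q. running_slope (real (Suc n)) (q n) u \<omega> \<partial>lborel) < \<infinity>"
    unfolding AE_all_countable using running_slope_finite[OF conjunct1[OF spec[OF q]] conjunct2[OF spec[OF q]]] by blast
  with u(2) flow_paths blow_up[OF compact_image_\<sigma>] AE_space show ?thesis
  proof eventually_elim
    case (elim \<omega>)
    show ?case
      using elim by (intro no_explosion_path[OF _ _ _ u(1) _ conjunct1[OF spec[OF q]]]) auto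
  qed
qed

end

section \<open>Spreading non-explosion from one point to cubes and to the whole manifold\<close>

context stochastic_flow begin

lemma no_explosion_on_cube:
  fixes \<sigma> :: "real ^ 'p::finite \<Rightarrow> 'a"
  defines "Q \<equiv> {u :: real ^ 'p. \<forall>i. 0 \<le> u $ i \<and> u $ i \<le> 1}"
  assumes \<sigma>: "\<And>u v. u \<in> Q \<Longrightarrow> v \<in> Q \<Longrightarrow> d (\<sigma> u) (\<sigma> v) \<le> C * dist u v"
    and u: "u \<in> Q" "AE \<omega> in P. \<xi> (\<sigma> u) \<omega> = \<infinity>"
    and moments: "\<And>T K. 0 < T \<Longrightarrow> compact K \<Longrightarrow> \<exists>q>real CARD('p).
      (SUP x\<in>K. \<integral>\<^sup>+\<omega>. sup_tangent_norm T q x \<omega> \<partial>P) < \<infinity>"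
  shows "AE \<omega> in P. (INF x\<in>\<sigma> ` Q. \<xi> x \<omega>) = \<infinity>"
proof -
  have Q: "Q = cbox 0 1"
    by (auto simp: Q_def mem_box_cart)
  have "emeasure lborel Q = (\<Prod>b\<in>Basis. (1 - 0 :: real ^ 'p) \<bullet> b)"
    unfolding Q by (intro emeasure_lborel_cbox) (auto simp: Basis_vec_def inner_axis)
  also have "(\<Prod>b\<in>Basis. (1 - 0 :: real ^ 'p) \<bullet> b) = 1"
    by (intro prod.neutral) (auto simp: Basis_vec_def inner_axis)
  finally have Q1: "emeasure lborel Q = 1" by simp
  obtain D where D: "countable D" "D \<subseteq> Q" "Q \<subseteq> closure D"
    by (rule separable)
  \<comment> \<open>The locale wants a positive Lipschitz constant, and \<open>C\<close> may have
    any sign. The base point of the height is arbitrary.\<close>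
  interpret stochastic_cube \<A> g P \<xi> \<Phi> Q D \<sigma> "\<bar>C\<bar> + 1" "\<sigma> u"
  proof
    show "compact Q" "convex Q" by (auto simp: Q)
    show "d (\<sigma> u) (\<sigma> v) \<le> (\<bar>C\<bar> + 1) * dist u v" if "u \<in> Q" "v \<in> Q" for u v
      by (rule order_trans[OF \<sigma>[OF that]]) (auto intro!: mult_right_mono)
  qed (use Q1 D in auto)
  show ?thesis
    using moments[OF _ compact_image_\<sigma>] by (intro no_explosion[OF u]) auto
qed

text \<open>Segments in charts are regarded as degenerate cubes of dimension \<open>p\<close>.\<close>

lemma no_explosion_everywhere:
  assumes x\<^sub>0: "AE \<omega> in P. \<xi> x\<^sub>0 \<omega> = \<infinity>"
    and moments: "\<And>T K. 0 < T \<Longrightarrow> compact K \<Longrightarrow> \<exists>q>real CARD('p::finite).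
      (SUP x\<in>K. \<integral>\<^sup>+\<omega>. sup_tangent_norm T q x \<omega> \<partial>P) < \<infinity>"
  shows "AE \<omega> in P. \<xi> x \<omega> = \<infinity>"
proof (rule connected_UNIV_induct[where P="\<lambda>x. AE \<omega> in P. \<xi> x \<omega> = \<infinity>", OF conn x\<^sub>0])
  fix x
  define c where "c = chart_at \<A> x"
  have c: "c \<in> \<A>" "x \<in> dom_chart c" by (simp_all add: c_def chart_at)
  obtain R where R: "0 < R" "ball (coord c x) R \<subseteq> img c"
    "\<And>p q. p \<in> ball (coord c x) R \<Longrightarrow> q \<in> ball (coord c x) R \<Longrightarrow>
       d (coord_inv c p) (coord_inv c q) \<le> 2 * rnorm g x (q - p)"
    using dist_upper[of x] unfolding c_def by blast
  have step: "AE \<omega> in P. \<xi> (coord_inv c q) \<omega> = \<infinity>"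
    if p: "p \<in> ball (coord c x) R" and q: "q \<in> ball (coord c x) R"
      and AE_p: "AE \<omega> in P. \<xi> (coord_inv c p) \<omega> = \<infinity>" for p q
  proof -
    define Q where "Q = {u :: real ^ 'p. \<forall>i. 0 \<le> u $ i \<and> u $ i \<le> 1}"
    \<comment> \<open>Any coordinate serves. The corners 0 and 1 of the cube are sent to
      \<open>p\<close> and \<open>q\<close>.\<close>
    define k :: 'p where "k = undefined"
    define \<gamma> where "\<gamma> u = p + (u $ k) *\<^sub>R (q - p)" for u :: "real ^ 'p"
    have \<gamma>: "\<gamma> u \<in> ball (coord c x) R" if "u \<in> Q" for u
    proof -
      have "(1 - u $ k) *\<^sub>R p + (u $ k) *\<^sub>R q \<in> ball (coord c x) R"
        using that p q by (intro convexD[OF convex_ball]) (auto simp: Q_def)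
      then show ?thesis by (simp add: \<gamma>_def algebra_simps)
    qed
    have "d (coord_inv c (\<gamma> u)) (coord_inv c (\<gamma> v)) \<le> 2 * rnorm g x (q - p) * dist u v"
      if "u \<in> Q" "v \<in> Q" for u v
    proof -
      have "d (coord_inv c (\<gamma> u)) (coord_inv c (\<gamma> v)) \<le> 2 * rnorm g x (\<gamma> v - \<gamma> u)"
        by (intro R(3) \<gamma> that)
      also have "\<gamma> v - \<gamma> u = (v $ k - u $ k) *\<^sub>R (q - p)"
        by (simp add: \<gamma>_def algebra_simps)
      also have "rnorm g x ((v $ k - u $ k) *\<^sub>R (q - p)) = \<bar>(v - u) $ k\<bar> * rnorm g x (q - p)"
        by (simp add: rnorm_def inner_form_scale[OF inner_form_metric])
      also have "2 * (\<bar>(v - u) $ k\<bar> * rnorm g x (q - p)) \<le> 2 * (dist u v * rnorm g x (q - p))"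
        using component_le_norm_cart[of "v - u" k]
        by (intro mult_left_mono mult_right_mono)
          (auto simp: dist_norm norm_minus_commute rnorm_def inner_form_nonneg[OF inner_form_metric])
      finally show ?thesis by (simp add: mult_ac)
    qed
    moreover have "(0 :: real ^ 'p) \<in> Q" "(1 :: real ^ 'p) \<in> Q"
      by (auto simp: Q_def)
    moreover have "AE \<omega> in P. \<xi> (coord_inv c (\<gamma> 0)) \<omega> = \<infinity>"
      using AE_p by (simp add: \<gamma>_def)
    ultimately have "AE \<omega> in P. (INF x\<in>(\<lambda>u. coord_inv c (\<gamma> u)) ` Q. \<xi> x \<omega>) = \<infinity>"
      unfolding Q_def by (intro no_explosion_on_cube[where u=0] moments) auto
    then show ?thesis
    proof eventually_elim
      case (elim \<omega>)
      have "(INF x\<in>(\<lambda>u. coord_inv c (\<gamma> u)) ` Q. \<xi> x \<omega>) \<le> \<xi> (coord_inv c (\<gamma> 1)) \<omega>"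
        using \<open>1 \<in> Q\<close> by (intro INF_lower) auto
      then show ?case using elim by (simp add: \<gamma>_def)
    qed
  qed
  have x: "coord c x \<in> ball (coord c x) R" "coord_inv c (coord c x) = x"
    using R coord_inv_coord[OF c] by auto
  show "\<exists>U. open U \<and> x \<in> U \<and> (\<forall>y\<in>U. (AE \<omega> in P. \<xi> x \<omega> = \<infinity>) \<longleftrightarrow> (AE \<omega> in P. \<xi> y \<omega> = \<infinity>))"
  proof (intro exI[of _ "coord_inv c ` ball (coord c x) R"] conjI ballI)
    show "open (coord_inv c ` ball (coord c x) R)"
      by (rule open_coord_inv_image[OF c(1) _ R(2)]) auto
    show "x \<in> coord_inv c ` ball (coord c x) R"
      using x by (intro rev_image_eqI[of "coord c x"]) auto
    fix y assume "y \<in> coord_inv c ` ball (coord c x) R"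
    then obtain q where q: "q \<in> ball (coord c x) R" "y = coord_inv c q" by blast
    show "(AE \<omega> in P. \<xi> x \<omega> = \<infinity>) \<longleftrightarrow> (AE \<omega> in P. \<xi> y \<omega> = \<infinity>)"
      using step[OF x(1) q(1)] step[OF q(1) x(1)] unfolding x(2) q(2) by blast
  qed
qed

lemma jointly_continuous_on:
  assumes K: "AE \<omega> in P. (INF x\<in>K. \<xi> x \<omega>) = \<infinity>"
  shows "AE \<omega> in P. continuous_on ({0..} \<times> K) (\<lambda>(t, x). \<Phi> t x \<omega>)"
  using K flow_paths
proof eventually_elim
  case (elim \<omega>)
  have "\<xi> x \<omega> = \<infinity>" if "x \<in> K" for x
    using INF_lower[OF that, of "\<lambda>x. \<xi> x \<omega>"] elim(1) by simp
  then show ?case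
    by (intro continuous_on_subset[OF flow_path_jointly_continuous[OF elim(2)]]) auto
qed

end

section \<open>Smooth simplices\<close>

lemma corner_simplex_subset_cube: "corner_simplex \<subseteq> {u :: real ^ 'p::finite. \<forall>i. 0 \<le> u $ i \<and> u $ i \<le> 1}"
proof
  fix u :: "real ^ 'p" assume u: "u \<in> corner_simplex"
  have "u $ i \<le> (\<Sum>i\<in>UNIV. u $ i)" for i
    using u by (intro member_le_sum) (auto simp: corner_simplex_def)
  then show "u \<in> {u. \<forall>i. 0 \<le> u $ i \<and> u $ i \<le> 1}"
    using u by (auto simp: corner_simplex_def intro: order_trans)
qed

lemma
  shows convex_corner_simplex: "convex (corner_simplex :: (real ^ 'p::finite) set)"
    and compact_corner_simplex: "compact (corner_simplex :: (real ^ 'p::finite) set)"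
proof -
  let ?S = "corner_simplex :: (real ^ 'p) set"
  show "convex ?S"
  proof (rule convexI)
    fix u v :: "real ^ 'p" and a b :: real
    assume *: "u \<in> ?S" "v \<in> ?S" "0 \<le> a" "0 \<le> b" "a + b = 1"
    have "(\<Sum>i\<in>UNIV. (a *\<^sub>R u + b *\<^sub>R v) $ i) = a * (\<Sum>i\<in>UNIV. u $ i) + b * (\<Sum>i\<in>UNIV. v $ i)"
      by (simp add: sum.distrib sum_distrib_left)
    also have "\<dots> \<le> a * 1 + b * 1"
      using * by (intro add_mono mult_left_mono) (auto simp: corner_simplex_def)
    finally show "a *\<^sub>R u + b *\<^sub>R v \<in> ?S"
      using * by (auto simp: corner_simplex_def)
  qed
  have eq: "?S = (\<Inter>i. {u. 0 \<le> u $ i}) \<inter> {u. (\<Sum>i\<in>UNIV. u $ i) \<le> 1}"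
    by (auto simp: corner_simplex_def)
  have "closed ?S"
    unfolding eq by (intro closed_Int closed_INT ballI closed_Collect_le continuous_intros)
  moreover have "?S \<subseteq> cbox 0 1"
    using corner_simplex_subset_cube[where 'p='p] by (auto simp: mem_box_cart subset_iff)
  ultimately show "compact ?S"
    by (metis bounded_cbox bounded_subset compact_eq_bounded_closed)
qed

context riemannian_manifold begin

text \<open>Smoothness on an open neighbourhood gives local Lipschitz bounds even at boundary
  points; compactness and convexity of the simplex make them global.\<close>

lemma smooth_simplex_lipschitz:
  fixes \<sigma> :: "real ^ 'p::finite \<Rightarrow> 'a"
  assumes W: "open W" "corner_simplex \<subseteq> W" and cont: "continuous_on W \<sigma>"
    and smooth: "\<And>c. c \<in> \<A> \<Longrightarrow> Ck_on 1 (W \<inter> \<sigma> -` dom_chart c) (coord c \<circ> \<sigma>)"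
  obtains C where "\<And>u v. u \<in> corner_simplex \<Longrightarrow> v \<in> corner_simplex \<Longrightarrow> d (\<sigma> u) (\<sigma> v) \<le> C * dist u v"
proof -
  have loc: "\<exists>M. \<exists>e>0. \<forall>v\<in>corner_simplex \<inter> ball u e. \<forall>w\<in>corner_simplex \<inter> ball u e. d (\<sigma> v) (\<sigma> w) \<le> M * dist v w"
    if u: "u \<in> corner_simplex" for u
  proof -
    define c where "c = chart_at \<A> (\<sigma> u)"
    have c: "c \<in> \<A>" "\<sigma> u \<in> dom_chart c" by (simp_all add: c_def chart_at)
    obtain R where R: "0 < R" "ball (coord c (\<sigma> u)) R \<subseteq> img c"
      "\<And>p q. p \<in> ball (coord c (\<sigma> u)) R \<Longrightarrow> q \<in> ball (coord c (\<sigma> u)) R \<Longrightarrow>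
         d (coord_inv c p) (coord_inv c q) \<le> 2 * rnorm g (\<sigma> u) (q - p)"
      using dist_upper[of "\<sigma> u"] unfolding c_def by blast
    obtain M where M: "0 < M" "\<And>v. rnorm g (\<sigma> u) v \<le> M * norm v"
      using inner_form_equiv_norm[OF inner_form_metric] unfolding rnorm_def by metis
    let ?f = "coord c \<circ> \<sigma>" and ?S = "W \<inter> \<sigma> -` dom_chart c"
    have S: "open ?S" "u \<in> ?S"
      using continuous_open_preimage[OF cont W(1) open_dom[OF c(1)]] u W(2) c by auto
    obtain \<delta> where \<delta>: "0 < \<delta>" "ball u \<delta> \<subseteq> ?S"
      "\<And>y z. y \<in> ball u \<delta> \<Longrightarrow> z \<in> ball u \<delta> \<Longrightarrow>
         norm (?f z - ?f y - frechet_derivative ?f (at u) (z - y)) \<le> 1 * norm (z - y)"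
      using C1_strictly_differentiable[OF smooth[OF c(1)] S zero_less_one] by blast
    have "?f differentiable (at u)"
      using smooth[OF c(1)] S(2) by auto
    then obtain B where B: "0 < B" "\<And>v. norm (frechet_derivative ?f (at u) v) \<le> B * norm v"
      using linear_bounded_pos[OF linear_frechet_derivative] by blast
    have lip: "norm (?f z - ?f y) \<le> (B + 1) * norm (z - y)" if "y \<in> ball u \<delta>" "z \<in> ball u \<delta>" for y z
    proof -
      let ?a = "frechet_derivative ?f (at u) (z - y)"
      have "norm (?f z - ?f y) \<le> norm (?f z - ?f y - ?a) + norm ?a"
        by (rule norm_triangle_sub[of "?f z - ?f y" ?a, THEN order_trans]) simp
      also have "\<dots> \<le> 1 * norm (z - y) + B * norm (z - y)"
        by (intro add_mono \<delta>(3) that B(2))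
      finally show ?thesis by (simp add: algebra_simps)
    qed
    \<comment> \<open>In coordinates the map has Lipschitz constant \<open>B + 1\<close> near
      \<open>u\<close>, the 1 being the tolerance of strict differentiability; with this radius the
      image stays in the ball of \<open>dist_upper\<close>.\<close>
    define e where "e = min \<delta> (R / (B + 1))"
    have e: "0 < e" "e \<le> \<delta>" "(B + 1) * e \<le> R"
    proof -
      show "0 < e" "e \<le> \<delta>"
        using \<delta>(1) R(1) B(1) by (auto simp: e_def)
      have "e \<le> R / (B + 1)" by (simp add: e_def)
      then show "(B + 1) * e \<le> R"
        using B(1) by (simp add: pos_le_divide_eq mult.commute)
    qed
    have near: "?f v \<in> ball (coord c (\<sigma> u)) R \<and> \<sigma> v \<in> dom_chart c" if "v \<in> ball u e" for v
    proof -
      have v: "v \<in> ball u \<delta>" "norm (v - u) < e" using that e(2) by (auto simp: dist_norm norm_minus_commute)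
      have "norm (?f v - ?f u) \<le> (B + 1) * norm (v - u)"
        using v \<delta>(1) by (intro lip) auto
      also have "\<dots> < (B + 1) * e" using v B by (intro mult_strict_left_mono) auto
      finally show ?thesis
        using e(3) v(1) \<delta>(2) by (auto simp: dist_norm norm_minus_commute)
    qed
    have "d (\<sigma> v) (\<sigma> w) \<le> (2 * (M * (B + 1))) * dist v w" if v: "v \<in> ball u e" and w: "w \<in> ball u e" for v w
    proof -
      have "d (\<sigma> v) (\<sigma> w) \<le> 2 * rnorm g (\<sigma> u) (?f w - ?f v)"
        using R(3)[of "?f v" "?f w"] near[OF v] near[OF w] by (simp add: coord_inv_coord[OF c(1)])
      also have "\<dots> \<le> 2 * (M * norm (?f w - ?f v))"
        using M by simp
      also have "\<dots> \<le> 2 * (M * ((B + 1) * norm (w - v)))"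
        using lip[of v w] v w e(2) M by (intro mult_left_mono) auto
      finally show ?thesis by (simp add: dist_norm norm_minus_commute mult.assoc)
    qed
    then show ?thesis using e(1) by blast
  qed
  show ?thesis
    by (rule locally_lipschitz_imp_lipschitz[OF compact_corner_simplex convex_corner_simplex
          dist_triangle_inequality loc]) (assumption, rule that)
qed

end

text \<open>The nearest-point projection onto the convex simplex has Lipschitz constant 1 and fixes
  the simplex. Composed with \<open>\<sigma>\<close>, it gives a Lipschitz map on the cube with the
  same image.\<close>

lemma smooth_simplex_images_subset:
  assumes "riemannian_manifold \<A> g"
  shows "smooth_simplex_images \<A> TYPE('p::finite) \<subseteq> lipschitz_cube_images \<A> g TYPE('p)"
proof
  interpret riemannian_manifold \<A> g by fact
  let ?Q = "{u :: real ^ 'p. \<forall>i. 0 \<le> u $ i \<and> u $ i \<le> 1}" and ?S = "corner_simplex :: (real ^ 'p) set"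
  fix K assume "K \<in> smooth_simplex_images \<A> TYPE('p)"
  then obtain \<sigma> :: "real ^ 'p \<Rightarrow> 'a" and W where K: "K = \<sigma> ` ?S"
    and W: "open W" "?S \<subseteq> W" "continuous_on W \<sigma>"
    and smooth: "\<And>c k. c \<in> \<A> \<Longrightarrow> Ck_on k (W \<inter> \<sigma> -` dom_chart c) (coord c \<circ> \<sigma>)"
    unfolding smooth_simplex_images_def by blast
  obtain C where C: "\<And>u v. u \<in> ?S \<Longrightarrow> v \<in> ?S \<Longrightarrow> d (\<sigma> u) (\<sigma> v) \<le> C * dist u v"
    using smooth_simplex_lipschitz[OF W smooth] by metis
  have "0 \<in> ?S" by (simp add: corner_simplex_def)
  then have S: "closed ?S" "?S \<noteq> {}"
    using compact_corner_simplex compact_imp_closed by blast+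
  define \<rho> where "\<rho> = closest_point ?S"
  have \<rho>: "\<rho> u \<in> ?S" for u
    unfolding \<rho>_def by (rule closest_point_in_set[OF S])
  have \<rho>_fix: "\<rho> u = u" if "u \<in> ?S" for u
    unfolding \<rho>_def by (rule closest_point_self[OF that])
  have "K = (\<sigma> \<circ> \<rho>) ` ?Q"
    unfolding K image_comp[symmetric]
    using \<rho> \<rho>_fix corner_simplex_subset_cube[where 'p='p] by (intro arg_cong[of _ _ "image \<sigma>"]) force
  moreover have "d ((\<sigma> \<circ> \<rho>) u) ((\<sigma> \<circ> \<rho>) v) \<le> \<bar>C\<bar> * dist u v" for u v
  proof -
    have "d (\<sigma> (\<rho> u)) (\<sigma> (\<rho> v)) \<le> C * dist (\<rho> u) (\<rho> v)"
      by (rule C[OF \<rho> \<rho>])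
    also have "\<dots> \<le> \<bar>C\<bar> * dist (\<rho> u) (\<rho> v)"
      by (intro mult_right_mono) auto
    also have "\<dots> \<le> \<bar>C\<bar> * dist u v"
      unfolding \<rho>_def using closest_point_lipschitz[OF convex_corner_simplex S]
      by (intro mult_left_mono) auto
    finally show ?thesis by simp
  qed
  ultimately show "K \<in> lipschitz_cube_images \<A> g TYPE('p)"
    unfolding lipschitz_cube_images_def by blast
qed

section \<open>The flow of the equation and the conclusion\<close>

lemma sde_flow_stochastic_flow:
  assumes "riemannian_manifold \<A> g" and P: "filtered_prob_space P \<F>"
    and flow: "sde_flow \<A> g P \<F> B X V \<xi> F"
  shows "stochastic_flow \<A> g P \<xi> F"
proof -
  interpret riemannian_manifold \<A> g by fact
  interpret prob_space P using P by (simp add: filtered_prob_space_def)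
  have pf: "partial_flow \<A> g P \<xi> F"
    using flow by (simp add: sde_flow_def)
  show ?thesis
  proof
    fix t :: real and x and U :: "'a set" assume "0 \<le> t" "open U"
    then have "{\<omega> \<in> space P. ereal t < \<xi> x \<omega> \<and> F t x \<omega> \<in> U} \<in> sets (\<F> t)"
      using flow unfolding sde_flow_def maximal_sde_solution_def sde_solution_def by blast
    moreover have "subalgebra P (\<F> t)"
      using P by (simp add: filtered_prob_space_def)
    ultimately show "{\<omega> \<in> space P. ereal t < \<xi> x \<omega> \<and> F t x \<omega> \<in> U} \<in> sets P"
      unfolding subalgebra_def by blast
  next
    show "AE \<omega> in P. flow_path (\<lambda>x. \<xi> x \<omega>) (\<lambda>t x. F t x \<omega>)"
      using pf unfolding partial_flow_def flow_path_def live_set_def by blast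
  next
    fix K :: "'a set" assume "compact K"
    then show "AE \<omega> in P. (INF x\<in>K. \<xi> x \<omega>) < \<infinity> \<longrightarrow>
       (\<forall>b. ((\<lambda>t. SUP x\<in>K. ereal (d b (F t x \<omega>))) \<longlongrightarrow> \<infinity>) (at_left (real_of_ereal (INF x\<in>K. \<xi> x \<omega>))))"
      using pf unfolding partial_flow_def explosion_time_on_def by blast
  qed
qed

theorem theorem4p1:
  fixes \<A> :: "('a::{t2_space, second_countable_topology}, 'e::euclidean_space) chart set"
    and g :: "'a \<Rightarrow> 'e \<Rightarrow> 'e \<Rightarrow> real"
    and P :: "'w measure"
    and \<F> :: "real \<Rightarrow> 'w measure"
    and B :: "real \<Rightarrow> 'w \<Rightarrow> 'b::euclidean_space"
    and X :: "'a \<Rightarrow> 'b \<Rightarrow> 'e"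
    and V :: "'a \<Rightarrow> 'e"
    and \<xi> :: "'a \<Rightarrow> 'w \<Rightarrow> ereal"
    and F :: "real \<Rightarrow> 'a \<Rightarrow> 'w \<Rightarrow> 'a"
    and p :: nat
  assumes "smooth_atlas \<A>"
    and "riemannian_metric \<A> g"
    and "connected (UNIV :: 'a set)"
    and "Metric_space.mcomplete UNIV (riemannian_dist \<A> g)"
    and "p = CARD('p::finite)" and "1 \<le> p" and "p \<le> DIM('e)"
    and "filtered_prob_space P \<F>"
    and "brownian_motion P \<F> B"
    and "Ck_linear_fields 2 \<A> X"
    and "Ck_vector_field 2 \<A> V"
    and "sde_flow \<A> g P \<F> B X V \<xi> F"
    and "complete_at_one_point P \<xi>"
    and moments: "\<And>t K. 0 < t \<Longrightarrow> compact K \<Longrightarrow>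
      \<exists>\<delta>>0. (SUP x\<in>K. \<integral>\<^sup>+\<omega>. (SUP s\<in>{0..t}.
          ennreal (tangent_norm \<A> g (\<lambda>z. F s z \<omega>) x powr (real p + \<delta>)) *
          indicator {s. ereal s < \<xi> x \<omega>} s) \<partial>completion P) < \<infinity>"
  shows "(\<forall>K\<in>lipschitz_cube_images \<A> g TYPE('p). AE \<omega> in P. explosion_time_on \<xi> K \<omega> = \<infinity>)
    \<and> strongly_p_complete \<A> P \<xi> F TYPE('p)"
proof -
  have mfd: "riemannian_manifold \<A> g"
    using assms(1-3) by unfold_locales
  interpret stochastic_flow \<A> g P \<xi> F
    by (rule sde_flow_stochastic_flow[OF mfd assms(8,12)])
  \<comment> \<open>Lower integrals with respect to \<open>P\<close> and to its completion coincide,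
    also for functions that are not measurable.\<close>
  have moments': "\<exists>q>real CARD('p). (SUP x\<in>K. \<integral>\<^sup>+\<omega>. sup_tangent_norm T q x \<omega> \<partial>P) < \<infinity>"
    if TK: "0 < T" "compact K" for T K
  proof -
    obtain \<delta> where "0 < \<delta>" "(SUP x\<in>K. \<integral>\<^sup>+\<omega>. (SUP s\<in>{0..T}.
        ennreal (tangent_norm \<A> g (\<lambda>z. F s z \<omega>) x powr (real p + \<delta>)) *
        indicator {s. ereal s < \<xi> x \<omega>} s) \<partial>completion P) < \<infinity>"
      using moments[OF TK] by blast
    then show ?thesis
      using \<open>p = CARD('p)\<close> by (intro exI[of _ "real p + \<delta>"]) (simp add: nn_integral_completion)
  qed
  obtain x\<^sub>0 where x\<^sub>0: "AE \<omega> in P. \<xi> x\<^sub>0 \<omega> = \<infinity>"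
    using assms(13) unfolding complete_at_one_point_def by blast
  have everywhere: "AE \<omega> in P. \<xi> x \<omega> = \<infinity>" for x
    by (rule no_explosion_everywhere[OF x\<^sub>0 moments'])
  have lipschitz: "AE \<omega> in P. explosion_time_on \<xi> K \<omega> = \<infinity>" if K: "K \<in> lipschitz_cube_images \<A> g TYPE('p)" for K
  proof -
    let ?Q = "{u :: real ^ 'p. \<forall>i. 0 \<le> u $ i \<and> u $ i \<le> 1}"
    obtain \<sigma> :: "real ^ 'p \<Rightarrow> 'a" and C where \<sigma>: "K = \<sigma> ` ?Q"
      "\<forall>u v. (\<forall>i. 0 \<le> u $ i \<and> u $ i \<le> 1) \<and> (\<forall>i. 0 \<le> v $ i \<and> v $ i \<le> 1) \<longrightarrow> d (\<sigma> u) (\<sigma> v) \<le> C * dist u v"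
      using K unfolding lipschitz_cube_images_def by blast
    have "AE \<omega> in P. (INF x\<in>\<sigma> ` ?Q. \<xi> x \<omega>) = \<infinity>"
      by (rule no_explosion_on_cube[where u=0 and C=C, OF _ _ everywhere moments']) (use \<sigma>(2) in auto)
    then show ?thesis
      by (simp add: explosion_time_on_def \<sigma>(1))
  qed
  \<comment> \<open>The flow is its own continuous version: where nothing explodes on
    \<open>K\<close>, its paths are jointly continuous already.\<close>
  have "strongly_p_complete \<A> P \<xi> F TYPE('p)"
    unfolding strongly_p_complete_def
  proof (intro ballI exI[of _ F] conjI)
    fix K assume "K \<in> smooth_simplex_images \<A> TYPE('p)"
    then have K: "AE \<omega> in P. (INF x\<in>K. \<xi> x \<omega>) = \<infinity>"
      using lipschitz smooth_simplex_images_subset[OF mfd] unfolding explosion_time_on_def by blast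
    show "AE \<omega> in P. continuous_on ({0..} \<times> K) (\<lambda>(t, x). F t x \<omega>)"
      by (rule jointly_continuous_on[OF K])
    show "AE \<omega> in P. \<xi> x \<omega> = \<infinity> \<and> (\<forall>t\<ge>0. F t x \<omega> = F t x \<omega>)" for x
      using everywhere[of x] by simp
  qed
  with lipschitz show ?thesis by blast
qed

end
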